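(* Let $X \subset \mathbb{P}^3$ be a general cubic surface over $\mathbb{C}$. Then the locus $$\mathcal{W}_{\mathrm{N}}(X) = \{L \in \mathbb{P}^3 \smallsetminus X \mid M(\pi_L) \neq S_3\}$$ of non-uniform points is empty.
   Context: All varieties are over $\mathbb{C}$. "General" means: for all $X$ in some dense Zariski-open subset of the projective space $\mathbb{P}^{19}$ parametrizing cubic surfaces in $\mathbb{P}^3$. Let $f: X \to Y$ be a generically finite dominant map of degree $d$ between irreducible complex algebraic varieties of the same dimension. Choose a dense open $U \subset Y$ over which $f$ is an étale covering and a point $y \in U$. Lifting loops gives a homomorphism $\rho: \pi_1(U,y) \to \operatorname{Aut}(f^{-1}(y)) \cong S_d$, where $S_d$ is the symmetric group on $d$ elements; its image $M(f)$ is the monodromy group of $f$ (up to identification independent of $U$ and $y$). For a point $L \in \mathbb{P}^3$, let $\pi_L : \mathbb{P}^3 \dashrightarrow \mathbb{P}^2_L$ be the projection from $L$, sending $x \neq L$ to the line $\langle x, L\rangle$, where $\mathbb{P}^2_L$ is the projective plane of lines of $\mathbb{P}^3$ through $L$. If $X \subset \mathbb{P}^3$ is an irreducible surface of degree $d$ and $L \notin X$, the restriction of $\pi_L$ to $X$ (also denoted $\pi_L$) is a finite surjective morphism $X \to \mathbb{P}^2_L$ of degree $d$, and $M(\pi_L) \subseteq S_d$ denotes its monodromy group. The point $L$ is called uniform if $M(\pi_L) = S_d$ and non-uniform otherwise. *)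

theory Defs
  imports "HOL-Analysis.Analysis"
begin

section \<open>Quotient topologies and covering maps for abstract topologies\<close>

definition quotient_topology :: "'a topology \<Rightarrow> ('a \<Rightarrow> 'b) \<Rightarrow> 'b topology" where
  "quotient_topology X f =
     topology (\<lambda>V. V \<subseteq> f ` topspace X \<and> openin X {x \<in> topspace X. f x \<in> V})"

lemma openin_quotient_topology:
  "openin (quotient_topology X f) V \<longleftrightarrow>
     V \<subseteq> f ` topspace X \<and> openin X {x \<in> topspace X. f x \<in> V}"
proof -
  have 1: "openin X {x \<in> topspace X. f x \<in> S \<inter> T}"
    if "openin X {x \<in> topspace X. f x \<in> S}" "openin X {x \<in> topspace X. f x \<in> T}" for S T
  proof -
    have "{x \<in> topspace X. f x \<in> S \<inter> T}
        = {x \<in> topspace X. f x \<in> S} \<inter> {x \<in> topspace X. f x \<in> T}" by auto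
    with that show ?thesis by auto
  qed
  have 2: "openin X {x \<in> topspace X. f x \<in> \<Union>K}"
    if "\<And>S. S \<in> K \<Longrightarrow> openin X {x \<in> topspace X. f x \<in> S}" for K
  proof -
    have "{x \<in> topspace X. f x \<in> \<Union>K} = (\<Union>S\<in>K. {x \<in> topspace X. f x \<in> S})" by auto
    with that show ?thesis by auto
  qed
  have "istopology (\<lambda>V. V \<subseteq> f ` topspace X \<and> openin X {x \<in> topspace X. f x \<in> V})"
    unfolding istopology_def using 1 2 by (auto 0 3)
  then show ?thesis
    by (simp add: quotient_topology_def)
qed

lemma topspace_quotient_topology: "topspace (quotient_topology X f) = f ` topspace X"
proof -
  have "{x \<in> topspace X. f x \<in> f ` topspace X} = topspace X" by auto
  then have "openin (quotient_topology X f) (f ` topspace X)"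
    by (simp add: openin_quotient_topology)
  then show ?thesis
    by (meson openin_quotient_topology openin_subset openin_topspace subset_antisym)
qed

lemma quotient_map_quotient_topology: "quotient_map X (quotient_topology X f) f"
  by (simp add: quotient_map_def topspace_quotient_topology openin_quotient_topology)

text \<open>The library predicate \<^const>\<open>covering_space\<close>, restated for abstract topologies.\<close>

definition covering_map :: "'a topology \<Rightarrow> 'b topology \<Rightarrow> ('a \<Rightarrow> 'b) \<Rightarrow> bool" where
  "covering_map E B p \<longleftrightarrow>
     continuous_map E B p \<and> p ` topspace E = topspace B \<and>
     (\<forall>b \<in> topspace B. \<exists>T. b \<in> T \<and> openin B T \<and>
        (\<exists>\<V>. \<Union>\<V> = {x \<in> topspace E. p x \<in> T} \<and>
             (\<forall>W\<in>\<V>. openin E W) \<and>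
             pairwise disjnt \<V> \<and>
             (\<forall>W\<in>\<V>. homeomorphic_map (subtopology E W) (subtopology B T) p)))"

text \<open>
  The image of the homomorphism \<open>\<rho>\<close> from the fundamental group of \<open>B\<close> at \<open>y\<close> to the
  permutations of the fibre over \<open>y\<close>: a permutation belongs to it if lifting some loop \<open>\<gamma>\<close> at
  \<open>y\<close> carries each point \<open>x\<close> of the fibre to \<open>\<sigma> x\<close>. For a covering map, lifts are unique and
  their endpoints depend only on the homotopy class of \<open>\<gamma>\<close>, so letting \<open>\<gamma>\<close> range over loops
  or over homotopy classes gives the same set of permutations.
\<close>

definition monodromy_group ::
    "'a topology \<Rightarrow> 'b topology \<Rightarrow> ('a \<Rightarrow> 'b) \<Rightarrow> 'b \<Rightarrow> ('a \<Rightarrow> 'a) set" where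
  "monodromy_group E B p y =
     {\<sigma>. \<sigma> permutes {x \<in> topspace E. p x = y} \<and>
         (\<exists>\<gamma>. pathin B \<gamma> \<and> \<gamma> 0 = y \<and> \<gamma> 1 = y \<and>
            (\<forall>x \<in> topspace E. p x = y \<longrightarrow>
               (\<exists>\<delta>. pathin E \<delta> \<and> (\<forall>t\<in>{0..1}. p (\<delta> t) = \<gamma> t) \<and> \<delta> 0 = x \<and> \<delta> 1 = \<sigma> x)))}"


section \<open>Complex projective space\<close>

text \<open>
  Points of projective space are the one-dimensional complex linear subspaces of \<open>\<complex>\<^sup>n\<close>, so
  \<open>\<bbbP>\<^sup>3\<close> is \<^term>\<open>proj_space :: (complex^4) set set\<close>. Likewise the lines of projective space are
  the two-dimensional subspaces. Note that \<^const>\<open>vec.span\<close>, \<^const>\<open>vec.dim\<close> and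
  \<^const>\<open>vec.subspace\<close> refer to the complex vector space structure.
\<close>

definition proj_space :: "(complex^'n) set set" where
  "proj_space = {V. vec.subspace V \<and> vec.dim V = 1}"

definition analytic_topology :: "(complex^'n) set topology" where
  "analytic_topology = quotient_topology (top_of_set (- {0})) (\<lambda>v. vec.span {v})"

definition monom_eval :: "('n \<Rightarrow> nat) \<Rightarrow> complex^'n \<Rightarrow> complex" where
  "monom_eval \<alpha> v = (\<Prod>i\<in>UNIV. v $ i ^ \<alpha> i)"

definition form_eval :: "nat \<Rightarrow> (('n \<Rightarrow> nat) \<Rightarrow> complex) \<Rightarrow> complex^'n \<Rightarrow> complex" where
  "form_eval d a v = (\<Sum>\<alpha> | (\<Sum>i\<in>UNIV. \<alpha> i) = d. a \<alpha> * monom_eval \<alpha> v)"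

text \<open>
  The open sets are the unions of the basic sets where a homogeneous polynomial (of degree \<open>d\<close>,
  with coefficients \<open>a\<close>) does not vanish; a form does not vanish at a point \<open>V\<close> of projective
  space if it is non-zero at some vector of the subspace \<open>V\<close>.
\<close>

definition zariski_topology :: "(complex^'n) set topology" where
  "zariski_topology =
     topology_generated_by {{V \<in> proj_space. \<exists>v\<in>V. form_eval d a v \<noteq> 0} | d a. True}"

lemma proj_space_eq: "proj_space = (\<lambda>v. vec.span {v}) ` (- {0})"
proof (intro subset_antisym subsetI)
  fix V :: "(complex^'n) set" assume "V \<in> proj_space"
  then have V: "vec.subspace V" "vec.dim V = 1" by (auto simp: proj_space_def)
  obtain B where B: "B \<subseteq> V" "vec.independent B" "V \<subseteq> vec.span B" "card B = vec.dim V"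
    using vec.basis_exists by blast
  then obtain v where v: "B = {v}" using V(2) by (metis card_1_singletonE)
  have "vec.span {v} = V"
    using B V(1) v by (metis vec.span_subspace)
  moreover have "v \<noteq> 0" using B(2) v vec.dependent_zero by blast
  ultimately show "V \<in> (\<lambda>v. vec.span {v}) ` (- {0})" by blast
next
  fix V :: "(complex^'n) set" assume "V \<in> (\<lambda>v. vec.span {v}) ` (- {0})"
  then obtain v where v: "v \<noteq> 0" "V = vec.span {v}" by auto
  have "vec.independent {v}" using v(1) by (simp add: vec.independent_insert)
  then have "vec.dim V = 1" using v(2) by (simp add: vec.dim_eq_card_independent)
  with v(2) show "V \<in> proj_space" by (simp add: proj_space_def)
qed

lemma topspace_analytic_topology: "topspace analytic_topology = proj_space"
  by (simp add: analytic_topology_def topspace_quotient_topology proj_space_eq)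

lemma topspace_zariski_topology: "topspace zariski_topology = (proj_space :: (complex^'n) set set)"
proof -
  have *: "V \<in> {V \<in> proj_space. \<exists>v\<in>V. form_eval 0 (\<lambda>_. 1) v \<noteq> 0}"
    if "V \<in> proj_space" for V :: "(complex^'n) set"
  proof -
    have "form_eval 0 (\<lambda>_. 1) (0 :: complex^'n) \<noteq> 0"
    proof -
      have "{\<alpha> :: 'n \<Rightarrow> nat. (\<Sum>i\<in>UNIV. \<alpha> i) = 0} = {\<lambda>_. 0}" by auto
      then show ?thesis by (simp add: form_eval_def monom_eval_def)
    qed
    with that show ?thesis
      by (auto simp: proj_space_def intro!: bexI[of _ 0] vec.subspace_0)
  qed
  show ?thesis
    unfolding zariski_topology_def topology_generated_by_topspace using * by blast
qed


section \<open>Projection from a point\<close>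

text \<open>
  \<open>proj_from L x\<close> is the line joining \<open>x\<close> and \<open>L\<close>. The plane \<open>\<bbbP>\<^sup>2\<^sub>L\<close> of lines through \<open>L\<close> is the
  quotient of \<open>\<bbbP>\<^sup>3 - {L}\<close> by this map, for the analytic as well as for the Zariski topology.
\<close>

definition proj_from :: "(complex^'n) set \<Rightarrow> (complex^'n) set \<Rightarrow> (complex^'n) set" where
  "proj_from L x = vec.span (L \<union> x)"

definition lines_through :: "(complex^'n) set \<Rightarrow> (complex^'n) set set" where
  "lines_through L = {l. vec.subspace l \<and> vec.dim l = 2 \<and> L \<subseteq> l}"

definition lines_analytic :: "(complex^'n) set \<Rightarrow> (complex^'n) set topology" where
  "lines_analytic L = quotient_topology (subtopology analytic_topology (- {L})) (proj_from L)"

definition lines_zariski :: "(complex^'n) set \<Rightarrow> (complex^'n) set topology" where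
  "lines_zariski L = quotient_topology (subtopology zariski_topology (- {L})) (proj_from L)"

lemma proj_from_image:
  assumes "L \<in> proj_space"
  shows "proj_from L ` (proj_space - {L}) = lines_through L"
proof (intro subset_antisym subsetI)
  obtain u where u: "u \<noteq> 0" "L = vec.span {u}" using assms by (auto simp: proj_space_eq)
  have join: "vec.span (L \<union> vec.span {v}) = vec.span {u, v}" for v
  proof -
    have "vec.span {u} \<subseteq> vec.span {u,v}" "vec.span {v} \<subseteq> vec.span {u,v}"
      by (simp_all add: vec.span_mono)
    moreover have "{u, v} \<subseteq> vec.span (L \<union> vec.span {v})"
      using u(2) by (auto intro!: vec.span_base)
    ultimately show ?thesis
      using u(2) by (meson Un_least subset_antisym vec.span_minimal vec.subspace_span)
  qed
  {
    fix l assume "l \<in> proj_from L ` (proj_space - {L})"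
    then obtain x where x: "x \<in> proj_space" "x \<noteq> L" "l = vec.span (L \<union> x)"
      by (auto simp: proj_from_def)
    from x(1) obtain v where v0: "v \<noteq> 0" "x = vec.span {v}" by (auto simp: proj_space_eq)
    have v: "v \<noteq> 0" "vec.span {v} \<noteq> L" "l = vec.span {u, v}"
      using v0 x(2,3) join by auto
    have nv: "v \<notin> vec.span {u}"
    proof
      assume a: "v \<in> vec.span {u}"
      then obtain k where k: "v = k *s u" by (auto simp: vec.span_singleton)
      with v(1) have "k \<noteq> 0" by auto
      then have "u = inverse k *s v" using k by simp
      then have "u \<in> vec.span {v}" by (auto simp: vec.span_singleton)
      with a have "vec.span {v} = vec.span {u}"
        by (simp add: subset_antisym vec.span_minimal)
      with v(2) u(2) show False by simp
    qed
    have "vec.independent {v, u}" using nv u(1) by (simp add: vec.independent_insert)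
    moreover have "v \<noteq> u" using nv by (auto intro: vec.span_base)
    ultimately have "vec.dim l = 2"
      unfolding v(3) by (simp add: vec.dim_eq_card_independent insert_commute)
    moreover have "L \<subseteq> l" using v(3) u(2) by (simp add: vec.span_mono)
    ultimately show "l \<in> lines_through L" using v(3) by (simp add: lines_through_def)
  next
    fix l assume "l \<in> lines_through L"
    then have l: "vec.subspace l" "vec.dim l = 2" "L \<subseteq> l" by (auto simp: lines_through_def)
    have iu: "vec.independent {u}" using u(1) by (simp add: vec.independent_insert)
    have "\<not> l \<subseteq> vec.span {u}"
    proof
      assume "l \<subseteq> vec.span {u}"
      then have "vec.dim l \<le> card {u}" by (intro vec.dim_le_card) auto
      with l(2) show False by simp
    qed
    then obtain v where v: "v \<in> l" "v \<notin> vec.span {u}" by auto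
    then have iv: "vec.independent {v, u}" and vu: "v \<noteq> u"
      using u(1) by (auto simp: vec.independent_insert intro: vec.span_base)
    have sub: "{v, u} \<subseteq> l" using v(1) l(3) u(2) vec.span_base by blast
    have "l \<subseteq> vec.span {v, u}"
      using vec.card_ge_dim_independent[OF sub iv] l(2) vu by simp
    then have "l = vec.span {u, v}"
      using sub l(1) by (metis insert_commute vec.span_subspace)
    moreover have "v \<noteq> 0" using v(2) vec.span_zero by blast
    moreover have "vec.span {v} \<noteq> L" using v(2) u(2) vec.span_base by blast
    ultimately show "l \<in> proj_from L ` (proj_space - {L})"
      by (intro image_eqI[of _ _ "vec.span {v}"]) (auto simp: proj_from_def proj_space_eq join)
  }
qed

lemma topspace_lines:
  assumes "L \<in> proj_space"
  shows "topspace (lines_analytic L) = lines_through L"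
    and "topspace (lines_zariski L) = lines_through L"
  using proj_from_image[OF assms]
  by (simp_all add: lines_analytic_def lines_zariski_def topspace_quotient_topology
      topspace_analytic_topology topspace_zariski_topology Diff_eq)


section \<open>Uniform and non-uniform points\<close>

definition part_over ::
    "(complex^'n) set set \<Rightarrow> (complex^'n) set \<Rightarrow> (complex^'n) set set \<Rightarrow> (complex^'n) set topology" where
  "part_over X L U = subtopology analytic_topology {x \<in> X. proj_from L x \<in> U}"

definition base_over ::
    "(complex^'n) set \<Rightarrow> (complex^'n) set set \<Rightarrow> (complex^'n) set topology" where
  "base_over L U = subtopology (lines_analytic L) U"

text \<open>
  \<open>U\<close> is a dense Zariski-open set of lines over which the projection of \<open>X\<close> from \<open>L\<close>, a map of
  degree \<open>d\<close>, is an etale covering, i.e. a topological covering with \<open>d\<close> sheets. The number of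
  sheets has to be prescribed: a non-reduced equation may define a set \<open>X\<close> whose projection
  is a covering with fewer sheets.
\<close>

definition etale_covering_over ::
    "nat \<Rightarrow> (complex^'n) set set \<Rightarrow> (complex^'n) set \<Rightarrow> (complex^'n) set set \<Rightarrow> bool" where
  "etale_covering_over d X L U \<longleftrightarrow>
     openin (lines_zariski L) U \<and>
     (lines_zariski L) closure_of U = lines_through L \<and>
     covering_map (part_over X L U) (base_over L U) (proj_from L) \<and>
     (\<forall>y\<in>U. card {x \<in> X. proj_from L x = y} = d)"

text \<open>
  The monodromy group of the projection is independent of the choice of \<open>U\<close> and \<open>y\<close>, up to
  identification of the fibres; \<open>L\<close> is uniform if it is the full symmetric group of a fibre.
\<close>

definition uniform_point :: "nat \<Rightarrow> (complex^'n) set set \<Rightarrow> (complex^'n) set \<Rightarrow> bool" where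
  "uniform_point d X L \<longleftrightarrow>
     (\<exists>U y. etale_covering_over d X L U \<and> y \<in> U \<and>
        monodromy_group (part_over X L U) (base_over L U) (proj_from L) y
          = {\<sigma>. \<sigma> permutes {x \<in> X. proj_from L x = y}})"

definition nonuniform_locus :: "nat \<Rightarrow> (complex^'n) set set \<Rightarrow> (complex^'n) set set" where
  "nonuniform_locus d X = {L \<in> proj_space - X. \<not> uniform_point d X L}"


section \<open>Cubic surfaces\<close>

typedef cubic_exponent = "{\<alpha> :: 4 \<Rightarrow> nat. (\<Sum>i\<in>UNIV. \<alpha> i) = 3}"
  morphisms exponent Cubic_exponent
  by (rule exI[of _ "\<lambda>i. if i = 0 then 3 else 0"]) simp

lemma card_cubic_exponents: "card {\<alpha> :: 4 \<Rightarrow> nat. (\<Sum>i\<in>UNIV. \<alpha> i) = 3} = 20"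
proof -
  have "bij_betw (\<lambda>\<alpha>. [\<alpha> 1, \<alpha> 2, \<alpha> 3, \<alpha> 4]) {\<alpha> :: 4 \<Rightarrow> nat. (\<Sum>i\<in>UNIV. \<alpha> i) = 3}
          {l :: nat list. length l = 4 \<and> sum_list l = 3}"
  proof (rule bij_betwI')
    fix \<alpha> \<beta> :: "4 \<Rightarrow> nat"
    show "([\<alpha> 1, \<alpha> 2, \<alpha> 3, \<alpha> 4] = [\<beta> 1, \<beta> 2, \<beta> 3, \<beta> 4]) = (\<alpha> = \<beta>)"
      by (simp add: fun_eq_iff forall_4)
  next
    fix \<alpha> :: "4 \<Rightarrow> nat"
    assume "\<alpha> \<in> {\<alpha>. (\<Sum>i\<in>UNIV. \<alpha> i) = 3}"
    then show "[\<alpha> 1, \<alpha> 2, \<alpha> 3, \<alpha> 4] \<in> {l. length l = 4 \<and> sum_list l = 3}"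
      by (simp add: sum_4)
  next
    fix l :: "nat list"
    assume "l \<in> {l. length l = 4 \<and> sum_list l = 3}"
    then obtain a b c d where l: "l = [a, b, c, d]" "a + b + c + d = 3"
      by (auto simp: numeral_eq_Suc length_Suc_conv)
    define \<alpha> :: "4 \<Rightarrow> nat" where
      "\<alpha> = (\<lambda>i. if i = 1 then a else if i = 2 then b else if i = 3 then c else d)"
    have "\<alpha> \<in> {\<alpha>. (\<Sum>i\<in>UNIV. \<alpha> i) = 3}" "l = [\<alpha> 1, \<alpha> 2, \<alpha> 3, \<alpha> 4]"
      using l by (simp_all add: sum_4 \<alpha>_def)
    then show "\<exists>\<alpha>\<in>{\<alpha> :: 4 \<Rightarrow> nat. (\<Sum>i\<in>UNIV. \<alpha> i) = 3}. l = [\<alpha> 1, \<alpha> 2, \<alpha> 3, \<alpha> 4]"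
      by blast
  qed
  then have "card {\<alpha> :: 4 \<Rightarrow> nat. (\<Sum>i\<in>UNIV. \<alpha> i) = 3} = (3 + 4 - 1) choose 3"
    by (simp add: bij_betw_same_card card_length_sum_list)
  then show ?thesis by (simp add: eval_nat_numeral)
qed

instance cubic_exponent :: finite
proof
  have "finite {\<alpha> :: 4 \<Rightarrow> nat. (\<Sum>i\<in>UNIV. \<alpha> i) = 3}"
    using card_cubic_exponents by (metis card.infinite zero_neq_numeral)
  then show "finite (UNIV :: cubic_exponent set)"
    by (metis finite_imageI type_definition.Abs_image type_definition_cubic_exponent)
qed

lemma card_cubic_exponent: "CARD(cubic_exponent) = 20"
  using type_definition.card[OF type_definition_cubic_exponent] card_cubic_exponents by simp

text \<open>
  With the exponents of the 20 cubic monomials in 4 variables as index set, \<open>\<bbbP>\<^sup>1\<^sup>9\<close> is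
  \<^term>\<open>proj_space :: (complex^cubic_exponent) set set\<close>.
\<close>

definition cubic_form :: "complex^cubic_exponent \<Rightarrow> complex^4 \<Rightarrow> complex" where
  "cubic_form c v = (\<Sum>\<alpha>\<in>UNIV. c $ \<alpha> * monom_eval (exponent \<alpha>) v)"

text \<open>
  The cubic surface with parameter \<open>C\<close> in \<open>\<bbbP>\<^sup>1\<^sup>9\<close>; the vectors of \<open>C\<close> are the scalar multiples of
  its equation.
\<close>

definition cubic_surface :: "(complex^cubic_exponent) set \<Rightarrow> (complex^4) set set" where
  "cubic_surface C = {x \<in> proj_space. \<forall>c\<in>C. \<forall>v\<in>x. cubic_form c v = 0}"

end

theory Submission
  imports Defs "HOL-Complex_Analysis.Residue_Theorem"
begin

text \<open>
  Let \<open>f\<close> be the cubic form of the surface and \<open>L\<close> a point with \<open>f L = 1\<close>. On the polar plane of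
  \<open>L\<close> the surface is given by a depressed cubic \<open>t\<^sup>3 + p t + q\<close> with a quadratic form \<open>p\<close> and a
  cubic form \<open>q\<close>. If the monodromy group is not \<open>S\<^sub>3\<close>, it fixes a root or consists of even
  permutations. In the first case the fixed root, restricted to the lines of the plane through a base
  point \<open>e\<close>, is an entire function of linear growth, so it is linear and the surface contains a plane.
  In the second case the discriminant has a square root \<open>s\<close> that is polynomial on these lines, and
  the factorization \<open>(s + k q) (s - k q) = - 4 p\<^sup>3\<close> with \<open>k\<^sup>2 = - 27\<close> forces \<open>p = 0\<close> or \<open>p\<close> and \<open>q\<close> to
  depend on two linear forms only; then the surface is cyclic or a cone. Reducible cubics, cyclic cubics and
  cones depend on at most 17 parameters, so by counting monomials there are nonzero forms on \<open>\<bbbP>\<^sup>1\<^sup>9\<close>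
  vanishing on them.
\<close>

section \<open>Forms\<close>

text \<open>Continuation along a line through \<open>e\<close> gives one answer per line, and
  nothing so far ties the answers on different lines together. What ties them is the first-order
  term: all lines share the value at \<open>e\<close>, and differentiating the cubic equation, or
  the equation of the square root of the discriminant, determines the slope at \<open>e\<close>,
  which is linear in the direction. A linear root is then known completely, and so are the two
  factors of \<open>- 4 * p ^ 3\<close>, up to a choice between two shapes. For this,
  \<open>p\<close> should have no linear term on the line. Hence \<open>e\<close> is taken with
  \<open>p e\<close> nonzero and the directions \<open>w\<close> range over \<open>V\<close>, the
  vectors of the polar plane that are polar to \<open>e\<close> with respect to \<open>p\<close>;
  there \<open>p (e + z *s w) = p e + p w * z ^ 2\<close>. The vectors \<open>e + w\<close> fill the
  affine chart \<open>phi = 1\<close> of the polar plane, and identities obtained over it are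
  carried to \<open>phi = 0\<close> because they depend polynomially on an auxiliary
  parameter.\<close>

lemma finite_exponents: "finite {\<alpha> :: 'n::finite \<Rightarrow> nat. (\<Sum>i\<in>UNIV. \<alpha> i) = d}"
proof (rule finite_subset)
  show "{\<alpha> :: 'n \<Rightarrow> nat. (\<Sum>i\<in>UNIV. \<alpha> i) = d} \<subseteq> PiE UNIV (\<lambda>_. {..d})"
    by (auto simp: PiE_def Pi_def intro!: member_le_sum)
qed (intro finite_PiE; simp)

lemma exponent_le_degree:
  fixes \<alpha> :: "'n::finite \<Rightarrow> nat"
  assumes "(\<Sum>i\<in>UNIV. \<alpha> i) = d"
  shows "\<alpha> i \<le> d"
  using assms member_le_sum[of i UNIV \<alpha>] by auto

lemma monom_eval_mult: "monom_eval \<alpha> v * monom_eval \<beta> v = monom_eval (\<lambda>i. \<alpha> i + \<beta> i) v"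
  by (simp add: monom_eval_def prod.distrib power_add)

lemma monom_eval_scale: "monom_eval \<alpha> (k *s v) = k ^ (\<Sum>i\<in>UNIV. \<alpha> i) * monom_eval \<alpha> v"
  by (simp add: monom_eval_def power_mult_distrib prod.distrib power_sum)

lemma form_eval_scale: "form_eval d a (k *s v) = k ^ d * form_eval d a v"
  by (simp add: form_eval_def monom_eval_scale sum_distrib_left mult_ac)

lemma monom_eval_line:
  "\<exists>P. \<forall>s. monom_eval \<alpha> (v + s *s w) = poly P s"
proof
  show "\<forall>s. monom_eval \<alpha> (v + s *s w) = poly (\<Prod>i\<in>UNIV. [:v $ i, w $ i:] ^ \<alpha> i) s"
    by (simp add: monom_eval_def poly_prod)
qed

lemma form_eval_line:
  "\<exists>P. \<forall>s. form_eval d a (v + s *s w) = poly P s"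
proof -
  from monom_eval_line[of _ v w] obtain P where "\<And>\<alpha> s. monom_eval \<alpha> (v + s *s w) = poly (P \<alpha>) s"
    by metis
  then have "\<forall>s. form_eval d a (v + s *s w) =
      poly (\<Sum>\<alpha> | (\<Sum>i\<in>UNIV. \<alpha> i) = d. smult (a \<alpha>) (P \<alpha>)) s"
    by (simp add: form_eval_def poly_sum)
  then show ?thesis ..
qed

text \<open>The coefficients are hidden, so that an explicit polynomial can be recognized as a form
  by closure rules without computing them.\<close>

definition is_form :: "nat \<Rightarrow> (complex^'n \<Rightarrow> complex) \<Rightarrow> bool" where
  "is_form d h \<longleftrightarrow> (\<exists>a. \<forall>v. h v = form_eval d a v)"

lemma is_form_zero: "is_form d (\<lambda>v. 0)"
  unfolding is_form_def by (rule exI[of _ "\<lambda>_. 0"]) (simp add: form_eval_def)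

lemma is_form_add:
  assumes "is_form d g" "is_form d h"
  shows "is_form d (\<lambda>v. g v + h v)"
proof -
  from assms obtain a b where "\<And>v. g v = form_eval d a v" "\<And>v. h v = form_eval d b v"
    unfolding is_form_def by metis
  then have "\<forall>v. g v + h v = form_eval d (\<lambda>\<alpha>. a \<alpha> + b \<alpha>) v"
    by (simp add: form_eval_def sum.distrib distrib_right)
  then show ?thesis unfolding is_form_def by blast
qed

lemma is_form_scale:
  assumes "is_form d h"
  shows "is_form d (\<lambda>v. k * h v)"
proof -
  from assms obtain a where "\<And>v. h v = form_eval d a v"
    unfolding is_form_def by metis
  then have "\<forall>v. k * h v = form_eval d (\<lambda>\<alpha>. k * a \<alpha>) v"
    by (simp add: form_eval_def sum_distrib_left mult_ac)
  then show ?thesis unfolding is_form_def by blast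
qed

lemma is_form_sum:
  assumes "\<And>j. j \<in> J \<Longrightarrow> is_form d (h j)"
  shows "is_form d (\<lambda>v. \<Sum>j\<in>J. h j v)"
  using assms by (induction J rule: infinite_finite_induct) (auto intro: is_form_zero is_form_add)

lemma is_form_monom: "is_form (\<Sum>i\<in>UNIV. \<alpha> i) (monom_eval \<alpha> :: complex^'n \<Rightarrow> complex)"
proof -
  have "monom_eval \<alpha> v = form_eval (\<Sum>i\<in>UNIV. \<alpha> i) (\<lambda>\<beta>. if \<beta> = \<alpha> then 1 else 0) v" for v :: "complex^'n"
  proof -
    have "form_eval (\<Sum>i\<in>UNIV. \<alpha> i) (\<lambda>\<beta>. if \<beta> = \<alpha> then 1 else 0) v =
       (\<Sum>\<beta> | (\<Sum>i\<in>UNIV. \<beta> i) = (\<Sum>i\<in>UNIV. \<alpha> i). if \<beta> = \<alpha> then monom_eval \<beta> v else 0)"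
      unfolding form_eval_def by (intro sum.cong) auto
    also have "\<dots> = monom_eval \<alpha> v"
      by (subst sum.delta) (auto simp: finite_exponents)
    finally show ?thesis by simp
  qed
  then show ?thesis unfolding is_form_def by blast
qed

lemma is_form_mult:
  assumes "is_form d g" "is_form e h"
  shows "is_form (d + e) (\<lambda>v. g v * h v)"
proof -
  from assms obtain a b where *: "\<And>v. g v = form_eval d a v" "\<And>v. h v = form_eval e b v"
    unfolding is_form_def by metis
  have "g v * h v = (\<Sum>\<alpha> | (\<Sum>i\<in>UNIV. \<alpha> i) = d. \<Sum>\<beta> | (\<Sum>i\<in>UNIV. \<beta> i) = e.
      (a \<alpha> * b \<beta>) * monom_eval (\<lambda>i. \<alpha> i + \<beta> i) v)" for v
    by (simp add: * form_eval_def sum_product monom_eval_mult[symmetric] mult_ac)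
  moreover have "is_form (d + e) (\<lambda>v. \<Sum>\<alpha> | (\<Sum>i\<in>UNIV. \<alpha> i) = d. \<Sum>\<beta> | (\<Sum>i\<in>UNIV. \<beta> i) = e.
      (a \<alpha> * b \<beta>) * monom_eval (\<lambda>i. \<alpha> i + \<beta> i) v)"
  proof (intro is_form_sum is_form_scale)
    fix \<alpha> \<beta> :: "'a \<Rightarrow> nat"
    assume "\<alpha> \<in> {\<alpha>. (\<Sum>i\<in>UNIV. \<alpha> i) = d}" "\<beta> \<in> {\<alpha>. (\<Sum>i\<in>UNIV. \<alpha> i) = e}"
    then show "is_form (d + e) (monom_eval (\<lambda>i. \<alpha> i + \<beta> i) :: complex^'a \<Rightarrow> complex)"
      using is_form_monom[of "\<lambda>i. \<alpha> i + \<beta> i"] by (simp add: sum.distrib)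
  qed
  ultimately show ?thesis by simp
qed

lemma is_form_power:
  assumes "is_form d h"
  shows "is_form (d * k) (\<lambda>v. h v ^ k)"
proof (induction k)
  case 0
  have "is_form 0 (\<lambda>v. 1 :: complex)"
    using is_form_monom[of "\<lambda>_. 0 :: nat"] by (simp add: monom_eval_def[abs_def])
  then show ?case by simp
next
  case (Suc k)
  then show ?case using is_form_mult[OF assms Suc.IH] by (simp add: add.commute)
qed

lemma is_form_coordinate: "is_form 1 (\<lambda>v :: complex^'n. v $ i)"
proof -
  define e :: "'n \<Rightarrow> nat" where "e = (\<lambda>j. if j = i then 1 else 0)"
  have "monom_eval e v = v $ i" for v :: "complex^'n"
    by (simp add: monom_eval_def e_def if_distrib prod.delta cong: if_cong)
  then have "monom_eval e = (\<lambda>v :: complex^'n. v $ i)" by (rule ext)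
  moreover have "(\<Sum>j\<in>UNIV. e j) = 1" by (simp add: e_def)
  ultimately show ?thesis using is_form_monom[of e] by (simp only:)
qed

section \<open>Coefficients of forms\<close>

text \<open>Points whose coordinates are \<open>N\<close>-th roots of unity. Summing against
  characters over this grid is a discrete Fourier transform, which reads off coefficients from
  finitely many values.\<close>

definition torus_point :: "nat \<Rightarrow> ('n \<Rightarrow> nat) \<Rightarrow> complex^'n" where
  "torus_point N k = (\<chi> i. cis (2 * pi / N) ^ k i)"

text \<open>Orthogonality of the characters of the cyclic group of order \<open>N\<close>: the sum
  is geometric, its ratio is the power \<open>c - b\<close> of a primitive root of unity, and this
  is \<open>1\<close> only for \<open>b = c\<close> because both are below \<open>N\<close>.\<close>

lemma sum_root_of_unity_powers:
  assumes "b < N" "c < N"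
  shows "(\<Sum>j<N. (inverse (cis (2 * pi / N)) ^ b) ^ j * (cis (2 * pi / N) ^ j) ^ c) =
    (if b = c then of_nat N else 0)"
proof -
  define z where "z = cis (2 * pi / N)"
  have z0: "z \<noteq> 0" by (simp add: z_def)
  have zN: "z ^ N = 1" using assms by (simp add: z_def Complex.DeMoivre)
  define x where "x = inverse z ^ b * z ^ c"
  have eq: "(\<Sum>j<N. (inverse z ^ b) ^ j * (z ^ j) ^ c) = (\<Sum>j<N. x ^ j)"
    by (simp add: x_def power_mult_distrib mult.commute flip: power_mult)
  have "(\<Sum>j<N. x ^ j) = (if b = c then of_nat N else 0)"
  proof (cases "b = c")
    case True
    then have "x = 1" using z0 by (simp add: x_def flip: power_mult_distrib)
    then show ?thesis using True by simp
  next
    case False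
    have inj: "z ^ i = z ^ j \<Longrightarrow> i < N \<Longrightarrow> j < N \<Longrightarrow> i = j" for i j
    proof -
      assume *: "z ^ i = z ^ j" "i < N" "j < N"
      have "z ^ k = exp (2 * of_real pi * \<i> * of_nat k / of_nat N)" for k
        unfolding z_def Complex.DeMoivre by (simp add: cis_conv_exp mult_ac)
      then have "i mod N = j mod N"
        using *(1) complex_root_unity_eq[of N i j] assms by simp
      then show "i = j" using * by simp
    qed
    have "x \<noteq> 1"
    proof
      assume "x = 1"
      then have "z ^ c = z ^ b" using z0 by (simp add: x_def field_simps)
      then show False using inj assms False by metis
    qed
    moreover have "x ^ N = 1"
      by (simp add: x_def power_mult_distrib mult.commute[of _ N] zN power_inverse flip: power_mult)
         (simp add: power_mult zN)
    ultimately show ?thesis using False by (simp add: sum_gp_strict)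
  qed
  with eq show ?thesis by (simp add: z_def)
qed

lemma torus_orthogonality:
  fixes \<alpha> \<beta> :: "'n::finite \<Rightarrow> nat"
  assumes "\<And>i. \<alpha> i < N" "\<And>i. \<beta> i < N"
  shows "(\<Sum>k\<in>PiE UNIV (\<lambda>_. {..<N}). (\<Prod>i\<in>UNIV. (inverse (cis (2 * pi / N)) ^ \<alpha> i) ^ k i) *
            monom_eval \<beta> (torus_point N k)) = (if \<alpha> = \<beta> then of_nat N ^ CARD('n) else 0)"
proof -
  have "(\<Sum>k\<in>PiE UNIV (\<lambda>_. {..<N}). (\<Prod>i\<in>UNIV. (inverse (cis (2 * pi / N)) ^ \<alpha> i) ^ k i) *
            monom_eval \<beta> (torus_point N k)) =
     (\<Sum>k\<in>PiE UNIV (\<lambda>_. {..<N}). (\<Prod>i\<in>UNIV. (inverse (cis (2 * pi / N)) ^ \<alpha> i) ^ k i *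
            (cis (2 * pi / N) ^ k i) ^ \<beta> i))"
    by (simp add: monom_eval_def torus_point_def prod.distrib)
  also have "\<dots> = (\<Prod>i\<in>UNIV. \<Sum>j<N. (inverse (cis (2 * pi / N)) ^ \<alpha> i) ^ j *
            (cis (2 * pi / N) ^ j) ^ \<beta> i)"
    by (subst prod_sum_PiE) auto
  also have "\<dots> = (\<Prod>i\<in>UNIV. if \<alpha> i = \<beta> i then of_nat N else 0)"
    by (intro prod.cong sum_root_of_unity_powers assms refl)
  also have "\<dots> = (if \<alpha> = \<beta> then of_nat N ^ CARD('n) else 0)"
    by (auto simp: fun_eq_iff)
  finally show ?thesis .
qed

text \<open>Fourier inversion. No exponent of degree \<open>d\<close> exceeds \<open>d\<close>, so
  the roots of unity of order \<open>Suc d\<close> separate the monomials. The formula shows that a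
  form with a nonzero coefficient is a nonzero function, and that coefficients are linear
  combinations of values.\<close>

lemma form_eval_coefficient:
  fixes \<alpha> :: "'n::finite \<Rightarrow> nat"
  assumes "(\<Sum>i\<in>UNIV. \<alpha> i) = d"
  shows "a \<alpha> * of_nat (Suc d) ^ CARD('n) =
    (\<Sum>k\<in>PiE UNIV (\<lambda>_. {..<Suc d}). (\<Prod>i\<in>UNIV. (inverse (cis (2 * pi / Suc d)) ^ \<alpha> i) ^ k i) *
       form_eval d a (torus_point (Suc d) k))"
proof -
  have "(\<Sum>k\<in>PiE UNIV (\<lambda>_. {..<Suc d}). (\<Prod>i\<in>UNIV. (inverse (cis (2 * pi / Suc d)) ^ \<alpha> i) ^ k i) *
       form_eval d a (torus_point (Suc d) k)) =
    (\<Sum>\<beta> | (\<Sum>i\<in>UNIV. \<beta> i) = d. a \<beta> * (\<Sum>k\<in>PiE UNIV (\<lambda>_. {..<Suc d}).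
      (\<Prod>i\<in>UNIV. (inverse (cis (2 * pi / Suc d)) ^ \<alpha> i) ^ k i) * monom_eval \<beta> (torus_point (Suc d) k)))"
    unfolding form_eval_def sum_distrib_left by (subst sum.swap) (simp add: mult_ac)
  also have "\<dots> = (\<Sum>\<beta> | (\<Sum>i\<in>UNIV. \<beta> i) = d. a \<beta> * (if \<alpha> = \<beta> then of_nat (Suc d) ^ CARD('n) else 0))"
    using assms exponent_le_degree
    by (intro sum.cong refl arg_cong2[where f = "(*)"] torus_orthogonality)
       (auto simp: less_Suc_eq_le)
  also have "\<dots> = (\<Sum>\<beta> | (\<Sum>i\<in>UNIV. \<beta> i) = d. if \<beta> = \<alpha> then a \<beta> * of_nat (Suc d) ^ CARD('n) else 0)"
    by (intro sum.cong) auto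
  also have "\<dots> = a \<alpha> * of_nat (Suc d) ^ CARD('n)"
    using assms by (subst sum.delta) (auto simp: finite_exponents)
  finally show ?thesis by simp
qed

lemma form_eval_nonzero:
  fixes \<alpha> :: "'n::finite \<Rightarrow> nat"
  assumes "(\<Sum>i\<in>UNIV. \<alpha> i) = d" "a \<alpha> \<noteq> 0"
  obtains v where "form_eval d a v \<noteq> 0"
proof -
  have "a \<alpha> * of_nat (Suc d) ^ CARD('n) \<noteq> 0" using assms(2) by (simp del: of_nat_Suc)
  then show thesis
    using form_eval_coefficient[OF assms(1), of a] that by (metis (no_types, lifting) mult_zero_right sum.neutral)
qed

section \<open>Irreducibility of projective space\<close>

lemma span_singleton_in_proj_space: "v \<noteq> 0 \<Longrightarrow> vec.span {v} \<in> proj_space"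
  by (auto simp: proj_space_eq)

lemma proj_spaceE:
  assumes "V \<in> proj_space"
  obtains v where "v \<noteq> 0" "V = vec.span {v}"
  using assms by (auto simp: proj_space_eq)

lemma span_singleton_eq: "V \<in> proj_space \<Longrightarrow> v \<in> V \<Longrightarrow> v \<noteq> 0 \<Longrightarrow> vec.span {v} = V"
  for V :: "(complex^'n) set"
proof -
  assume V: "V \<in> proj_space" and v: "v \<in> V" "v \<noteq> 0"
  then obtain w where w: "V = vec.span {w}" by (auto simp: proj_space_eq)
  with v obtain k where k: "v = k *s w" by (auto simp: vec.span_singleton)
  with v have "k \<noteq> 0" by auto
  then have "w = inverse k *s v" using k by simp
  then have "w \<in> vec.span {v}" by (auto simp: vec.span_singleton)
  then have "vec.span {w} \<subseteq> vec.span {v}" by (intro vec.span_minimal) simp_all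
  moreover have "vec.span {v} \<subseteq> vec.span {w}" using v(1) w by (intro vec.span_minimal) simp_all
  ultimately show ?thesis using w by simp
qed

lemma form_nonzero_on_span_iff:
  "(\<exists>x\<in>vec.span {v}. form_eval d a x \<noteq> 0) \<longleftrightarrow> form_eval d a v \<noteq> 0"
proof
  assume "\<exists>x\<in>vec.span {v}. form_eval d a x \<noteq> 0"
  then show "form_eval d a v \<noteq> 0" by (auto simp: vec.span_singleton form_eval_scale)
qed (auto intro: vec.span_base)

section \<open>Restriction to lines and irreducibility\<close>

lemma finite_zeros_on_line:
  assumes "form_eval d a v \<noteq> 0"
  shows "finite {s. form_eval d a (v + s *s w) = 0}"
proof -
  obtain P where P: "\<And>s. form_eval d a (v + s *s w) = poly P s"
    using form_eval_line by metis
  have "poly P 0 \<noteq> 0" using P[of 0] assms by simp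
  then have "P \<noteq> 0" by auto
  then show ?thesis using poly_roots_finite[of P] P by simp
qed

text \<open>A basic open set containing the point of \<open>v\<close> misses on this line only the
  zeros of a polynomial that is nonzero at \<open>0\<close>, and the at most one parameter where
  \<open>v + s *s w\<close> vanishes. Finiteness survives intersections, and a union contains its
  member through the point of \<open>v\<close>, so induction on the generation of the topology
  applies.\<close>

lemma zariski_open_cofinite_on_line:
  fixes v w :: "complex^'n"
  assumes "openin zariski_topology S" "vec.span {v} \<in> S"
  shows "finite {s. vec.span {v + s *s w} \<notin> S}"
proof -
  have v0: "v \<noteq> 0"
  proof
    assume "v = 0"
    then have "vec.span {v} = {0}" by simp
    moreover have "vec.span {v} \<in> proj_space"
      using assms openin_subset[OF assms(1)] by (auto simp: topspace_zariski_topology)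
    ultimately show False by (simp add: proj_space_def)
  qed
  have "generate_topology_on {{V \<in> proj_space. \<exists>v\<in>V. form_eval d a v \<noteq> 0} | d a. True} S"
    using assms(1) by (simp add: zariski_topology_def openin_topology_generated_by_iff)
  then show ?thesis using assms(2)
  proof induction
    case Empty
    then show ?case by simp
  next
    case (Int S T)
    have "{s. vec.span {v + s *s w} \<notin> S \<inter> T} =
        {s. vec.span {v + s *s w} \<notin> S} \<union> {s. vec.span {v + s *s w} \<notin> T}" by auto
    with Int show ?case by auto
  next
    case (UN K)
    then obtain S where "S \<in> K" "finite {s. vec.span {v + s *s w} \<notin> S}" by auto
    then show ?case by (auto elim: rev_finite_subset)
  next
    case (Basis S)
    then obtain d a where S: "S = {V \<in> proj_space. \<exists>v\<in>V. form_eval d a v \<noteq> 0}" by auto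
    then have nz: "form_eval d a v \<noteq> 0"
      using Basis form_nonzero_on_span_iff[of v d a] by auto
    have "finite {s. v + s *s w = 0}"
    proof -
      obtain i where i: "v $ i \<noteq> 0" using v0 by (auto simp: vec_eq_iff)
      have "{s. v + s *s w = 0} \<subseteq> {- (v $ i) / (w $ i)}"
      proof
        fix s assume "s \<in> {s. v + s *s w = 0}"
        then have *: "v $ i + s * w $ i = 0" by (simp add: vec_eq_iff)
        with i have "w $ i \<noteq> 0" by auto
        with * show "s \<in> {- (v $ i) / (w $ i)}" by (simp add: field_simps add_eq_0_iff2)
      qed
      then show ?thesis by (rule finite_subset) simp
    qed
    moreover have "{s. vec.span {v + s *s w} \<notin> S} \<subseteq>
        {s. v + s *s w = 0} \<union> {s. form_eval d a (v + s *s w) = 0}"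
      using span_singleton_in_proj_space form_nonzero_on_span_iff by (fastforce simp: S)
    ultimately show ?case
      using finite_zeros_on_line[OF nz] by (meson finite_Un finite_subset)
  qed
qed

text \<open>On the line joining a point of \<open>S\<close> to a point of \<open>T\<close> both sets
  are cofinite. The line is parametrized from \<open>v\<close> for one set and from \<open>w\<close>
  for the other; the two parameters of a common point are inverse to each other, which explains the
  image under \<open>inverse\<close> and the exclusion of \<open>0\<close>.\<close>

lemma zariski_open_Int_nonempty:
  fixes S T :: "(complex^'n) set set"
  assumes "openin zariski_topology S" "openin zariski_topology T" "S \<noteq> {}" "T \<noteq> {}"
  shows "S \<inter> T \<noteq> {}"
proof -
  have sub: "S \<subseteq> proj_space" "T \<subseteq> proj_space"
    using assms openin_subset by (metis topspace_zariski_topology)+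
  obtain v w where v: "vec.span {v} \<in> S" and w: "vec.span {w} \<in> T"
  proof -
    obtain V W where VW: "V \<in> S" "W \<in> T" using assms(3,4) by blast
    then have "V \<in> proj_space" "W \<in> proj_space" using sub by auto
    then obtain v w where "V = vec.span {v}" "W = vec.span {w}" by (elim proj_spaceE)
    with VW show thesis using that[of v w] by simp
  qed
  let ?A = "{s. vec.span {v + s *s w} \<notin> S}" and ?B = "{s. vec.span {w + s *s v} \<notin> T}"
  have fin: "finite (?A \<union> inverse ` ?B \<union> {0})"
    using zariski_open_cofinite_on_line[OF assms(1) v] zariski_open_cofinite_on_line[OF assms(2) w]
    by simp
  then obtain s where s: "s \<notin> ?A \<union> inverse ` ?B \<union> {0}"
    using ex_new_if_finite[OF infinite_UNIV_char_0 fin] by (elim exE)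
  have "inverse s \<notin> ?B"
  proof
    assume "inverse s \<in> ?B"
    then have "inverse (inverse s) \<in> inverse ` ?B" by (rule imageI)
    with s show False by simp
  qed
  then have T: "vec.span {w + inverse s *s v} \<in> T" by simp
  have s0: "s \<noteq> 0" and S: "vec.span {v + s *s w} \<in> S" using s by simp_all
  have eq: "s *s (w + inverse s *s v) = v + s *s w"
    using s0 by (simp add: vec.scale_right_distrib add.commute)
  have "vec.span {s *s (w + inverse s *s v)} = vec.span {w + inverse s *s v}"
    using s0 vec.span_image_scale[of "{w + inverse s *s v}" "\<lambda>_. s"] by simp
  then have "vec.span {v + s *s w} = vec.span {w + inverse s *s v}" unfolding eq .
  with S T have "vec.span {v + s *s w} \<in> S \<inter> T" by auto
  then show ?thesis by blast
qed

lemma zariski_open_dense: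
  assumes "openin zariski_topology S" "S \<noteq> {}"
  shows "zariski_topology closure_of S = proj_space"
  using zariski_open_Int_nonempty[OF _ assms(1) _ assms(2)]
  by (intro subset_antisym) (auto simp: closure_of_def topspace_zariski_topology)

lemma openin_zariski_nonzero_form:
  assumes "is_form d h"
  shows "openin zariski_topology {V \<in> proj_space. \<exists>v\<in>V. h v \<noteq> 0}"
proof -
  obtain a where "\<And>v. h v = form_eval d a v" using assms by (auto simp: is_form_def)
  then show ?thesis unfolding zariski_topology_def
    by (auto simp: openin_topology_generated_by_iff intro!: generate_topology_on.Basis)
qed

section \<open>Forms vanishing on a parametrized family\<close>

text \<open>A homogeneous system with fewer equations than unknowns, by Gaussian elimination: the
  pivot unknown \<open>\<beta>\<^sub>0\<close> is removed from the remaining equations.\<close>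

lemma nontrivial_solution_exists:
  fixes M :: "'a \<Rightarrow> 'b \<Rightarrow> complex"
  assumes "finite \<Gamma>" "finite N" "card \<Gamma> < card N"
  shows "\<exists>a. (\<exists>\<beta>\<in>N. a \<beta> \<noteq> 0) \<and> (\<forall>\<gamma>\<in>\<Gamma>. (\<Sum>\<beta>\<in>N. a \<beta> * M \<beta> \<gamma>) = 0)"
  using assms
proof (induction \<Gamma> arbitrary: N M rule: finite_induct)
  case empty
  then have "N \<noteq> {}" by auto
  then show ?case by (intro exI[of _ "\<lambda>_. 1"]) auto
next
  case (insert \<gamma>\<^sub>0 \<Gamma>)
  show ?case
  proof (cases "\<forall>\<beta>\<in>N. M \<beta> \<gamma>\<^sub>0 = 0")
    case True
    have lt: "card \<Gamma> < card N" using insert.prems insert.hyps by simp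
    obtain a where "\<exists>\<beta>\<in>N. a \<beta> \<noteq> 0" "\<forall>\<gamma>\<in>\<Gamma>. (\<Sum>\<beta>\<in>N. a \<beta> * M \<beta> \<gamma>) = 0"
      using insert.IH[of N M, OF insert.prems(1) lt] by (elim exE conjE)
    with True show ?thesis by (intro exI[of _ a]) auto
  next
    case False
    then obtain \<beta>\<^sub>0 where \<beta>\<^sub>0: "\<beta>\<^sub>0 \<in> N" "M \<beta>\<^sub>0 \<gamma>\<^sub>0 \<noteq> 0" by auto
    define N' where "N' = N - {\<beta>\<^sub>0}"
    have N: "N = insert \<beta>\<^sub>0 N'" "\<beta>\<^sub>0 \<notin> N'" "finite N'"
      using \<beta>\<^sub>0 insert.prems by (auto simp: N'_def)
    have lt: "card \<Gamma> < card N'"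
      using insert.prems insert.hyps N by simp
    obtain a where a: "\<exists>\<beta>\<in>N'. a \<beta> \<noteq> 0"
      "\<forall>\<gamma>\<in>\<Gamma>. (\<Sum>\<beta>\<in>N'. a \<beta> * (M \<beta> \<gamma> - M \<beta> \<gamma>\<^sub>0 / M \<beta>\<^sub>0 \<gamma>\<^sub>0 * M \<beta>\<^sub>0 \<gamma>)) = 0"
      using insert.IH[of N' "\<lambda>\<beta> \<gamma>. M \<beta> \<gamma> - M \<beta> \<gamma>\<^sub>0 / M \<beta>\<^sub>0 \<gamma>\<^sub>0 * M \<beta>\<^sub>0 \<gamma>", OF N(3) lt]
      by (elim exE conjE)
    \<comment> \<open>The value of the pivot unknown that solves the equation
      \<open>\<gamma>\<^sub>0\<close>, given the other unknowns.\<close>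
    define t where "t = - (\<Sum>\<beta>\<in>N'. a \<beta> * (M \<beta> \<gamma>\<^sub>0 / M \<beta>\<^sub>0 \<gamma>\<^sub>0))"
    define a' where "a' = a(\<beta>\<^sub>0 := t)"
    have "(\<Sum>\<beta>\<in>N. a' \<beta> * M \<beta> \<gamma>) = t * M \<beta>\<^sub>0 \<gamma> + (\<Sum>\<beta>\<in>N'. a \<beta> * M \<beta> \<gamma>)" for \<gamma>
    proof -
      have "(\<Sum>\<beta>\<in>N'. a' \<beta> * M \<beta> \<gamma>) = (\<Sum>\<beta>\<in>N'. a \<beta> * M \<beta> \<gamma>)"
        using N(2) by (intro sum.cong) (auto simp: a'_def)
      then show ?thesis using N by (simp add: a'_def)
    qed
    also have "t * M \<beta>\<^sub>0 \<gamma> + (\<Sum>\<beta>\<in>N'. a \<beta> * M \<beta> \<gamma>) =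
        (\<Sum>\<beta>\<in>N'. a \<beta> * (M \<beta> \<gamma> - M \<beta> \<gamma>\<^sub>0 / M \<beta>\<^sub>0 \<gamma>\<^sub>0 * M \<beta>\<^sub>0 \<gamma>))" for \<gamma>
      by (simp add: t_def sum_distrib_right sum_distrib_left right_diff_distrib sum_subtractf mult_ac)
    finally have *: "(\<Sum>\<beta>\<in>N. a' \<beta> * M \<beta> \<gamma>) =
        (\<Sum>\<beta>\<in>N'. a \<beta> * (M \<beta> \<gamma> - M \<beta> \<gamma>\<^sub>0 / M \<beta>\<^sub>0 \<gamma>\<^sub>0 * M \<beta>\<^sub>0 \<gamma>))" for \<gamma> .
    have "\<forall>\<gamma>\<in>insert \<gamma>\<^sub>0 \<Gamma>. (\<Sum>\<beta>\<in>N. a' \<beta> * M \<beta> \<gamma>) = 0"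
      using a(2) \<beta>\<^sub>0(2) by (simp add: *)
    moreover have "\<exists>\<beta>\<in>N. a' \<beta> \<noteq> 0"
      using a(1) N by (auto simp: a'_def)
    ultimately show ?thesis by blast
  qed
qed

text \<open>The degree is bounded in each variable separately, so that the count is at most a plain
  power of \<open>D + 1\<close>; exponents beyond the \<open>m\<close> variables are set to
  \<open>0\<close> to make the set finite.\<close>

definition exponents :: "nat \<Rightarrow> nat \<Rightarrow> (nat \<Rightarrow> nat) set" where
  "exponents m D = {\<alpha>. (\<forall>i<m. \<alpha> i \<le> D) \<and> (\<forall>i\<ge>m. \<alpha> i = 0)}"

definition param_monom :: "nat \<Rightarrow> (nat \<Rightarrow> nat) \<Rightarrow> (nat \<Rightarrow> complex) \<Rightarrow> complex" where
  "param_monom m \<alpha> \<theta> = (\<Prod>i<m. \<theta> i ^ \<alpha> i)"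

definition param_poly :: "nat \<Rightarrow> nat \<Rightarrow> ((nat \<Rightarrow> complex) \<Rightarrow> complex) \<Rightarrow> bool" where
  "param_poly m D g \<longleftrightarrow> (\<exists>c. \<forall>\<theta>. g \<theta> = (\<Sum>\<alpha>\<in>exponents m D. c \<alpha> * param_monom m \<alpha> \<theta>))"

lemma exponents_subset:
  "exponents m D \<subseteq> (\<lambda>xs i. if i < m then xs ! i else 0) ` {xs. set xs \<subseteq> {..D} \<and> length xs = m}"
proof
  fix \<alpha> assume \<alpha>: "\<alpha> \<in> exponents m D"
  show "\<alpha> \<in> (\<lambda>xs i. if i < m then xs ! i else 0) ` {xs. set xs \<subseteq> {..D} \<and> length xs = m}"
    using \<alpha> by (intro image_eqI[of _ _ "map \<alpha> [0..<m]"]) (auto simp: exponents_def fun_eq_iff)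
qed

lemma finite_bounded_exponents: "finite (exponents m D)"
  by (rule finite_subset[OF exponents_subset]) (simp add: finite_lists_length_eq)

lemma card_exponents_le: "card (exponents m D) \<le> (D + 1) ^ m"
proof -
  have "card (exponents m D) \<le> card {xs. set xs \<subseteq> {..D} \<and> length xs = m}"
    using exponents_subset by (rule surj_card_le[rotated]) (simp add: finite_lists_length_eq)
  then show ?thesis by (simp add: card_lists_length_eq)
qed

section \<open>Arithmetic of polynomials in the parameters\<close>

lemma param_poly_mono:
  assumes "param_poly m D g" "D \<le> E"
  shows "param_poly m E g"
proof -
  obtain c where c: "\<And>\<theta>. g \<theta> = (\<Sum>\<alpha>\<in>exponents m D. c \<alpha> * param_monom m \<alpha> \<theta>)"
    using assms by (auto simp: param_poly_def)
  have sub: "exponents m D \<subseteq> exponents m E" using assms(2) by (auto simp: exponents_def)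
  define c' where "c' \<alpha> = (if \<alpha> \<in> exponents m D then c \<alpha> else 0)" for \<alpha>
  have *: "\<forall>\<theta>. g \<theta> = (\<Sum>\<alpha>\<in>exponents m E. c' \<alpha> * param_monom m \<alpha> \<theta>)"
    unfolding c using sub
    by (intro allI sum.mono_neutral_cong_left) (auto simp: finite_bounded_exponents c'_def)
  show ?thesis unfolding param_poly_def by (rule exI[of _ c'], rule *)
qed

lemma param_poly_zero: "param_poly m D (\<lambda>_. 0)"
  unfolding param_poly_def by (rule exI[of _ "\<lambda>_. 0"]) simp

lemma param_poly_add:
  assumes "param_poly m D g" "param_poly m D h"
  shows "param_poly m D (\<lambda>\<theta>. g \<theta> + h \<theta>)"
proof -
  obtain b c where "\<And>\<theta>. g \<theta> = (\<Sum>\<alpha>\<in>exponents m D. b \<alpha> * param_monom m \<alpha> \<theta>)"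
    "\<And>\<theta>. h \<theta> = (\<Sum>\<alpha>\<in>exponents m D. c \<alpha> * param_monom m \<alpha> \<theta>)"
    using assms unfolding param_poly_def by metis
  then have *: "\<forall>\<theta>. g \<theta> + h \<theta> = (\<Sum>\<alpha>\<in>exponents m D. (b \<alpha> + c \<alpha>) * param_monom m \<alpha> \<theta>)"
    by (simp add: sum.distrib distrib_right)
  show ?thesis unfolding param_poly_def by (rule exI[of _ "\<lambda>\<alpha>. b \<alpha> + c \<alpha>"], rule *)
qed

lemma param_poly_scale:
  assumes "param_poly m D g"
  shows "param_poly m D (\<lambda>\<theta>. k * g \<theta>)"
proof -
  obtain c where "\<And>\<theta>. g \<theta> = (\<Sum>\<alpha>\<in>exponents m D. c \<alpha> * param_monom m \<alpha> \<theta>)"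
    using assms unfolding param_poly_def by metis
  then have *: "\<forall>\<theta>. k * g \<theta> = (\<Sum>\<alpha>\<in>exponents m D. (k * c \<alpha>) * param_monom m \<alpha> \<theta>)"
    by (simp add: sum_distrib_left mult_ac)
  show ?thesis unfolding param_poly_def by (rule exI[of _ "\<lambda>\<alpha>. k * c \<alpha>"], rule *)
qed

lemma param_poly_sum:
  assumes "\<And>j. j \<in> J \<Longrightarrow> param_poly m D (h j)"
  shows "param_poly m D (\<lambda>\<theta>. \<Sum>j\<in>J. h j \<theta>)"
  using assms
  by (induction J rule: infinite_finite_induct) (auto intro: param_poly_zero param_poly_add)

lemma param_poly_monom:
  assumes "\<alpha> \<in> exponents m D"
  shows "param_poly m D (param_monom m \<alpha>)"
proof -
  have "param_monom m \<alpha> \<theta> =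
      (\<Sum>\<beta>\<in>exponents m D. (if \<beta> = \<alpha> then 1 else 0) * param_monom m \<beta> \<theta>)" for \<theta>
  proof -
    have "(\<Sum>\<beta>\<in>exponents m D. (if \<beta> = \<alpha> then 1 else 0) * param_monom m \<beta> \<theta>) =
      (\<Sum>\<beta>\<in>exponents m D. if \<beta> = \<alpha> then param_monom m \<beta> \<theta> else 0)"
      by (intro sum.cong) auto
    then show ?thesis using assms by (simp add: sum.delta finite_bounded_exponents)
  qed
  then show ?thesis
    unfolding param_poly_def by (intro exI[of _ "\<lambda>\<beta>. if \<beta> = \<alpha> then 1 else 0"]) blast
qed

lemma param_poly_const: "param_poly m D (\<lambda>_. k)"
proof -
  have "param_poly m D (param_monom m (\<lambda>_. 0))"
    by (rule param_poly_monom) (simp add: exponents_def)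
  then show ?thesis using param_poly_scale[of m D _ k] by (fastforce simp: param_monom_def)
qed

lemma param_poly_var:
  assumes "i < m"
  shows "param_poly m 1 (\<lambda>\<theta>. \<theta> i)"
proof -
  define e where "e = (\<lambda>j. if j = i then 1 else 0 :: nat)"
  have "param_monom m e = (\<lambda>\<theta>. \<theta> i)"
    using assms by (auto simp: param_monom_def e_def if_distrib prod.delta cong: if_cong)
  moreover have "e \<in> exponents m 1" using assms by (auto simp: exponents_def e_def)
  ultimately show ?thesis using param_poly_monom by metis
qed

lemma param_poly_mult:
  assumes "param_poly m D g" "param_poly m E h"
  shows "param_poly m (D + E) (\<lambda>\<theta>. g \<theta> * h \<theta>)"
proof -
  obtain b c where *: "\<And>\<theta>. g \<theta> = (\<Sum>\<alpha>\<in>exponents m D. b \<alpha> * param_monom m \<alpha> \<theta>)"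
    "\<And>\<theta>. h \<theta> = (\<Sum>\<alpha>\<in>exponents m E. c \<alpha> * param_monom m \<alpha> \<theta>)"
    using assms unfolding param_poly_def by metis
  have "g \<theta> * h \<theta> = (\<Sum>\<alpha>\<in>exponents m D. \<Sum>\<beta>\<in>exponents m E.
      (b \<alpha> * c \<beta>) * param_monom m (\<lambda>i. \<alpha> i + \<beta> i) \<theta>)" for \<theta>
    by (simp add: * sum_product param_monom_def power_add prod.distrib mult_ac)
  moreover have "param_poly m (D + E) (\<lambda>\<theta>. \<Sum>\<alpha>\<in>exponents m D. \<Sum>\<beta>\<in>exponents m E.
      (b \<alpha> * c \<beta>) * param_monom m (\<lambda>i. \<alpha> i + \<beta> i) \<theta>)"
    by (intro param_poly_sum param_poly_scale param_poly_monom)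
       (auto simp: exponents_def intro: add_mono)
  ultimately show ?thesis by simp
qed

lemma param_poly_power:
  assumes "param_poly m D g"
  shows "param_poly m (D * k) (\<lambda>\<theta>. g \<theta> ^ k)"
proof (induction k)
  case 0
  then show ?case by (simp add: param_poly_const)
next
  case (Suc k)
  then show ?case using param_poly_mult[OF assms Suc.IH] by (simp add: add.commute)
qed

lemma param_poly_prod:
  assumes "\<And>j. j \<in> J \<Longrightarrow> param_poly m (D j) (h j)"
  shows "param_poly m (\<Sum>j\<in>J. D j) (\<lambda>\<theta>. \<Prod>j\<in>J. h j \<theta>)"
  using assms
  by (induction J rule: infinite_finite_induct) (auto intro: param_poly_const param_poly_mult)

text \<open>All exponents but the one at \<open>j\<^sub>0\<close> range freely over
  \<open>{..K}\<close>, and the one at \<open>j\<^sub>0\<close> fills up the total degree; it is a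
  natural number because the others add up to at most \<open>(CARD('n) - 1) * K\<close>.\<close>

lemma card_exponents_ge:
  "(K + 1) ^ (CARD('n) - 1) \<le> card {\<beta> :: 'n::finite \<Rightarrow> nat. (\<Sum>j\<in>UNIV. \<beta> j) = (CARD('n) - 1) * K}"
proof -
  obtain j\<^sub>0 :: 'n where True by simp
  define ext where "ext = (\<lambda>\<beta> :: 'n \<Rightarrow> nat. \<beta>(j\<^sub>0 := (CARD('n) - 1) * K - (\<Sum>j\<in>UNIV - {j\<^sub>0}. \<beta> j)))"
  let ?A = "PiE (UNIV - {j\<^sub>0}) (\<lambda>_. {..K})"
  have card: "card (UNIV - {j\<^sub>0}) = CARD('n) - 1" by (simp add: card_Diff_singleton)
  have sum_ext: "(\<Sum>j\<in>UNIV. ext \<beta> j) = (CARD('n) - 1) * K" if "\<beta> \<in> ?A" for \<beta>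
  proof -
    have "(\<Sum>j\<in>UNIV - {j\<^sub>0}. \<beta> j) \<le> (CARD('n) - 1) * K"
      using that sum_bounded_above[of "UNIV - {j\<^sub>0}" \<beta> K] card by (auto simp: PiE_def Pi_def)
    moreover have "(\<Sum>j\<in>UNIV. ext \<beta> j) = ext \<beta> j\<^sub>0 + (\<Sum>j\<in>UNIV - {j\<^sub>0}. ext \<beta> j)"
      by (rule sum.remove) auto
    moreover have "(\<Sum>j\<in>UNIV - {j\<^sub>0}. ext \<beta> j) = (\<Sum>j\<in>UNIV - {j\<^sub>0}. \<beta> j)"
      by (intro sum.cong) (auto simp: ext_def)
    ultimately show ?thesis by (simp add: ext_def)
  qed
  have "inj_on ext ?A"
  proof (rule inj_onI)
    fix \<beta> \<beta>' assume *: "\<beta> \<in> ?A" "\<beta>' \<in> ?A" "ext \<beta> = ext \<beta>'"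
    have "\<beta> j = \<beta>' j" if "j \<in> UNIV - {j\<^sub>0}" for j
      using fun_cong[OF *(3), of j] that by (simp add: ext_def)
    then show "\<beta> = \<beta>'" using * by (auto intro: PiE_ext)
  qed
  then have "card ?A = card (ext ` ?A)" by (simp add: card_image)
  also have "\<dots> \<le> card {\<beta> :: 'n \<Rightarrow> nat. (\<Sum>j\<in>UNIV. \<beta> j) = (CARD('n) - 1) * K}"
    using sum_ext by (intro card_mono finite_exponents) auto
  finally show ?thesis by (simp add: card_PiE card)
qed

definition param_polynomial :: "nat \<Rightarrow> ((nat \<Rightarrow> complex) \<Rightarrow> complex) \<Rightarrow> bool" where
  "param_polynomial m g \<longleftrightarrow> (\<exists>D. param_poly m D g)"

lemma param_polynomial_const: "param_polynomial m (\<lambda>_. k)"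
  using param_poly_const by (auto simp: param_polynomial_def)

lemma param_polynomial_var: "i < m \<Longrightarrow> param_polynomial m (\<lambda>\<theta>. \<theta> i)"
  using param_poly_var by (auto simp: param_polynomial_def)

lemma param_polynomial_add:
  assumes "param_polynomial m g" "param_polynomial m h"
  shows "param_polynomial m (\<lambda>\<theta>. g \<theta> + h \<theta>)"
proof -
  obtain D E where "param_poly m D g" "param_poly m E h"
    using assms by (auto simp: param_polynomial_def)
  then have "param_poly m (max D E) (\<lambda>\<theta>. g \<theta> + h \<theta>)"
    by (intro param_poly_add) (auto elim: param_poly_mono)
  then show ?thesis by (auto simp: param_polynomial_def)
qed

lemma param_polynomial_mult:
  assumes "param_polynomial m g" "param_polynomial m h"
  shows "param_polynomial m (\<lambda>\<theta>. g \<theta> * h \<theta>)"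
  using assms param_poly_mult by (fastforce simp: param_polynomial_def)

lemma param_polynomial_diff:
  assumes "param_polynomial m g" "param_polynomial m h"
  shows "param_polynomial m (\<lambda>\<theta>. g \<theta> - h \<theta>)"
  using param_polynomial_add[OF assms(1) param_polynomial_mult[OF param_polynomial_const[of m "-1"] assms(2)]]
  by simp

lemma param_polynomial_power:
  assumes "param_polynomial m g"
  shows "param_polynomial m (\<lambda>\<theta>. g \<theta> ^ k)"
  using assms param_poly_power by (fastforce simp: param_polynomial_def)

lemma param_polynomial_sum:
  assumes "\<And>j. j \<in> J \<Longrightarrow> param_polynomial m (h j)"
  shows "param_polynomial m (\<lambda>\<theta>. \<Sum>j\<in>J. h j \<theta>)"
  using assms
  by (induction J rule: infinite_finite_induct) (auto intro: param_polynomial_const param_polynomial_add)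

lemmas param_polynomial_intros =
  param_polynomial_const param_polynomial_var param_polynomial_add param_polynomial_mult
  param_polynomial_diff param_polynomial_power param_polynomial_sum

text \<open>
  The products of degree \<open>k\<close> of the coordinates of \<open>P \<theta>\<close> are polynomials in \<open>m\<close> parameters of degree
  \<open>O(k)\<close>, so they span a space of dimension \<open>O(k\<^sup>m)\<close>, whereas the number of forms of degree \<open>k\<close>
  grows faster; hence there is a linear relation.
\<close>

lemma vanishing_form_exists:
  fixes P :: "'n::finite \<Rightarrow> (nat \<Rightarrow> complex) \<Rightarrow> complex"
  assumes P: "\<And>j. param_polynomial m (P j)" and m: "m + 2 \<le> CARD('n)"
  shows "\<exists>k a. (\<exists>v :: complex^'n. form_eval k a v \<noteq> 0) \<and>
    (\<forall>\<theta>. form_eval k a (\<chi> j. P j \<theta>) = 0)"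
proof -
  obtain D where D: "\<And>j. param_poly m (D j) (P j)"
    using P unfolding param_polynomial_def by metis
  define e where "e = (\<Sum>j\<in>UNIV. D j)"
  have P': "param_poly m e (P j)" for j
    using D by (rule param_poly_mono) (simp add: e_def member_le_sum)
  \<comment> \<open>\<open>C\<close> satisfies \<open>e * k + 1 \<le> C * (K + 1)\<close>, and
    \<open>K\<close> is chosen as \<open>C ^ m\<close> so that the constant \<open>C ^ m\<close> is
    absorbed by one extra factor \<open>K + 1\<close>. The assumption on \<open>m\<close> provides
    room for this factor below the exponent \<open>CARD('n) - 1\<close>.\<close>
  define C where "C = e * (CARD('n) - 1) + 1"
  define K where "K = C ^ m"
  define k where "k = (CARD('n) - 1) * K"
  let ?N = "{\<beta> :: 'n \<Rightarrow> nat. (\<Sum>j\<in>UNIV. \<beta> j) = k}"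
  have "e * (n * K) + 1 \<le> (e * n + 1) * (K + 1)" for n by (simp add: algebra_simps)
  then have "e * k + 1 \<le> C * (K + 1)" by (simp only: C_def k_def)
  then have "(e * k + 1) ^ m \<le> (C * (K + 1)) ^ m" by (rule power_mono) simp
  also have "\<dots> = K * (K + 1) ^ m" by (simp only: power_mult_distrib K_def)
  also have "\<dots> < (K + 1) ^ (m + 1)" by simp
  also have "\<dots> \<le> (K + 1) ^ (CARD('n) - 1)" using m by (intro power_increasing) auto
  also have "\<dots> \<le> card ?N" unfolding k_def by (rule card_exponents_ge)
  finally have lt: "card (exponents m (e * k)) < card ?N"
    using card_exponents_le[of m "e * k"] by linarith
  have "param_poly m (e * k) (\<lambda>\<theta>. monom_eval \<beta> (\<chi> j. P j \<theta>))" if "\<beta> \<in> ?N" for \<beta>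
  proof -
    have "param_poly m (\<Sum>j\<in>UNIV. e * \<beta> j) (\<lambda>\<theta>. \<Prod>j\<in>UNIV. P j \<theta> ^ \<beta> j)"
      by (intro param_poly_prod param_poly_power P')
    then show ?thesis using that by (simp add: monom_eval_def flip: sum_distrib_left)
  qed
  then have "\<forall>\<beta>\<in>?N. \<exists>c. \<forall>\<theta>. monom_eval \<beta> (\<chi> j. P j \<theta>) =
      (\<Sum>\<alpha>\<in>exponents m (e * k). c \<alpha> * param_monom m \<alpha> \<theta>)"
    unfolding param_poly_def by blast
  then obtain c where c: "\<And>\<beta> \<theta>. \<beta> \<in> ?N \<Longrightarrow> monom_eval \<beta> (\<chi> j. P j \<theta>) =
      (\<Sum>\<alpha>\<in>exponents m (e * k). c \<beta> \<alpha> * param_monom m \<alpha> \<theta>)"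
    by metis
  obtain a where a: "\<exists>\<beta>\<in>?N. a \<beta> \<noteq> 0"
      "\<forall>\<gamma>\<in>exponents m (e * k). (\<Sum>\<beta>\<in>?N. a \<beta> * c \<beta> \<gamma>) = 0"
    using nontrivial_solution_exists[OF finite_bounded_exponents finite_exponents lt, of c]
    by (elim exE conjE)
  have "form_eval k a (\<chi> j. P j \<theta>) = 0" for \<theta>
  proof -
    have "form_eval k a (\<chi> j. P j \<theta>) =
        (\<Sum>\<beta>\<in>?N. a \<beta> * (\<Sum>\<alpha>\<in>exponents m (e * k). c \<beta> \<alpha> * param_monom m \<alpha> \<theta>))"
      unfolding form_eval_def by (intro sum.cong refl) (simp add: c)
    also have "\<dots> = (\<Sum>\<alpha>\<in>exponents m (e * k). (\<Sum>\<beta>\<in>?N. a \<beta> * c \<beta> \<alpha>) * param_monom m \<alpha> \<theta>)"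
      unfolding sum_distrib_left sum_distrib_right by (subst sum.swap) (simp add: mult_ac)
    also have "\<dots> = 0" by (simp add: a(2))
    finally show ?thesis .
  qed
  moreover obtain \<beta> where "\<beta> \<in> ?N" "a \<beta> \<noteq> 0" using a(1) by auto
  then have "\<exists>v :: complex^'n. form_eval k a v \<noteq> 0" using form_eval_nonzero by blast
  ultimately show ?thesis by blast
qed

section \<open>Polarization of cubic forms\<close>

text \<open>A symmetric trilinear form. The two transpositions generate all permutations of the
  arguments, so linearity in the first argument gives it in the others. Restrictions of the cubic to
  lines, its polar planes and its polar quadrics all become values of \<open>\<tau>\<close>.\<close>

locale cubic_polarization =
  fixes \<tau> :: "complex^4 \<Rightarrow> complex^4 \<Rightarrow> complex^4 \<Rightarrow> complex"
  assumes commute_12: "\<tau> x y z = \<tau> y x z"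
    and commute_23: "\<tau> x y z = \<tau> x z y"
    and add_1: "\<tau> (x + x') y z = \<tau> x y z + \<tau> x' y z"
    and scale_1: "\<tau> (k *s x) y z = k * \<tau> x y z"
begin

lemma add_2: "\<tau> x (y + y') z = \<tau> x y z + \<tau> x y' z"
  by (metis commute_12 add_1)

lemma add_3: "\<tau> x y (z + z') = \<tau> x y z + \<tau> x y z'"
  by (metis commute_23 add_2)

lemma scale_2: "\<tau> x (k *s y) z = k * \<tau> x y z"
  by (metis commute_12 scale_1)

lemma scale_3: "\<tau> x y (k *s z) = k * \<tau> x y z"
  by (metis commute_23 scale_2)

lemma diff_1: "\<tau> (x - x') y z = \<tau> x y z - \<tau> x' y z"
  using add_1[of "x - x'" x' y z] by simp

lemma diff_2: "\<tau> x (y - y') z = \<tau> x y z - \<tau> x y' z"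
  using add_2[of x "y - y'" y' z] by simp

lemma diff_3: "\<tau> x y (z - z') = \<tau> x y z - \<tau> x y z'"
  using add_3[of x y "z - z'" z'] by simp

lemma zero_1: "\<tau> 0 y z = 0"
  using scale_1[of 0 0 y z] by simp

lemma zero_3: "\<tau> x y 0 = 0"
  using scale_3[of x y 0 0] by simp

lemmas commute = commute_12 commute_23

lemmas expand = add_1 add_2 add_3 diff_1 diff_2 diff_3 scale_1 scale_2 scale_3

lemma sum_3: "\<tau> x y (\<Sum>j\<in>J. h j) = (\<Sum>j\<in>J. \<tau> x y (h j))"
  by (induction J rule: infinite_finite_induct) (auto simp: zero_3 add_3)

lemma coordinates_3: "\<tau> x y z = (\<Sum>k\<in>UNIV. z $ k * \<tau> x y (axis k 1))"
proof -
  have "\<tau> x y z = \<tau> x y (\<Sum>k\<in>UNIV. z $ k *s axis k 1)" by (simp add: basis_expansion)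
  then show ?thesis by (simp add: sum_3 scale_3)
qed

lemma coordinates_2: "\<tau> x y z = (\<Sum>j\<in>UNIV. y $ j * \<tau> x (axis j 1) z)"
  using coordinates_3[of x z y] by (simp only: commute_23[of x _ z])

lemma coordinates_23:
  "\<tau> x y z = (\<Sum>j\<in>UNIV. \<Sum>k\<in>UNIV. y $ j * z $ k * \<tau> x (axis j 1) (axis k 1))"
proof -
  have "y $ j * \<tau> x (axis j 1) z = (\<Sum>k\<in>UNIV. y $ j * z $ k * \<tau> x (axis j 1) (axis k 1))" for j
    by (subst coordinates_3) (simp only: sum_distrib_left mult.assoc)
  then show ?thesis by (subst coordinates_2) (simp only:)
qed

end

lemma cubic_polarization_add:
  assumes "cubic_polarization \<sigma>" "cubic_polarization \<tau>"
  shows "cubic_polarization (\<lambda>x y z. \<sigma> x y z + \<tau> x y z)"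
proof -
  interpret \<sigma>: cubic_polarization \<sigma> by fact
  interpret \<tau>: cubic_polarization \<tau> by fact
  show ?thesis
  proof
    show "\<sigma> x y z + \<tau> x y z = \<sigma> y x z + \<tau> y x z" for x y z
      by (simp only: \<sigma>.commute_12[of x] \<tau>.commute_12[of x])
    show "\<sigma> x y z + \<tau> x y z = \<sigma> x z y + \<tau> x z y" for x y z
      by (simp only: \<sigma>.commute_23[of _ y] \<tau>.commute_23[of _ y])
  qed (simp_all add: \<sigma>.add_1 \<tau>.add_1 \<sigma>.scale_1 \<tau>.scale_1 distrib_left)
qed

lemma cubic_polarization_scale:
  assumes "cubic_polarization \<tau>"
  shows "cubic_polarization (\<lambda>x y z. k * \<tau> x y z)"
proof -
  interpret cubic_polarization \<tau> by fact
  show ?thesis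
  proof
    show "k * \<tau> x y z = k * \<tau> y x z" for x y z
      by (simp only: commute_12[of x])
    show "k * \<tau> x y z = k * \<tau> x z y" for x y z
      by (simp only: commute_23[of _ y])
  qed (simp_all add: add_1 scale_1 distrib_left)
qed

lemma cubic_polarization_sum:
  assumes "\<And>j. j \<in> J \<Longrightarrow> cubic_polarization (\<tau> j)"
  shows "cubic_polarization (\<lambda>x y z. \<Sum>j\<in>J. \<tau> j x y z)"
proof -
  have "cubic_polarization (\<lambda>_ _ _. 0)" by unfold_locales auto
  with assms show ?thesis
    by (induction J rule: infinite_finite_induct) (auto intro: cubic_polarization_add)
qed

lemma cubic_polarization_linear_cube:
  fixes l :: "complex^4 \<Rightarrow> complex"
  assumes "\<And>x y. l (x + y) = l x + l y" "\<And>k x. l (k *s x) = k * l x"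
  shows "cubic_polarization (\<lambda>x y z. l x * l y * l z)"
  by unfold_locales (simp_all add: assms algebra_simps)

text \<open>Peels one variable off a monomial; three applications turn a cubic monomial into a
  product of three coordinates, which is easy to polarize.\<close>

lemma exponent_split:
  fixes \<alpha> :: "'n::finite \<Rightarrow> nat"
  assumes "(\<Sum>i\<in>UNIV. \<alpha> i) = Suc d"
  obtains i \<beta> where "(\<Sum>i\<in>UNIV. \<beta> i) = d" "\<And>v. monom_eval \<alpha> v = v $ i * monom_eval \<beta> v"
proof -
  obtain i where i: "\<alpha> i \<noteq> 0" using assms by (metis sum.neutral nat.distinct(1))
  define \<beta> where "\<beta> = \<alpha>(i := \<alpha> i - 1)"
  have s: "(\<Sum>j\<in>UNIV. \<alpha> j) = \<alpha> i + (\<Sum>j\<in>UNIV - {i}. \<alpha> j)" "(\<Sum>j\<in>UNIV. \<beta> j) = \<beta> i + (\<Sum>j\<in>UNIV - {i}. \<beta> j)"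
    by (rule sum.remove; simp)+
  have "(\<Sum>j\<in>UNIV - {i}. \<beta> j) = (\<Sum>j\<in>UNIV - {i}. \<alpha> j)"
    by (intro sum.cong) (auto simp: \<beta>_def)
  with s i assms have "(\<Sum>j\<in>UNIV. \<beta> j) = d" by (simp add: \<beta>_def)
  moreover have "monom_eval \<alpha> v = v $ i * monom_eval \<beta> v" for v
  proof -
    have p: "monom_eval \<alpha> v = v $ i ^ \<alpha> i * (\<Prod>j\<in>UNIV - {i}. v $ j ^ \<alpha> j)"
      "monom_eval \<beta> v = v $ i ^ \<beta> i * (\<Prod>j\<in>UNIV - {i}. v $ j ^ \<beta> j)"
      unfolding monom_eval_def by (rule prod.remove; simp)+
    have "(\<Prod>j\<in>UNIV - {i}. v $ j ^ \<beta> j) = (\<Prod>j\<in>UNIV - {i}. v $ j ^ \<alpha> j)"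
      by (intro prod.cong) (auto simp: \<beta>_def)
    moreover have "v $ i ^ \<alpha> i = v $ i * v $ i ^ \<beta> i"
      using i by (simp add: \<beta>_def power_eq_if)
    ultimately show ?thesis using p by simp
  qed
  ultimately show thesis using that by blast
qed

lemma cubic_monom_polarization:
  fixes \<alpha> :: "4 \<Rightarrow> nat"
  assumes "(\<Sum>i\<in>UNIV. \<alpha> i) = 3"
  shows "\<exists>\<tau>. cubic_polarization \<tau> \<and> (\<forall>x. monom_eval \<alpha> x = \<tau> x x x)"
proof -
  have s\<alpha>: "(\<Sum>i\<in>UNIV. \<alpha> i) = Suc 2" using assms by simp
  obtain i \<beta> where \<beta>: "(\<Sum>i\<in>UNIV. \<beta> i) = 2" "\<And>v. monom_eval \<alpha> v = v $ i * monom_eval \<beta> v"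
    using exponent_split[of \<alpha> 2, OF s\<alpha>] by metis
  have s\<beta>: "(\<Sum>i\<in>UNIV. \<beta> i) = Suc 1" using \<beta>(1) by simp
  obtain j \<gamma> where \<gamma>: "(\<Sum>i\<in>UNIV. \<gamma> i) = 1" "\<And>v. monom_eval \<beta> v = v $ j * monom_eval \<gamma> v"
    using exponent_split[of \<beta> 1, OF s\<beta>] by metis
  have s\<gamma>: "(\<Sum>i\<in>UNIV. \<gamma> i) = Suc 0" using \<gamma>(1) by simp
  obtain k \<delta> where \<delta>: "(\<Sum>i\<in>UNIV. \<delta> i) = 0" "\<And>v. monom_eval \<gamma> v = v $ k * monom_eval \<delta> v"
    using exponent_split[of \<gamma> 0, OF s\<gamma>] by metis
  have "\<delta> = (\<lambda>_. 0)" using \<delta>(1) by (auto simp: fun_eq_iff)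
  then have m: "monom_eval \<alpha> x = x $ i * (x $ j * x $ k)" for x
    unfolding \<beta>(2) \<gamma>(2) \<delta>(2) by (simp add: monom_eval_def)
  \<comment> \<open>The average of the product over the six assignments of the arguments to the
    three coordinates.\<close>
  define \<tau> where "\<tau> x y z = (1/6) * (x $ i * y $ j * z $ k + x $ i * z $ j * y $ k +
      y $ i * x $ j * z $ k + y $ i * z $ j * x $ k + z $ i * x $ j * y $ k + z $ i * y $ j * x $ k)"
    for x y z :: "complex^4"
  have "cubic_polarization \<tau>"
    by unfold_locales (simp_all add: \<tau>_def algebra_simps)
  moreover have "\<forall>x. monom_eval \<alpha> x = \<tau> x x x" by (simp add: m \<tau>_def)
  ultimately show ?thesis by blast
qed

lemma cubic_form_polarization:
  obtains \<tau> where "cubic_polarization \<tau>" "\<And>x. cubic_form c x = \<tau> x x x"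
proof -
  have "\<exists>\<tau>. cubic_polarization \<tau> \<and> (\<forall>x. monom_eval (exponent \<alpha>) x = \<tau> x x x)" for \<alpha>
    using cubic_monom_polarization exponent[of \<alpha>] by blast
  then obtain \<tau> where \<tau>: "\<And>\<alpha>. cubic_polarization (\<tau> \<alpha>)" "\<And>\<alpha> x. monom_eval (exponent \<alpha>) x = \<tau> \<alpha> x x x"
    by metis
  show thesis
  proof
    show "cubic_polarization (\<lambda>x y z. \<Sum>\<alpha>\<in>UNIV. c $ \<alpha> * \<tau> \<alpha> x y z)"
      by (intro cubic_polarization_sum cubic_polarization_scale \<tau>)
    show "cubic_form c x = (\<Sum>\<alpha>\<in>UNIV. c $ \<alpha> * \<tau> \<alpha> x x x)" for x
      by (simp add: cubic_form_def \<tau>)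
  qed
qed

section \<open>Special families of cubic surfaces\<close>

lemma cubic_form_eq_form_eval: "cubic_form c x = form_eval 3 (\<lambda>\<alpha>. c $ Cubic_exponent \<alpha>) x"
proof -
  have "bij_betw exponent UNIV {\<alpha> :: 4 \<Rightarrow> nat. (\<Sum>i\<in>UNIV. \<alpha> i) = 3}"
    by (metis bij_betw_def exponent_inject inj_onI type_definition.Rep_range type_definition_cubic_exponent)
  then show ?thesis
    unfolding form_eval_def cubic_form_def
    by (subst sum.reindex_bij_betw[symmetric]) (auto simp: exponent_inverse)
qed

text \<open>By Fourier inversion the coefficients of a cubic form are linear combinations of its
  values at the torus points, hence polynomials in the parameters as soon as the values are. A
  family can therefore be given by its values. The bound is \<open>18 = 20 - 2\<close>: the
  dimension count requires two more coefficients than parameters.\<close>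

lemma vanishing_form_for_family:
  fixes F :: "(nat \<Rightarrow> complex) \<Rightarrow> complex^4 \<Rightarrow> complex"
  assumes F: "\<And>x. param_polynomial m (\<lambda>\<theta>. F \<theta> x)" and m: "m \<le> 18"
  shows "\<exists>k a. (\<exists>c :: complex^cubic_exponent. form_eval k a c \<noteq> 0) \<and>
    (\<forall>c \<theta>. (\<forall>x. cubic_form c x = F \<theta> x) \<longrightarrow> form_eval k a c = 0)"
proof -
  define w where "w \<alpha> q = (\<Prod>i\<in>UNIV. (inverse (cis (2 * pi / Suc 3)) ^ exponent \<alpha> i) ^ q i)" for \<alpha> q
  define P where "P \<alpha> \<theta> = (1 / of_nat (Suc 3) ^ CARD(4)) *
    (\<Sum>q\<in>PiE UNIV (\<lambda>_. {..<Suc 3}). w \<alpha> q * F \<theta> (torus_point (Suc 3) q))" for \<alpha> \<theta>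
  have poly: "param_polynomial m (P \<alpha>)" for \<alpha>
    unfolding P_def by (intro param_polynomial_intros F)
  have dim: "m + 2 \<le> CARD(cubic_exponent)" using m by (simp add: card_cubic_exponent)
  obtain k a where ka: "\<exists>c :: complex^cubic_exponent. form_eval k a c \<noteq> 0"
    "\<forall>\<theta>. form_eval k a (\<chi> \<alpha>. P \<alpha> \<theta>) = 0"
    using vanishing_form_exists[of m P, OF poly dim] by blast
  have "form_eval k a c = 0" if c: "\<And>x. cubic_form c x = F \<theta> x" for c \<theta>
  proof -
    have "c $ \<alpha> = P \<alpha> \<theta>" for \<alpha>
    proof -
      have "c $ \<alpha> * of_nat (Suc 3) ^ CARD(4) =
        (\<Sum>q\<in>PiE UNIV (\<lambda>_. {..<Suc 3}). w \<alpha> q * F \<theta> (torus_point (Suc 3) q))"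
        using form_eval_coefficient[of "exponent \<alpha>" 3 "\<lambda>\<beta>. c $ Cubic_exponent \<beta>"] exponent[of \<alpha>]
        by (simp add: w_def exponent_inverse flip: c cubic_form_eq_form_eval)
      then show ?thesis by (simp add: P_def field_simps)
    qed
    then have "c = (\<chi> \<alpha>. P \<alpha> \<theta>)" by (simp add: vec_eq_iff)
    with ka(2) show ?thesis by simp
  qed
  with ka(1) show ?thesis by blast
qed

text \<open>A linear form times a quadratic form, with \<open>4 + 10 = 14\<close> coefficients
  displayed as parameters so that they can be counted.\<close>

definition reducible_cubic :: "(complex^4 \<Rightarrow> complex) \<Rightarrow> bool" where
  "reducible_cubic f \<longleftrightarrow> (\<exists>\<theta> :: nat \<Rightarrow> complex. \<forall>x. f x =
     (\<theta> 0 * x $ 1 + \<theta> 1 * x $ 2 + \<theta> 2 * x $ 3 + \<theta> 3 * x $ 4) *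
     (\<theta> 4 * x $ 1 * x $ 1 + \<theta> 5 * x $ 2 * x $ 2 + \<theta> 6 * x $ 3 * x $ 3 + \<theta> 7 * x $ 4 * x $ 4 +
      \<theta> 8 * x $ 1 * x $ 2 + \<theta> 9 * x $ 1 * x $ 3 + \<theta> 10 * x $ 1 * x $ 4 +
      \<theta> 11 * x $ 2 * x $ 3 + \<theta> 12 * x $ 2 * x $ 4 + \<theta> 13 * x $ 3 * x $ 4))"

text \<open>Cones (\<open>l = 0\<close>) and cyclic cubics, i.e. triple coverings of a plane ramified in a plane section.\<close>

definition cyclic_cubic :: "(complex^4 \<Rightarrow> complex) \<Rightarrow> bool" where
  "cyclic_cubic f \<longleftrightarrow> (\<exists>l u. u \<noteq> 0 \<and>
     (\<forall>x y. l (x + y) = l x + l y) \<and> (\<forall>k x. l (k *s x) = k * l x) \<and>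
     (\<forall>k x. f (x + k *s u) - l (x + k *s u) ^ 3 = f x - l x ^ 3))"

lemma vanishing_form_reducible:
  obtains k a where "\<exists>c :: complex^cubic_exponent. form_eval k a c \<noteq> 0"
    "\<And>c. reducible_cubic (cubic_form c) \<Longrightarrow> form_eval k a c = 0"
proof -
  define F :: "(nat \<Rightarrow> complex) \<Rightarrow> complex^4 \<Rightarrow> complex" where "F \<theta> x =
     (\<theta> 0 * x $ 1 + \<theta> 1 * x $ 2 + \<theta> 2 * x $ 3 + \<theta> 3 * x $ 4) *
     (\<theta> 4 * x $ 1 * x $ 1 + \<theta> 5 * x $ 2 * x $ 2 + \<theta> 6 * x $ 3 * x $ 3 + \<theta> 7 * x $ 4 * x $ 4 +
      \<theta> 8 * x $ 1 * x $ 2 + \<theta> 9 * x $ 1 * x $ 3 + \<theta> 10 * x $ 1 * x $ 4 +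
      \<theta> 11 * x $ 2 * x $ 3 + \<theta> 12 * x $ 2 * x $ 4 + \<theta> 13 * x $ 3 * x $ 4)" for \<theta> x
  have le: "(14 :: nat) \<le> 18" by simp
  have poly: "param_polynomial 14 (\<lambda>\<theta>. F \<theta> x)" for x
    unfolding F_def by (intro param_polynomial_intros) simp_all
  obtain k a where ka: "\<exists>c :: complex^cubic_exponent. form_eval k a c \<noteq> 0"
    "\<forall>c \<theta>. (\<forall>x. cubic_form c x = F \<theta> x) \<longrightarrow> form_eval k a c = 0"
    using vanishing_form_for_family[of 14 F, OF poly le] by blast
  moreover have "\<exists>\<theta>. \<forall>x. cubic_form c x = F \<theta> x" if "reducible_cubic (cubic_form c)" for c
    using that unfolding reducible_cubic_def F_def .
  ultimately show thesis using that by blast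
qed

text \<open>Minus the cube of \<open>h\<close>, the cubic is invariant under translation by
  \<open>u\<close>, so it is a ternary cubic evaluated at the projection of the point along
  \<open>u\<close> to the plane where coordinate \<open>i\<close> vanishes. This takes
  \<open>4\<close> parameters for \<open>h\<close>, \<open>10\<close> for the ternary cubic and
  \<open>3\<close> for the ratios of the coordinates of \<open>u\<close>, in all
  \<open>17\<close>.\<close>

lemma vanishing_form_cyclic_at:
  fixes i j k l :: 4
  assumes ijkl: "distinct [i, j, k, l]" "UNIV = {i, j, k, l}"
  obtains d a where "\<exists>c :: complex^cubic_exponent. form_eval d a c \<noteq> 0"
    "\<And>c h u. \<lbrakk>u $ i \<noteq> 0; \<And>x y. h (x + y) = h x + h y; \<And>s x. h (s *s x) = s * h x;
       \<And>s x. cubic_form c (x + s *s u) - h (x + s *s u) ^ 3 = cubic_form c x - h x ^ 3\<rbrakk>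
       \<Longrightarrow> form_eval d a c = 0"
proof -
  define F :: "(nat \<Rightarrow> complex) \<Rightarrow> complex^4 \<Rightarrow> complex" where "F \<theta> x =
     (\<theta> 0 * x $ i + \<theta> 1 * x $ j + \<theta> 2 * x $ k + \<theta> 3 * x $ l) ^ 3 +
     (\<theta> 4 * (x $ j - \<theta> 14 * x $ i) ^ 3 + \<theta> 5 * (x $ k - \<theta> 15 * x $ i) ^ 3 + \<theta> 6 * (x $ l - \<theta> 16 * x $ i) ^ 3 +
      \<theta> 7 * (x $ j - \<theta> 14 * x $ i) ^ 2 * (x $ k - \<theta> 15 * x $ i) +
      \<theta> 8 * (x $ j - \<theta> 14 * x $ i) ^ 2 * (x $ l - \<theta> 16 * x $ i) +
      \<theta> 9 * (x $ k - \<theta> 15 * x $ i) ^ 2 * (x $ j - \<theta> 14 * x $ i) +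
      \<theta> 10 * (x $ k - \<theta> 15 * x $ i) ^ 2 * (x $ l - \<theta> 16 * x $ i) +
      \<theta> 11 * (x $ l - \<theta> 16 * x $ i) ^ 2 * (x $ j - \<theta> 14 * x $ i) +
      \<theta> 12 * (x $ l - \<theta> 16 * x $ i) ^ 2 * (x $ k - \<theta> 15 * x $ i) +
      \<theta> 13 * (x $ j - \<theta> 14 * x $ i) * (x $ k - \<theta> 15 * x $ i) * (x $ l - \<theta> 16 * x $ i))" for \<theta> x
  have le: "(17 :: nat) \<le> 18" by simp
  have poly: "param_polynomial 17 (\<lambda>\<theta>. F \<theta> x)" for x
    unfolding F_def by (intro param_polynomial_intros) simp_all
  obtain d a where da: "\<exists>c :: complex^cubic_exponent. form_eval d a c \<noteq> 0"
    "\<forall>c \<theta>. (\<forall>x. cubic_form c x = F \<theta> x) \<longrightarrow> form_eval d a c = 0"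
    using vanishing_form_for_family[of 17 F, OF poly le] by blast
  have "\<exists>\<theta>. \<forall>x. cubic_form c x = F \<theta> x"
    if u: "u $ i \<noteq> 0" and h: "\<And>x y. h (x + y) = h x + h y" "\<And>s x. h (s *s x) = s * h x"
      and inv: "\<And>s x. cubic_form c (x + s *s u) - h (x + s *s u) ^ 3 = cubic_form c x - h x ^ 3"
    for c h u
  proof -
    obtain \<tau>\<^sub>0 where \<tau>\<^sub>0: "cubic_polarization \<tau>\<^sub>0" "\<And>x. cubic_form c x = \<tau>\<^sub>0 x x x"
      using cubic_form_polarization by blast
    define \<tau> where "\<tau> x y z = \<tau>\<^sub>0 x y z + (-1) * (h x * h y * h z)" for x y z
    interpret cubic_polarization \<tau>
      unfolding \<tau>_def
      by (intro cubic_polarization_add cubic_polarization_scale cubic_polarization_linear_cube h \<tau>\<^sub>0)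
    have g: "cubic_form c x - h x ^ 3 = \<tau> x x x" for x
      by (simp add: \<tau>\<^sub>0 \<tau>_def power3_eq_cube)
    define b where "b q = axis q (1 :: complex)" for q :: 4
    define \<theta> where "\<theta> = (!) [h (b i), h (b j), h (b k), h (b l),
       \<tau> (b j) (b j) (b j), \<tau> (b k) (b k) (b k), \<tau> (b l) (b l) (b l),
       3 * \<tau> (b j) (b j) (b k), 3 * \<tau> (b j) (b j) (b l), 3 * \<tau> (b k) (b k) (b j),
       3 * \<tau> (b k) (b k) (b l), 3 * \<tau> (b l) (b l) (b j), 3 * \<tau> (b l) (b l) (b k),
       6 * \<tau> (b j) (b k) (b l), u $ j / u $ i, u $ k / u $ i, u $ l / u $ i]"
    have sum4: "(\<Sum>q\<in>UNIV. w q) = w i + w j + w k + w l" for w :: "4 \<Rightarrow> complex^4"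
      unfolding ijkl(2) using ijkl(1) by (simp add: add_ac)
    have expansion: "x = x $ i *s b i + x $ j *s b j + x $ k *s b k + x $ l *s b l" for x
      using basis_expansion[of x] by (simp add: sum4 b_def)
    have "cubic_form c x = F \<theta> x" for x
    proof -
      \<comment> \<open>This multiple of \<open>u\<close> moves \<open>x\<close> to the plane where
        coordinate \<open>i\<close> vanishes.\<close>
      define s where "s = - x $ i / u $ i"
      define y where "y = x + s *s u"
      have y: "y $ i = 0" "y $ q = x $ q - u $ q / u $ i * x $ i" for q
        using u by (simp_all add: y_def s_def)
      have hx: "h x = h (b i) * x $ i + h (b j) * x $ j + h (b k) * x $ k + h (b l) * x $ l"
        by (subst expansion[of x]) (simp add: h mult.commute)
      have e1: "cubic_form c x = h x ^ 3 + \<tau> y y y"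
        using inv[of x s] g[of y] by (simp add: y_def algebra_simps)
      have e2: "\<tau> y y y = \<tau> (y $ j *s b j + y $ k *s b k + y $ l *s b l)
         (y $ j *s b j + y $ k *s b k + y $ l *s b l) (y $ j *s b j + y $ k *s b k + y $ l *s b l)"
        using expansion[of y] y(1) by simp
      have e3: "\<tau> (A *s b j + B *s b k + C *s b l) (A *s b j + B *s b k + C *s b l) (A *s b j + B *s b k + C *s b l) =
        \<tau> (b j) (b j) (b j) * A ^ 3 + \<tau> (b k) (b k) (b k) * B ^ 3 + \<tau> (b l) (b l) (b l) * C ^ 3 +
        3 * \<tau> (b j) (b j) (b k) * A ^ 2 * B + 3 * \<tau> (b j) (b j) (b l) * A ^ 2 * C +
        3 * \<tau> (b k) (b k) (b j) * B ^ 2 * A + 3 * \<tau> (b k) (b k) (b l) * B ^ 2 * C +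
        3 * \<tau> (b l) (b l) (b j) * C ^ 2 * A + 3 * \<tau> (b l) (b l) (b k) * C ^ 2 * B +
        6 * \<tau> (b j) (b k) (b l) * A * B * C" for A B C
        by (simp add: expand commute algebra_simps power2_eq_square power3_eq_cube)
      show ?thesis
        unfolding e1 e2 e3 hx by (simp add: F_def \<theta>_def y(2))
    qed
    then show ?thesis by blast
  qed
  with da that show thesis by blast
qed

text \<open>Which coordinate of \<open>u\<close> is nonzero depends on the cubic, hence one form for
  every coordinate and a conclusion that at least one of the four vanishes.\<close>

lemma vanishing_form_cyclic:
  obtains d a where "\<And>q. \<exists>c :: complex^cubic_exponent. form_eval (d q) (a q) c \<noteq> 0"
    "\<And>c. cyclic_cubic (cubic_form c) \<Longrightarrow> \<exists>q :: 4. form_eval (d q) (a q) c = 0"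
proof -
  let ?Q = "\<lambda>i d a. (\<exists>c :: complex^cubic_exponent. form_eval d a c \<noteq> 0) \<and>
    (\<forall>c h u. u $ i \<noteq> 0 \<longrightarrow> (\<forall>x y. h (x + y) = h x + h y) \<longrightarrow> (\<forall>s x. h (s *s x) = s * h x) \<longrightarrow>
       (\<forall>s x. cubic_form c (x + s *s u) - h (x + s *s u) ^ 3 = cubic_form c x - h x ^ 3)
       \<longrightarrow> form_eval d a c = 0)"
  have Q: "\<exists>d a. ?Q i d a" if "distinct [i, j, k, l]" "UNIV = {i, j, k, l}" for i j k l :: 4
    by (rule vanishing_form_cyclic_at[OF that]) blast
  have "\<exists>d a. ?Q i d a" for i :: 4
  proof -
    consider "i = 1" | "i = 2" | "i = 3" | "i = 4" using exhaust_4 by blast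
    then show ?thesis
    proof cases
      case 1
      have "UNIV = {1,2,3,4 :: 4}" unfolding UNIV_4 by blast
      then show ?thesis unfolding 1 by (rule Q[rotated]) simp
    next
      case 2
      have "UNIV = {2,1,3,4 :: 4}" unfolding UNIV_4 by blast
      then show ?thesis unfolding 2 by (rule Q[rotated]) simp
    next
      case 3
      have "UNIV = {3,1,2,4 :: 4}" unfolding UNIV_4 by blast
      then show ?thesis unfolding 3 by (rule Q[rotated]) simp
    next
      case 4
      have "UNIV = {4,1,2,3 :: 4}" unfolding UNIV_4 by blast
      then show ?thesis unfolding 4 by (rule Q[rotated]) simp
    qed
  qed
  then obtain d a where da: "\<And>i. ?Q i (d i) (a i)" by metis
  show thesis
  proof
    show "\<exists>c :: complex^cubic_exponent. form_eval (d q) (a q) c \<noteq> 0" for q using da by blast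
    fix c assume "cyclic_cubic (cubic_form c)"
    then obtain l u where lu: "u \<noteq> 0" "\<forall>x y. l (x + y) = l x + l y" "\<forall>k x. l (k *s x) = k * l x"
     "\<forall>k x. cubic_form c (x + k *s u) - l (x + k *s u) ^ 3 = cubic_form c x - l x ^ 3"
      unfolding cyclic_cubic_def by blast
    obtain q where "u $ q \<noteq> 0" using lu(1) by (auto simp: vec_eq_iff)
    with da[of q] lu have "form_eval (d q) (a q) c = 0" by blast
    then show "\<exists>q. form_eval (d q) (a q) c = 0" ..
  qed
qed

lemma general_cubic:
  obtains G :: "(complex^cubic_exponent) set set" where "openin zariski_topology G"
    "zariski_topology closure_of G = proj_space"
    "\<And>C c. C \<in> G \<Longrightarrow> c \<in> C \<Longrightarrow> c \<noteq> 0 \<Longrightarrow> \<not> reducible_cubic (cubic_form c) \<and> \<not> cyclic_cubic (cubic_form c)"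
proof -
  obtain k\<^sub>0 a\<^sub>0 where 0: "\<exists>c :: complex^cubic_exponent. form_eval k\<^sub>0 a\<^sub>0 c \<noteq> 0"
    "\<And>c. reducible_cubic (cubic_form c) \<Longrightarrow> form_eval k\<^sub>0 a\<^sub>0 c = 0"
    using vanishing_form_reducible by metis
  obtain d a where 1: "\<And>q. \<exists>c :: complex^cubic_exponent. form_eval (d q) (a q) c \<noteq> 0"
    "\<And>c. cyclic_cubic (cubic_form c) \<Longrightarrow> \<exists>q :: 4. form_eval (d q) (a q) c = 0"
    using vanishing_form_cyclic by metis
  define N where "N k b = {V \<in> proj_space. \<exists>v\<in>V. form_eval k b v \<noteq> 0}"
    for k and b :: "(cubic_exponent \<Rightarrow> nat) \<Rightarrow> complex"
  have open_N: "openin zariski_topology (N k b)" for k b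
    unfolding N_def by (rule openin_zariski_nonzero_form) (auto simp: is_form_def)
  have N_iff: "form_eval k b c \<noteq> 0" if "C \<in> N k b" "c \<in> C" "c \<noteq> 0" for C k b c
  proof -
    have "vec.span {c} = C" using that span_singleton_eq by (auto simp: N_def)
    then show ?thesis using that(1) form_nonzero_on_span_iff[of c k b] by (auto simp: N_def)
  qed
  \<comment> \<open>In degree \<open>0\<close> the given vector \<open>c\<close> may be zero and
    then spans no point. It is moved along a coordinate axis, avoiding the finitely many zeros of
    the form and the parameter where the coordinate vanishes.\<close>
  have nonempty: "N k b \<noteq> {}" if "\<exists>c. form_eval k b c \<noteq> 0" for k b
  proof -
    from that obtain c where c: "form_eval k b c \<noteq> 0" by blast
    have "finite {s. form_eval k b (c + s *s axis undefined 1) = 0}"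
      by (rule finite_zeros_on_line[OF c])
    then have "finite ({s. form_eval k b (c + s *s axis undefined 1) = 0} \<union> {- c $ undefined})" by simp
    from ex_new_if_finite[OF infinite_UNIV_char_0 this]
    obtain s where s: "form_eval k b (c + s *s axis undefined 1) \<noteq> 0" "s \<noteq> - c $ undefined" by auto
    have "(c + s *s axis undefined 1) $ undefined \<noteq> 0"
      using s(2) by (simp add: axis_def add_eq_0_iff)
    then have "c + s *s axis undefined 1 \<noteq> 0" by (metis zero_index)
    then have "vec.span {c + s *s axis undefined 1} \<in> N k b"
      using s(1)
      by (simp only: N_def mem_Collect_eq form_nonzero_on_span_iff span_singleton_in_proj_space simp_thms)
    then show ?thesis by blast
  qed
  define G where "G = N k\<^sub>0 a\<^sub>0 \<inter> (N (d 1) (a 1) \<inter> (N (d 2) (a 2) \<inter> (N (d 3) (a 3) \<inter> N (d 4) (a 4))))"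
  have G_open: "openin zariski_topology G" unfolding G_def by (intro openin_Int open_N)
  moreover have "G \<noteq> {}"
    unfolding G_def by (intro zariski_open_Int_nonempty openin_Int open_N nonempty 0(1) 1(1))
  then have "zariski_topology closure_of G = proj_space"
    by (rule zariski_open_dense[OF G_open])
  moreover have "\<not> reducible_cubic (cubic_form c) \<and> \<not> cyclic_cubic (cubic_form c)"
    if "C \<in> G" "c \<in> C" "c \<noteq> 0" for C c
  proof -
    have "C \<in> N (d q) (a q)" for q using that(1) exhaust_4[of q] by (auto simp: G_def)
    moreover have "C \<in> N k\<^sub>0 a\<^sub>0" using that(1) by (simp add: G_def)
    ultimately show ?thesis using N_iff that(2,3) 0(2) 1(2) by metis
  qed
  ultimately show thesis by (rule that)
qed

section \<open>Depressed cubics\<close>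

definition dcubic :: "complex \<Rightarrow> complex \<Rightarrow> complex \<Rightarrow> complex" where
  "dcubic p q t = t ^ 3 + p * t + q"

definition discr :: "complex \<Rightarrow> complex \<Rightarrow> complex" where
  "discr p q = - 4 * p ^ 3 - 27 * q ^ 2"

lemma monic_cubic_splits:
  fixes a b c :: complex
  obtains x y z where "\<And>t. t ^ 3 + a * t ^ 2 + b * t + c = (t - x) * (t - y) * (t - z)"
proof -
  obtain x where "(\<Sum>i\<le>3. (!) [c, b, a, 1] i * x ^ i) = 0"
    by (rule Cauchy_Integral_Formula.fundamental_theorem_of_algebra[of "(!) [c, b, a, 1]" 3])
       (auto intro: bexI[of _ 3])
  then have x: "c = - (x ^ 3 + a * x ^ 2 + b * x)"
    by (simp add: eval_nat_numeral algebra_simps eq_neg_iff_add_eq_0)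
  \<comment> \<open>These are the coefficients of the quotient of the cubic by
    \<open>t - x\<close>.\<close>
  obtain y where "(\<Sum>i\<le>2. (!) [x ^ 2 + a * x + b, x + a, 1] i * y ^ i) = 0"
    by (rule Cauchy_Integral_Formula.fundamental_theorem_of_algebra[of "(!) [x ^ 2 + a * x + b, x + a, 1]" 2])
       (auto intro: bexI[of _ 2])
  then have y: "b = - (y ^ 2 + (x + a) * y + x ^ 2 + a * x)"
    by (simp add: eval_nat_numeral algebra_simps eq_neg_iff_add_eq_0)
  have "t ^ 3 + a * t ^ 2 + b * t + c = (t - x) * (t - y) * (t - (- (x + y + a)))" for t
    unfolding x y by (simp add: power2_eq_square power3_eq_cube algebra_simps)
  then show thesis by (rule that)
qed

lemma dcubic_factors_sum_zero:
  assumes "\<And>t. dcubic p q t = (t - x) * (t - y) * (t - z)"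
  shows "z = - x - y" "p = - (x ^ 2) - x * y - y ^ 2" "q = x * y * (x + y)"
proof -
  have 0: "q = - x * y * z" using assms[of 0] by (simp add: dcubic_def)
  have 1: "1 + p + q = (1 - x) * (1 - y) * (1 - z)" using assms[of 1] by (simp add: dcubic_def)
  have m1: "- 1 - p + q = (- 1 - x) * (- 1 - y) * (- 1 - z)" using assms[of "-1"] by (simp add: dcubic_def)
  have "2 * q = - 2 * (x + y + z) - 2 * x * y * z"
    using arg_cong2[OF 1 m1, of "(+)"] by (simp add: algebra_simps)
  with 0 have "2 * (x + y + z) = 0" by (simp add: algebra_simps)
  then have "x + y + z = 0" by (metis mult_eq_0_iff zero_neq_numeral)
  then show z: "z = - x - y" by (simp add: algebra_simps eq_neg_iff_add_eq_0)
  show q: "q = x * y * (x + y)" using 0 z by (simp add: algebra_simps)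
  have "p = (1 - x) * (1 - y) * (1 - z) - 1 - q" unfolding 1[symmetric] by simp
  then show "p = - (x ^ 2) - x * y - y ^ 2"
    unfolding q z by (simp add: algebra_simps power2_eq_square)
qed

lemma discr_factors:
  assumes "\<And>t. dcubic p q t = (t - x) * (t - y) * (t - z)"
  shows "discr p q = ((x - y) * (y - z) * (z - x)) ^ 2"
  unfolding discr_def dcubic_factors_sum_zero[OF assms] by algebra

lemma dcubic_splits:
  obtains x y z where "\<And>t. dcubic p q t = (t - x) * (t - y) * (t - z)"
    "discr p q = ((x - y) * (y - z) * (z - x)) ^ 2"
proof -
  obtain x y z where "\<And>t. t ^ 3 + 0 * t ^ 2 + p * t + q = (t - x) * (t - y) * (t - z)"
    using monic_cubic_splits[of 0 p q] by blast
  then have *: "\<And>t. dcubic p q t = (t - x) * (t - y) * (t - z)" by (simp add: dcubic_def)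
  show thesis by (rule that[OF *]) (use discr_factors[OF *] in auto)
qed

text \<open>\<open>3 * t ^ 2 + p\<close> is the derivative of the cubic. At a multiple root
  \<open>p = - 3 * t ^ 2\<close> and \<open>q = 2 * t ^ 3\<close>, and the two terms of the
  discriminant cancel.\<close>

lemma dcubic_simple_root:
  assumes "dcubic p q t = 0" "discr p q \<noteq> 0"
  shows "3 * t ^ 2 + p \<noteq> 0"
proof
  assume "3 * t ^ 2 + p = 0"
  then have p: "p = - 3 * t ^ 2" by (simp add: add_eq_0_iff2)
  have "q = t ^ 3 + p * t + q - (t ^ 3 + p * t)" by simp
  also have "t ^ 3 + p * t + q = 0" using assms(1) by (simp add: dcubic_def)
  also have "0 - (t ^ 3 + p * t) = 2 * t ^ 3" by (simp add: p power2_eq_square power3_eq_cube)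
  finally have "discr p q = - 4 * (- 3 * t ^ 2) ^ 3 - 27 * (2 * t ^ 3) ^ 2" by (simp add: discr_def p)
  also have "\<dots> = 0" by algebra
  finally show False using assms(2) by simp
qed

text \<open>The powers of \<open>M\<close> follow the weights \<open>2\<close> and \<open>3\<close>
  of \<open>p\<close> and \<open>q\<close>. When these are polynomials of degrees at most
  \<open>2\<close> and \<open>3\<close> in a variable, the bound becomes linear growth of the
  root.\<close>

lemma dcubic_root_bound:
  assumes "dcubic p q t = 0" "norm p \<le> M ^ 2" "norm q \<le> M ^ 3" "M > 0"
  shows "norm t \<le> 2 * M"
proof (rule ccontr)
  assume "\<not> norm t \<le> 2 * M"
  then have t: "norm t > 2 * M" by simp
  have "t ^ 3 = - (p * t + q)" using assms(1) unfolding dcubic_def by (metis add.assoc add_eq_0_iff2)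
  then have "norm t ^ 3 = norm (p * t + q)" by (metis norm_minus_cancel norm_power)
  also have "\<dots> \<le> norm p * norm t + norm q" using norm_triangle_ineq[of "p * t" q] by (simp add: norm_mult)
  also have "\<dots> \<le> M ^ 2 * norm t + M ^ 3" using mult_right_mono[OF assms(2), of "norm t"] assms(3) by simp
  also have "\<dots> \<le> M ^ 2 * norm t + M ^ 2 * norm t"
    using t assms(4) by (simp add: power2_eq_square power3_eq_cube)
  also have "\<dots> < norm t ^ 3"
  proof -
    have "2 * M ^ 2 \<le> (2 * M) ^ 2" by (simp add: power2_eq_square)
    also have "\<dots> < norm t ^ 2" using t assms(4) by (intro power_strict_mono) auto
    finally have "2 * M ^ 2 * norm t < norm t ^ 2 * norm t"
      using t assms(4) by (intro mult_strict_right_mono) auto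
    then show ?thesis by (simp add: power2_eq_square power3_eq_cube)
  qed
  finally show False by simp
qed

lemma dcubic_root_near:
  assumes "norm (dcubic p q a) < \<delta> ^ 3"
  obtains t where "dcubic p q t = 0" "norm (t - a) < \<delta>"
proof -
  obtain x y z where f: "\<And>t. dcubic p q t = (t - x) * (t - y) * (t - z)" using dcubic_splits by blast
  have "\<exists>t\<in>{x, y, z}. norm (t - a) < \<delta>"
  proof (rule ccontr)
    assume "\<not> ?thesis"
    then have le: "\<delta> \<le> norm (a - x)" "\<delta> \<le> norm (a - y)" "\<delta> \<le> norm (a - z)"
      by (auto simp: norm_minus_commute not_less)
    have "0 < \<delta> ^ 3" using assms norm_ge_zero by (rule le_less_trans[rotated])
    then have "0 \<le> \<delta>" by (simp add: zero_less_power_eq)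
    then have "\<delta> * \<delta> * \<delta> \<le> norm (a - x) * norm (a - y) * norm (a - z)"
      using le by (intro mult_mono) auto
    then show False using assms by (simp add: f norm_mult power3_eq_cube)
  qed
  then show thesis using that f by auto
qed

definition factors_at :: "(complex \<times> complex \<Rightarrow> complex) \<Rightarrow> (complex \<times> complex \<Rightarrow> complex) \<Rightarrow>
    (complex \<times> complex \<Rightarrow> complex) \<Rightarrow> complex \<times> complex \<Rightarrow> bool" where
  "factors_at x y z c \<longleftrightarrow> x c \<noteq> y c \<and> x c \<noteq> z c \<and> y c \<noteq> z c \<and>
     (\<forall>t. dcubic (fst c) (snd c) t = (t - x c) * (t - y c) * (t - z c))"

lemma factors_at_permute:
  assumes "factors_at x y z c"
  shows "factors_at y x z c" "factors_at z x y c" "factors_at x z y c"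
  using assms by (auto simp: factors_at_def)

text \<open>
  Of three monic linear factors at distance at least \<open>\<delta>\<close> from \<open>a\<close> the product is at least \<open>\<delta>\<^sup>3\<close> at \<open>a\<close>;
  so a root stays near \<open>a\<close> as long as the value at \<open>a\<close> is small.
\<close>

lemma local_roots:
  assumes "discr (fst c\<^sub>0) (snd c\<^sub>0) \<noteq> 0"
  obtains T x y z where "open T" "c\<^sub>0 \<in> T"
    "continuous_on T x" "continuous_on T y" "continuous_on T z" "\<And>c. c \<in> T \<Longrightarrow> factors_at x y z c"
proof -
  obtain a b d where f0: "\<And>t. dcubic (fst c\<^sub>0) (snd c\<^sub>0) t = (t - a) * (t - b) * (t - d)"
    and "discr (fst c\<^sub>0) (snd c\<^sub>0) = ((a - b) * (b - d) * (d - a)) ^ 2"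
    using dcubic_splits by blast
  with assms have abd: "a \<noteq> b" "a \<noteq> d" "b \<noteq> d" by auto
  \<comment> \<open>Half the least distance keeps the three balls disjoint, so that each contains
    exactly one root for nearby coefficients and the roots can be labelled consistently.\<close>
  define \<delta> where "\<delta> = min (min (dist a b) (dist a d)) (dist b d) / 2"
  have \<delta>: "\<delta> > 0" "ball a \<delta> \<inter> ball b \<delta> = {}" "ball a \<delta> \<inter> ball d \<delta> = {}" "ball b \<delta> \<inter> ball d \<delta> = {}"
    using abd by (auto simp: \<delta>_def intro!: disjoint_ballI)
  define V where "V e \<epsilon> = {c. norm (dcubic (fst c) (snd c) e) < \<epsilon> ^ 3}" for e and \<epsilon> :: real
  have V_open: "open (V e \<epsilon>)" for e \<epsilon>
    unfolding V_def dcubic_def by (intro open_Collect_less continuous_intros)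
  define T where "T = V a \<delta> \<inter> V b \<delta> \<inter> V d \<delta>"
  have "\<exists>x y z. x \<in> ball a \<delta> \<and> y \<in> ball b \<delta> \<and> z \<in> ball d \<delta> \<and>
      (\<forall>t. dcubic (fst c) (snd c) t = (t - x) * (t - y) * (t - z))" if "c \<in> T" for c
  proof -
    from that obtain x y z where
      xyz: "x \<in> ball a \<delta>" "y \<in> ball b \<delta>" "z \<in> ball d \<delta>"
      "dcubic (fst c) (snd c) x = 0" "dcubic (fst c) (snd c) y = 0" "dcubic (fst c) (snd c) z = 0"
      unfolding T_def V_def by (auto simp: dist_norm norm_minus_commute elim!: dcubic_root_near)
    then have ne: "x \<noteq> y" "x \<noteq> z" "y \<noteq> z" using \<delta> by auto
    obtain u v w where f: "\<And>t. dcubic (fst c) (snd c) t = (t - u) * (t - v) * (t - w)"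
      using dcubic_splits by blast
    then have "{x, y, z} \<subseteq> {u, v, w}" using xyz by auto
    with ne have "\<forall>t. (t - u) * (t - v) * (t - w) = (t - x) * (t - y) * (t - z)"
      by (auto simp: mult_ac)
    with f xyz show ?thesis by auto
  qed
  then obtain x y z where xyz: "\<And>c. c \<in> T \<Longrightarrow> x c \<in> ball a \<delta>" "\<And>c. c \<in> T \<Longrightarrow> y c \<in> ball b \<delta>"
      "\<And>c. c \<in> T \<Longrightarrow> z c \<in> ball d \<delta>"
      "\<And>c t. c \<in> T \<Longrightarrow> dcubic (fst c) (snd c) t = (t - x c) * (t - y c) * (t - z c)"
    by metis
  have T_open: "open T" unfolding T_def by (intro open_Int V_open)
  have cont: "continuous_on T r"
    if r: "\<And>c. c \<in> T \<Longrightarrow> r c \<in> ball e \<delta>" "\<And>c. c \<in> T \<Longrightarrow> dcubic (fst c) (snd c) (r c) = 0"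
      and uniq: "\<And>c t. c \<in> T \<Longrightarrow> t \<in> ball e \<delta> \<Longrightarrow> dcubic (fst c) (snd c) t = 0 \<Longrightarrow> t = r c" for r e
  proof -
    have "(r \<longlongrightarrow> r c) (at c)" if "c \<in> T" for c
    proof (rule tendstoI)
      fix \<epsilon> :: real assume "\<epsilon> > 0"
      from r(1)[OF that] open_ball obtain \<eta> where \<eta>: "\<eta> > 0" "ball (r c) \<eta> \<subseteq> ball e \<delta>"
        by (meson openE)
      \<comment> \<open>Not larger than \<open>\<eta>\<close>, so that the root found near
        \<open>r c\<close> lies in the ball around \<open>e\<close> and is therefore the selected
        root \<open>r c'\<close>.\<close>
      define \<epsilon>' where "\<epsilon>' = min \<epsilon> \<eta>"
      have \<epsilon>': "\<epsilon>' > 0" using \<open>\<epsilon> > 0\<close> \<eta> by (simp add: \<epsilon>'_def)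
      have "c \<in> T \<inter> V (r c) \<epsilon>'" using that r(2)[OF that] \<epsilon>' by (simp add: V_def)
      then have "\<forall>\<^sub>F c' in at c. c' \<in> T \<inter> V (r c) \<epsilon>'"
        using T_open V_open by (intro eventually_at_in_open') auto
      then show "\<forall>\<^sub>F c' in at c. dist (r c') (r c) < \<epsilon>"
      proof (rule eventually_mono)
        fix c' assume c': "c' \<in> T \<inter> V (r c) \<epsilon>'"
        then obtain t where t: "dcubic (fst c') (snd c') t = 0" "norm (t - r c) < \<epsilon>'"
          by (auto simp: V_def elim: dcubic_root_near)
        then have "t \<in> ball e \<delta>" using \<eta>(2) by (auto simp: \<epsilon>'_def dist_norm norm_minus_commute subset_eq)
        then have "t = r c'" using uniq t c' by auto
        with t show "dist (r c') (r c) < \<epsilon>" by (simp add: \<epsilon>'_def dist_norm)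
      qed
    qed
    then show ?thesis using T_open by (simp add: continuous_on_eq_continuous_at continuous_at)
  qed
  show thesis
  proof
    show "open T" by fact
    show "c\<^sub>0 \<in> T" using \<delta>(1) f0 by (simp add: T_def V_def)
    show "continuous_on T x" by (rule cont[of x a]) (use xyz \<delta> in \<open>auto dest: xyz(2,3)\<close>)
    show "continuous_on T y" by (rule cont[of y b]) (use xyz \<delta> in \<open>auto dest: xyz(1,3)\<close>)
    show "continuous_on T z" by (rule cont[of z d]) (use xyz \<delta> in \<open>auto dest: xyz(1,2)\<close>)
    show "factors_at x y z c" if "c \<in> T" for c
      using xyz[OF that] \<delta> by (auto simp: factors_at_def)
  qed
qed

section \<open>The covering defined by a depressed cubic\<close>

text \<open>The function \<open>j\<close> rebuilds a point of \<open>E\<close> from its image in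
  \<open>B\<close> and a root, so \<open>E\<close> is the pullback of the root covering along
  \<open>(P, Q)\<close> and local root functions give its sheets. It is applied to the covering by
  roots itself and to the projection of the surface.\<close>

lemma covering_map_dcubic:
  fixes p :: "'a \<Rightarrow> 'b" and t :: "'a \<Rightarrow> complex" and P Q :: "'b \<Rightarrow> complex"
  assumes p: "continuous_map E B p" and t: "continuous_map E euclidean t"
    and P: "continuous_map B euclidean P" and Q: "continuous_map B euclidean Q"
    and nz: "\<And>b. b \<in> topspace B \<Longrightarrow> discr (P b) (Q b) \<noteq> 0"
    and root: "\<And>x. x \<in> topspace E \<Longrightarrow> dcubic (P (p x)) (Q (p x)) (t x) = 0"
    and j: "\<And>x. x \<in> topspace E \<Longrightarrow> j (p x) (t x) = x"
    and pj: "\<And>b r. b \<in> topspace B \<Longrightarrow> dcubic (P b) (Q b) r = 0 \<Longrightarrow>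
       j b r \<in> topspace E \<and> p (j b r) = b \<and> t (j b r) = r"
    and cont_j: "\<And>T r. \<lbrakk>openin B T; continuous_map (subtopology B T) euclidean r;
       \<And>b. b \<in> T \<Longrightarrow> dcubic (P b) (Q b) (r b) = 0\<rbrakk> \<Longrightarrow> continuous_map (subtopology B T) E (\<lambda>b. j b (r b))"
  shows "covering_map E B p"
  unfolding covering_map_def
proof (intro conjI ballI p)
  show "p ` topspace E = topspace B"
  proof
    show "p ` topspace E \<subseteq> topspace B" using p by (auto simp: continuous_map_def)
    show "topspace B \<subseteq> p ` topspace E"
    proof
      fix b assume b: "b \<in> topspace B"
      obtain r where "dcubic (P b) (Q b) r = 0" using dcubic_splits[of "P b" "Q b"] by (metis diff_self mult_zero_left)
      with pj b show "b \<in> p ` topspace E" by (metis imageI)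
    qed
  qed
next
  fix b assume b: "b \<in> topspace B"
  define PQ where "PQ b = (P b, Q b)" for b
  have PQ: "continuous_map B euclidean PQ"
    using continuous_map_pairedI[OF P Q] by (simp add: PQ_def[abs_def])
  have nzb: "discr (fst (PQ b)) (snd (PQ b)) \<noteq> 0" using nz[OF b] by (simp add: PQ_def)
  obtain T\<^sub>0 x y z where T\<^sub>0: "open T\<^sub>0" "PQ b \<in> T\<^sub>0" "continuous_on T\<^sub>0 x" "continuous_on T\<^sub>0 y" "continuous_on T\<^sub>0 z"
     "\<And>c. c \<in> T\<^sub>0 \<Longrightarrow> factors_at x y z c"
    by (rule local_roots[OF nzb]) (rule that)
  define T where "T = {b \<in> topspace B. PQ b \<in> T\<^sub>0}"
  have T_open: "openin B T"
    unfolding T_def using PQ T\<^sub>0(1) by (auto intro: openin_continuous_map_preimage)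
  define W where "W r = {e \<in> topspace E. p e \<in> T \<and> t e = r (PQ (p e))}" for r
  define E' where "E' = {e \<in> topspace E. p e \<in> T}"
  have E'_open: "openin E E'"
    unfolding E'_def using p T_open by (rule openin_continuous_map_preimage)
  have good: "openin E (W r) \<and> homeomorphic_map (subtopology E (W r)) (subtopology B T) p"
    if r: "continuous_on T\<^sub>0 r" "continuous_on T\<^sub>0 s" "continuous_on T\<^sub>0 s'"
      and f: "\<And>c. c \<in> T\<^sub>0 \<Longrightarrow> factors_at r s s' c" for r s s'
  proof
    have comp: "continuous_map (subtopology B T) euclidean (\<lambda>b. s (PQ b))" if "continuous_on T\<^sub>0 s" for s
    proof -
      have "continuous_map (subtopology B T) (top_of_set T\<^sub>0) PQ"
        using PQ by (auto simp: continuous_map_in_subtopology T_def intro: continuous_map_from_subtopology)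
      moreover have "continuous_map (top_of_set T\<^sub>0) euclidean s" using that by simp
      ultimately have "continuous_map (subtopology B T) euclidean (s \<circ> PQ)" by (rule continuous_map_compose)
      then show ?thesis by (simp add: o_def)
    qed
    have pE': "continuous_map (subtopology E E') (subtopology B T) p"
      using p by (auto simp: continuous_map_in_subtopology E'_def intro: continuous_map_from_subtopology)
    have diff: "continuous_map (subtopology E E') euclidean (\<lambda>e. t e - s (PQ (p e)))" if "continuous_on T\<^sub>0 s" for s
    proof -
      have "continuous_map (subtopology E E') euclidean ((\<lambda>b. s (PQ b)) \<circ> p)"
        using pE' comp[OF that] by (rule continuous_map_compose)
      then show ?thesis
        using t by (intro continuous_map_diff) (auto simp: o_def intro: continuous_map_from_subtopology)
    qed
    have neq: "openin (subtopology E E') {e \<in> topspace (subtopology E E'). t e - s (PQ (p e)) \<in> - {0}}"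
      if "continuous_on T\<^sub>0 s" for s
      using diff[OF that] by (rule openin_continuous_map_preimage) (simp add: open_Compl)
    \<comment> \<open>The sheet of \<open>r\<close> is cut out by an equation, which does not show
      that it is open. Since \<open>t e\<close> is one of three distinct roots, the equation amounts
      to avoiding the other two, an open condition.\<close>
    have "openin (subtopology E E') ({e \<in> topspace (subtopology E E'). t e - s (PQ (p e)) \<in> - {0}} \<inter>
        {e \<in> topspace (subtopology E E'). t e - s' (PQ (p e)) \<in> - {0}})"
      by (intro openin_Int neq r)
    also have "{e \<in> topspace (subtopology E E'). t e - s (PQ (p e)) \<in> - {0}} \<inter>
        {e \<in> topspace (subtopology E E'). t e - s' (PQ (p e)) \<in> - {0}} = W r"
    proof -
      have "t e = r (PQ (p e)) \<longleftrightarrow> t e \<noteq> s (PQ (p e)) \<and> t e \<noteq> s' (PQ (p e))" if "e \<in> E'" for e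
        using that root[of e] f[of "PQ (p e)"] by (auto simp: E'_def T_def factors_at_def PQ_def)
      then show ?thesis by (auto simp: W_def E'_def)
    qed
    finally show "openin E (W r)" using E'_open openin_trans_full by blast
    have rootr: "dcubic (P b) (Q b) (r (PQ b)) = 0" if "b \<in> T" for b
      using f[of "PQ b"] that by (auto simp: T_def factors_at_def PQ_def)
    have TB: "b \<in> topspace B" if "b \<in> T" for b using that by (simp add: T_def)
    have "continuous_map (subtopology B T) (subtopology E (W r)) (\<lambda>b. j b (r (PQ b)))"
      using cont_j[OF T_open comp[OF r(1)] rootr] pj[OF TB rootr]
      by (auto simp: continuous_map_in_subtopology W_def)
    moreover have "continuous_map (subtopology E (W r)) (subtopology B T) p"
      using p by (auto simp: continuous_map_in_subtopology W_def intro: continuous_map_from_subtopology)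
    moreover have "j (p e) (r (PQ (p e))) = e" if "e \<in> W r" for e
      using that j[of e] by (auto simp: W_def)
    moreover have "p (j b (r (PQ b))) = b" if "b \<in> T" for b
      using that pj[OF TB rootr] by auto
    ultimately have "homeomorphic_maps (subtopology E (W r)) (subtopology B T) p (\<lambda>b. j b (r (PQ b)))"
      by (simp add: homeomorphic_maps_def)
    then show "homeomorphic_map (subtopology E (W r)) (subtopology B T) p"
      using homeomorphic_map_maps by blast
  qed
  have Wx: "openin E (W x) \<and> homeomorphic_map (subtopology E (W x)) (subtopology B T) p"
    by (rule good[OF T\<^sub>0(3-6)])
  have Wy: "openin E (W y) \<and> homeomorphic_map (subtopology E (W y)) (subtopology B T) p"
    by (rule good[OF T\<^sub>0(4,3,5) factors_at_permute(1)[OF T\<^sub>0(6)]])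
  have Wz: "openin E (W z) \<and> homeomorphic_map (subtopology E (W z)) (subtopology B T) p"
    by (rule good[OF T\<^sub>0(5,3,4) factors_at_permute(2)[OF T\<^sub>0(6)]])
  have "\<Union>{W x, W y, W z} = {e \<in> topspace E. p e \<in> T}"
    using root T\<^sub>0(6) by (fastforce simp: W_def T_def factors_at_def PQ_def)
  moreover have "disjnt (W x) (W y)" "disjnt (W x) (W z)" "disjnt (W y) (W z)"
    using T\<^sub>0(6) by (auto simp: disjnt_iff W_def T_def factors_at_def)
  then have "pairwise disjnt {W x, W y, W z}"
    by (auto simp: pairwise_insert intro: disjnt_sym)
  moreover have "b \<in> T" using b T\<^sub>0(2) by (simp add: T_def)
  ultimately show "\<exists>T. b \<in> T \<and> openin B T \<and>
     (\<exists>\<V>. \<Union>\<V> = {x \<in> topspace E. p x \<in> T} \<and> (\<forall>W\<in>\<V>. openin E W) \<and> pairwise disjnt \<V> \<and>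
        (\<forall>W\<in>\<V>. homeomorphic_map (subtopology E W) (subtopology B T) p))"
    using T_open Wx Wy Wz by (intro exI[of _ T] exI[of _ "{W x, W y, W z}"] conjI) auto
qed

section \<open>The covering by roots over the complement of the discriminant curve\<close>

definition root_base :: "(complex \<times> complex) set" where
  "root_base = {c. discr (fst c) (snd c) \<noteq> 0}"

definition root_cover :: "((complex \<times> complex) \<times> complex) set" where
  "root_cover = {(c, t). c \<in> root_base \<and> dcubic (fst c) (snd c) t = 0}"

text \<open>The passage to the library predicate \<open>covering_space\<close> makes path lifting,
  uniqueness of lifts and the lifting criterion available; all continuation of roots takes place in
  this one covering.\<close>

lemma covering_space_roots: "covering_space root_cover fst root_base"
proof -
  have "covering_map (top_of_set root_cover) (top_of_set root_base) fst"
  proof (rule covering_map_dcubic[where t = snd and P = fst and Q = snd and j = Pair])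
    fix T r assume r: "continuous_map (subtopology (top_of_set root_base) T) euclidean r"
      "\<And>b. b \<in> T \<Longrightarrow> dcubic (fst b) (snd b) (r b) = 0" "openin (top_of_set root_base) T"
    have T: "T \<subseteq> root_base" using r(3) by (rule openin_imp_subset)
    then have "continuous_on T r" using r(1) by (simp add: subtopology_subtopology Int_absorb1)
    then have "continuous_on T (\<lambda>b. (b, r b))" by (intro continuous_intros)
    with T r(2) show "continuous_map (subtopology (top_of_set root_base) T) (top_of_set root_cover) (\<lambda>b. (b, r b))"
      by (auto simp: subtopology_subtopology Int_absorb1 continuous_map_subtopology_eu root_cover_def)
  qed (auto simp: root_base_def root_cover_def continuous_map_subtopology_eu intro!: continuous_intros)
  note cov = this[unfolded covering_map_def topspace_euclidean_subtopology]
  have "\<exists>T. c \<in> T \<and> openin (top_of_set root_base) T \<and>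
      (\<exists>v. \<Union>v = root_cover \<inter> fst -` T \<and> (\<forall>u\<in>v. openin (top_of_set root_cover) u) \<and>
         pairwise disjnt v \<and> (\<forall>u\<in>v. \<exists>q. homeomorphism u T fst q))" if "c \<in> root_base" for c
  proof -
    from cov[THEN conjunct2, THEN conjunct2, rule_format, OF that]
    obtain T v where T: "c \<in> T" "openin (top_of_set root_base) T" "\<Union>v = {x \<in> root_cover. fst x \<in> T}"
      "\<forall>W\<in>v. openin (top_of_set root_cover) W" "pairwise disjnt v"
      "\<forall>W\<in>v. homeomorphic_map (subtopology (top_of_set root_cover) W) (subtopology (top_of_set root_base) T) fst"
      by (elim exE conjE)
    have "\<exists>q. homeomorphism W T fst q" if W: "W \<in> v" for W
    proof -
      have sub: "W \<subseteq> root_cover" "T \<subseteq> root_base" using T(2,4) W openin_imp_subset by blast+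
      obtain q where "homeomorphic_maps (top_of_set W) (top_of_set T) fst q"
        using T(6) W sub by (auto simp: subtopology_subtopology Int_absorb1 homeomorphic_map_maps)
      then have hom: "homeomorphism W T fst q"
        by (intro homeomorphismI)
           (simp_all add: homeomorphic_maps_def continuous_map_subtopology_eu image_subset_iff_funcset)
      show ?thesis by (rule exI[of _ q], rule hom)
    qed
    moreover have "\<Union>v = root_cover \<inter> fst -` T" using T(3) by auto
    ultimately show ?thesis using T(1,2,4,5) by blast
  qed
  moreover have "continuous_on root_cover fst" by (intro continuous_intros)
  moreover have "fst ` root_cover = root_base" using cov by simp
  ultimately show ?thesis unfolding covering_space_def by blast
qed

definition root_path :: "(real \<Rightarrow> complex \<times> complex) \<Rightarrow> (real \<Rightarrow> complex) \<Rightarrow> bool" where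
  "root_path g h \<longleftrightarrow> path h \<and> (\<forall>s\<in>{0..1}. dcubic (fst (g s)) (snd (g s)) (h s) = 0)"

lemma root_path_exists:
  assumes "path g" "path_image g \<subseteq> root_base" "dcubic (fst (g 0)) (snd (g 0)) t = 0"
  obtains h where "root_path g h" "h 0 = t"
proof -
  have "(g 0, t) \<in> root_cover"
    using assms by (auto simp: root_cover_def path_image_def)
  moreover have "pathstart g = fst (g 0, t)" by (simp add: pathstart_def)
  ultimately obtain k where k: "path k" "path_image k \<subseteq> root_cover" "pathstart k = (g 0, t)"
     "\<And>s. s \<in> {0..1} \<Longrightarrow> fst (k s) = g s"
    using covering_space_lift_path_strong[OF covering_space_roots _ assms(1,2)] by metis
  have "path (\<lambda>s. snd (k s))" using k(1) unfolding path_def by (intro continuous_intros)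
  moreover have "dcubic (fst (g s)) (snd (g s)) (snd (k s)) = 0" if "s \<in> {0..1}" for s
  proof -
    have "k s \<in> root_cover" using k(2) that by (auto simp: path_image_def)
    then show ?thesis using k(4)[OF that] by (auto simp: root_cover_def)
  qed
  ultimately have "root_path g (\<lambda>s. snd (k s))" by (simp add: root_path_def)
  moreover have "snd (k 0) = t" using k(3) by (simp add: pathstart_def)
  ultimately show thesis by (rule that)
qed

lemma root_path_unique:
  assumes "path g" "path_image g \<subseteq> root_base" "root_path g h" "root_path g k"
    and "s \<in> {0..1}" "h s = k s" "s' \<in> {0..1}"
  shows "h s' = k s'"
proof -
  have "(g s', h s') = (g s', k s')"
  proof (rule covering_space_lift_unique[OF covering_space_roots, where f = g and T = "{0..1}" and a = s])
    show "continuous_on {0..1} (\<lambda>s. (g s, h s))" "continuous_on {0..1} (\<lambda>s. (g s, k s))" "continuous_on {0..1} g"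
      using assms(1,3,4) by (auto simp: root_path_def path_def intro!: continuous_intros)
  qed (use assms in \<open>auto simp: root_path_def root_cover_def path_image_def\<close>)
  then show ?thesis by simp
qed

section \<open>Monodromy of a depressed cubic\<close>

definition root_set :: "complex \<times> complex \<Rightarrow> complex set" where
  "root_set c = {t. dcubic (fst c) (snd c) t = 0}"

lemma root_set_eq:
  assumes "c \<in> root_base"
  obtains x y z where "root_set c = {x, y, z}" "x \<noteq> y" "x \<noteq> z" "y \<noteq> z"
    "discr (fst c) (snd c) = ((x - y) * (y - z) * (z - x)) ^ 2"
proof -
  obtain x y z where *: "\<And>t. dcubic (fst c) (snd c) t = (t - x) * (t - y) * (t - z)"
    "discr (fst c) (snd c) = ((x - y) * (y - z) * (z - x)) ^ 2"
    using dcubic_splits by blast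
  show thesis
    by (rule that[of x y z]) (use assms * in \<open>auto simp: root_set_def root_base_def\<close>)
qed

lemma finite_root_set: "c \<in> root_base \<Longrightarrow> finite (root_set c)"
  by (erule root_set_eq) simp

text \<open>Monodromy along \<open>g\<close>, acting on roots. Root paths over a path in
  \<open>root_base\<close> are unique, so asking for some root path with the given ends fixes
  \<open>\<sigma>\<close> on the roots.\<close>

definition induces :: "(real \<Rightarrow> complex \<times> complex) \<Rightarrow> (complex \<Rightarrow> complex) \<Rightarrow> bool" where
  "induces g \<sigma> \<longleftrightarrow> (\<forall>t\<in>root_set (g 0). \<exists>h. root_path g h \<and> h 0 = t \<and> h 1 = \<sigma> t)"

lemma induces_exists:
  assumes g: "path g" "path_image g \<subseteq> root_base" "g 1 = g 0"
  obtains \<sigma> where "\<sigma> permutes root_set (g 0)" "induces g \<sigma>"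
proof -
  have "\<exists>h. root_path g h \<and> h 0 = t" if "t \<in> root_set (g 0)" for t
  proof -
    have "dcubic (fst (g 0)) (snd (g 0)) t = 0" using that by (simp add: root_set_def)
    from root_path_exists[OF g(1,2) this] show ?thesis by blast
  qed
  then have "\<exists>H. \<forall>t\<in>root_set (g 0). root_path g (H t) \<and> H t 0 = t"
    by (intro bchoice) blast
  then obtain H where H: "\<And>t. t \<in> root_set (g 0) \<Longrightarrow> root_path g (H t) \<and> H t 0 = t"
    by blast
  define \<sigma> where "\<sigma> t = (if t \<in> root_set (g 0) then H t 1 else t)" for t
  have g0: "g 0 \<in> root_base" using g(2) by (auto simp: path_image_def)
  have fin: "finite (root_set (g 0))" using g0 by (rule finite_root_set)
  have "H t 1 \<in> root_set (g 0)" if "t \<in> root_set (g 0)" for t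
  proof -
    have "dcubic (fst (g 1)) (snd (g 1)) (H t 1) = 0" using H[OF that] by (simp add: root_path_def)
    then show ?thesis unfolding g(3) by (simp add: root_set_def)
  qed
  then have maps: "\<sigma> ` root_set (g 0) \<subseteq> root_set (g 0)" by (auto simp: \<sigma>_def)
  have inj: "inj_on \<sigma> (root_set (g 0))"
  proof (rule inj_onI)
    fix t u assume tu: "t \<in> root_set (g 0)" "u \<in> root_set (g 0)" "\<sigma> t = \<sigma> u"
    \<comment> \<open>Uniqueness of lifts, used from time \<open>1\<close> backwards: root paths
      with a common end have a common start.\<close>
    have "H t 0 = H u 0"
      by (rule root_path_unique[OF g(1,2), of _ _ 1]) (use H tu in \<open>auto simp: \<sigma>_def\<close>)
    then show "t = u" using H tu by auto
  qed
  have "bij_betw \<sigma> (root_set (g 0)) (root_set (g 0))"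
    using endo_inj_surj[OF fin maps inj] inj by (simp add: bij_betw_def)
  then have "\<sigma> permutes root_set (g 0)" by (rule bij_imp_permutes) (simp add: \<sigma>_def)
  moreover have "induces g \<sigma>" unfolding induces_def using H by (auto simp: \<sigma>_def)
  ultimately show thesis by (rule that)
qed

lemma root_path_join:
  assumes "root_path g h" "root_path g' h'" "h 1 = h' 0"
  shows "root_path (g +++ g') (h +++ h')"
  unfolding root_path_def
proof
  show "path (h +++ h')"
    using assms by (intro path_join_imp) (auto simp: root_path_def pathstart_def pathfinish_def)
  show "\<forall>s\<in>{0..1}. dcubic (fst ((g +++ g') s)) (snd ((g +++ g') s)) ((h +++ h') s) = 0"
    using assms by (auto simp: root_path_def joinpaths_def)
qed

lemma induces_join:
  assumes "induces g \<sigma>" "induces g' \<sigma>'" "g' 0 = g 0" "\<sigma> permutes root_set (g 0)"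
  shows "induces (g +++ g') (\<sigma>' \<circ> \<sigma>)"
  unfolding induces_def
proof
  fix t assume "t \<in> root_set ((g +++ g') 0)"
  then have t: "t \<in> root_set (g 0)" by (simp add: joinpaths_def)
  then obtain h where h: "root_path g h" "h 0 = t" "h 1 = \<sigma> t" using assms(1) by (auto simp: induces_def)
  have "\<sigma> t \<in> root_set (g' 0)" using t assms(3,4) by (simp add: permutes_in_image)
  then obtain h' where h': "root_path g' h'" "h' 0 = \<sigma> t" "h' 1 = \<sigma>' (\<sigma> t)"
    using assms(2) by (auto simp: induces_def)
  have "root_path (g +++ g') (h +++ h')" using h h' by (intro root_path_join) auto
  moreover have "(h +++ h') 0 = t" "(h +++ h') 1 = (\<sigma>' \<circ> \<sigma>) t" using h h' by (simp_all add: joinpaths_def)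
  ultimately show "\<exists>h. root_path (g +++ g') h \<and> h 0 = t \<and> h 1 = (\<sigma>' \<circ> \<sigma>) t" by blast
qed

text \<open>A square root of the discriminant in terms of the roots. It changes sign under odd
  permutations only, so for distinct roots its value after a permutation detects the parity.\<close>

definition vandermonde :: "complex \<Rightarrow> complex \<Rightarrow> complex \<Rightarrow> complex" where
  "vandermonde x y z = (x - y) * (y - z) * (z - x)"

lemma permutes_three_cases:
  assumes "\<sigma> permutes {a, b, c}" "a \<noteq> b" "a \<noteq> c" "b \<noteq> c"
  shows "(\<sigma> a, \<sigma> b, \<sigma> c) \<in> {(a,b,c), (a,c,b), (b,a,c), (b,c,a), (c,a,b), (c,b,a)}"
proof -
  have "\<sigma> a \<in> {a,b,c}" "\<sigma> b \<in> {a,b,c}" "\<sigma> c \<in> {a,b,c}"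
    using permutes_in_image[OF assms(1)] by blast+
  moreover have "\<sigma> a \<noteq> \<sigma> b" "\<sigma> a \<noteq> \<sigma> c" "\<sigma> b \<noteq> \<sigma> c"
    using permutes_inj[OF assms(1)] assms(2-4) by (auto dest: injD)
  ultimately show ?thesis by (elim insertE emptyE) simp_all
qed

text \<open>A proper subgroup of the symmetric group on three letters consists of even permutations
  or fixes a letter, and the last two assumptions exclude these two cases.\<close>

lemma symmetric_group_three:
  assumes abc: "a \<noteq> b" "a \<noteq> c" "b \<noteq> c"
    and M: "\<And>\<sigma>. \<sigma> \<in> M \<Longrightarrow> \<sigma> permutes {a, b, c}"
    and comp: "\<And>\<sigma> \<tau>. \<sigma> \<in> M \<Longrightarrow> \<tau> \<in> M \<Longrightarrow> \<tau> \<circ> \<sigma> \<in> M"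
    and moved: "\<And>x. x \<in> {a, b, c} \<Longrightarrow> \<exists>\<sigma>\<in>M. \<sigma> x \<noteq> x"
    and odd: "\<exists>\<sigma>\<in>M. vandermonde (\<sigma> a) (\<sigma> b) (\<sigma> c) \<noteq> vandermonde a b c"
  shows "M = {\<sigma>. \<sigma> permutes {a, b, c}}"
proof -
  \<comment> \<open>\<open>m x y z\<close> says that the permutation with these values at
    \<open>a\<close>, \<open>b\<close>, \<open>c\<close> belongs to \<open>M\<close>. This turns the
    statement into propositional logic with six atoms.\<close>
  define m where "m x y z \<longleftrightarrow> (\<exists>\<sigma>\<in>M. \<sigma> a = x \<and> \<sigma> b = y \<and> \<sigma> c = z)" for x y z
  have mcomp: "m (\<tau> x) (\<tau> y) (\<tau> z)" if "m x y z" "\<tau> \<in> M" for x y z \<tau>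
  proof -
    obtain \<sigma> where \<sigma>: "\<sigma> \<in> M" "\<sigma> a = x" "\<sigma> b = y" "\<sigma> c = z" using \<open>m x y z\<close> unfolding m_def by blast
    have "\<tau> \<circ> \<sigma> \<in> M" by (rule comp[OF \<sigma>(1) that(2)])
    then show ?thesis unfolding m_def by (rule bexI[rotated]) (use \<sigma> in simp)
  qed
  have mm: "\<exists>\<tau>. \<tau> a = u \<and> \<tau> b = v \<and> \<tau> c = w \<and> m (\<tau> x) (\<tau> y) (\<tau> z)"
    if "m u v w" "m x y z" for u v w x y z
  proof -
    obtain \<tau> where \<tau>: "\<tau> \<in> M" "\<tau> a = u" "\<tau> b = v" "\<tau> c = w" using \<open>m u v w\<close> unfolding m_def by blast
    then show ?thesis using mcomp[OF that(2) \<tau>(1)] by blast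
  qed
  have cases: "(\<sigma> a, \<sigma> b, \<sigma> c) \<in> {(a,b,c), (a,c,b), (b,a,c), (b,c,a), (c,a,b), (c,b,a)}" if "\<sigma> \<in> M" for \<sigma>
    by (rule permutes_three_cases[OF M[OF that] abc])
  have o: "m a c b \<or> m b a c \<or> m c b a"
  proof -
    obtain \<sigma> where \<sigma>: "\<sigma> \<in> M" "vandermonde (\<sigma> a) (\<sigma> b) (\<sigma> c) \<noteq> vandermonde a b c" using odd by blast
    with cases[OF \<sigma>(1)] show ?thesis
      unfolding m_def by (auto simp: vandermonde_def mult_ac)
  qed
  have mv: "m b a c \<or> m b c a \<or> m c a b \<or> m c b a"
    "m a c b \<or> m b a c \<or> m b c a \<or> m c a b" "m a c b \<or> m b c a \<or> m c a b \<or> m c b a"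
  proof -
    obtain \<sigma> where \<sigma>: "\<sigma> \<in> M" "\<sigma> a \<noteq> a" using moved by blast
    with cases[OF \<sigma>(1)] show "m b a c \<or> m b c a \<or> m c a b \<or> m c b a" unfolding m_def by auto
    obtain \<sigma> where \<sigma>: "\<sigma> \<in> M" "\<sigma> b \<noteq> b" using moved by blast
    with cases[OF \<sigma>(1)] show "m a c b \<or> m b a c \<or> m b c a \<or> m c a b" unfolding m_def by auto
    obtain \<sigma> where \<sigma>: "\<sigma> \<in> M" "\<sigma> c \<noteq> c" using moved by blast
    with cases[OF \<sigma>(1)] show "m a c b \<or> m b c a \<or> m c a b \<or> m c b a" unfolding m_def by auto
  qed
  \<comment> \<open>The part of the multiplication table with a transposition as the outer factor;
    combined with \<open>o\<close> and \<open>mv\<close> it yields all six elements.\<close>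
  have prods:
    "m a c b \<Longrightarrow> m a c b \<Longrightarrow> m a b c" "m a c b \<Longrightarrow> m b a c \<Longrightarrow> m c a b" "m a c b \<Longrightarrow> m b c a \<Longrightarrow> m c b a"
    "m a c b \<Longrightarrow> m c a b \<Longrightarrow> m b a c" "m a c b \<Longrightarrow> m c b a \<Longrightarrow> m b c a"
    "m b a c \<Longrightarrow> m a c b \<Longrightarrow> m b c a" "m b a c \<Longrightarrow> m b a c \<Longrightarrow> m a b c" "m b a c \<Longrightarrow> m b c a \<Longrightarrow> m a c b"
    "m b a c \<Longrightarrow> m c a b \<Longrightarrow> m c b a" "m b a c \<Longrightarrow> m c b a \<Longrightarrow> m c a b"
    "m c b a \<Longrightarrow> m a c b \<Longrightarrow> m c a b" "m c b a \<Longrightarrow> m b a c \<Longrightarrow> m b c a" "m c b a \<Longrightarrow> m b c a \<Longrightarrow> m b a c"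
    "m c b a \<Longrightarrow> m c a b \<Longrightarrow> m a c b"
    by (drule (1) mm; auto)+
  have all: "m a b c \<and> m a c b \<and> m b a c \<and> m b c a \<and> m c a b \<and> m c b a"
    using o mv prods by argo
  have "\<sigma> \<in> M" if \<sigma>: "\<sigma> permutes {a, b, c}" for \<sigma>
  proof -
    have "m (\<sigma> a) (\<sigma> b) (\<sigma> c)" using permutes_three_cases[OF \<sigma> abc] all by auto
    then obtain \<tau> where \<tau>: "\<tau> \<in> M" "\<tau> a = \<sigma> a" "\<tau> b = \<sigma> b" "\<tau> c = \<sigma> c" unfolding m_def by blast
    have "\<tau> x = \<sigma> x" for x
      using \<tau> permutes_not_in[OF \<sigma>, of x] permutes_not_in[OF M[OF \<tau>(1)], of x] by (cases "x \<in> {a, b, c}") auto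
    then have "\<tau> = \<sigma>" ..
    with \<tau> show ?thesis by simp
  qed
  with M show ?thesis by blast
qed

section \<open>Single-valued branches on a punctured line\<close>

lemma punctured_plane:
  assumes "finite (K :: complex set)"
  shows "path_connected (- K)" "locally path_connected (- K)" "open (- K)" "infinite (- K)"
proof -
  show "open (- K)" using assms by (simp add: finite_imp_closed open_Compl)
  then show "locally path_connected (- K)" by (rule open_imp_locally_path_connected)
  show "path_connected (- K)"
    using assms by (intro path_connected_complement_countable) (auto simp: countable_finite)
  show "infinite (- K)"
  proof
    assume "finite (- K)"
    with assms have "finite (K \<union> - K)" by simp
    then show False using infinite_UNIV_char_0[where 'a = complex] by (simp add: Compl_partition)
  qed
qed

text \<open>The lifting criterion for maps into the base of a covering asks that the image of every
  loop be homotopic to the projection of a closed path. By the assumption \<open>closed\<close> the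
  lift of the loop through \<open>t\<^sub>0\<close> is itself closed, so the trivial homotopy
  suffices.\<close>

lemma global_root:
  fixes K :: "complex set"
  assumes K: "finite K" "z\<^sub>0 \<notin> K" and f: "continuous_on (- K) f" "f ` (- K) \<subseteq> root_base"
    and t\<^sub>0: "t\<^sub>0 \<in> root_set (f z\<^sub>0)"
    and closed: "\<And>r h. \<lbrakk>path r; path_image r \<subseteq> - K; r 0 = z\<^sub>0; r 1 = z\<^sub>0; root_path (f \<circ> r) h; h 0 = t\<^sub>0\<rbrakk> \<Longrightarrow> h 1 = t\<^sub>0"
  obtains g where "continuous_on (- K) g" "\<And>z. z \<notin> K \<Longrightarrow> g z \<in> root_set (f z)" "g z\<^sub>0 = t\<^sub>0"
proof -
  have hom: "\<exists>q. path q \<and> path_image q \<subseteq> root_cover \<and> pathstart q = (f z\<^sub>0, t\<^sub>0) \<and> pathfinish q = (f z\<^sub>0, t\<^sub>0) \<and>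
      homotopic_paths root_base (f \<circ> r) (fst \<circ> q)"
    if r: "path r" "path_image r \<subseteq> - K" "pathstart r = z\<^sub>0" "pathfinish r = z\<^sub>0" for r
  proof -
    have fr: "path (f \<circ> r)" "path_image (f \<circ> r) \<subseteq> root_base"
      using r f by (auto simp: path_image_compose intro!: path_continuous_image continuous_on_subset[OF f(1)])
    have r01: "r 0 = z\<^sub>0" "r 1 = z\<^sub>0" using r by (auto simp: pathstart_def pathfinish_def)
    obtain h where h: "root_path (f \<circ> r) h" "h 0 = t\<^sub>0"
      by (rule root_path_exists[OF fr, of t\<^sub>0]) (use t\<^sub>0 r01 in \<open>auto simp: root_set_def\<close>)
    have h1: "h 1 = t\<^sub>0" by (rule closed[OF r(1,2) r01 h])
    let ?q = "\<lambda>s. ((f \<circ> r) s, h s)"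
    have "path ?q" using fr(1) h(1) unfolding root_path_def path_def by (auto intro!: continuous_intros)
    moreover have "path_image ?q \<subseteq> root_cover"
      using fr(2) h(1) by (auto simp: path_image_def root_path_def root_cover_def)
    moreover have "homotopic_paths root_base (f \<circ> r) (fst \<circ> ?q)"
      using fr by (simp add: o_def homotopic_paths_refl)
    ultimately show ?thesis
      using h h1 r01 by (intro exI[of _ ?q]) (auto simp: pathstart_def pathfinish_def)
  qed
  have "(f z\<^sub>0, t\<^sub>0) \<in> root_cover" using t\<^sub>0 K(2) f(2) by (auto simp: root_cover_def root_set_def)
  moreover have "z\<^sub>0 \<in> - K" using K(2) by simp
  moreover have "f \<in> - K \<rightarrow> root_base" using f(2) by blast
  moreover have "f z\<^sub>0 = fst (f z\<^sub>0, t\<^sub>0)" by simp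
  ultimately obtain g where g: "continuous_on (- K) g" "g \<in> - K \<rightarrow> root_cover" "g z\<^sub>0 = (f z\<^sub>0, t\<^sub>0)"
     "\<And>y. y \<in> - K \<Longrightarrow> fst (g y) = f y"
    using covering_space_lift_general[OF covering_space_roots _ _ punctured_plane(1,2)[OF K(1)] f(1) _ _ hom]
    by blast
  show thesis
  proof
    show "continuous_on (- K) (\<lambda>z. snd (g z))" using g(1) by (intro continuous_intros)
    show "snd (g z) \<in> root_set (f z)" if "z \<notin> K" for z
    proof -
      have "g z \<in> root_cover" using g(2) that by auto
      then show ?thesis using g(4)[of z] that by (auto simp: root_cover_def root_set_def)
    qed
  qed (simp add: g)
qed

text \<open>The lifting criterion for the squaring map of the punctured plane. Along a loop, the
  Vandermonde product of the three transported roots is a continuous square root of the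
  discriminant, and it returns to its initial value because the induced permutation preserves
  it.\<close>

lemma global_sqrt_discr:
  fixes K :: "complex set"
  assumes K: "finite K" "z\<^sub>0 \<notin> K" and f: "continuous_on (- K) f" "f ` (- K) \<subseteq> root_base"
    and xyz: "root_set (f z\<^sub>0) = {x, y, z}" "x \<noteq> y" "x \<noteq> z" "y \<noteq> z"
    and even: "\<And>r \<sigma>. \<lbrakk>path r; path_image r \<subseteq> - K; r 0 = z\<^sub>0; r 1 = z\<^sub>0; induces (f \<circ> r) \<sigma>; \<sigma> permutes {x, y, z}\<rbrakk> \<Longrightarrow>
       vandermonde (\<sigma> x) (\<sigma> y) (\<sigma> z) = vandermonde x y z"
  obtains s where "continuous_on (- K) s" "\<And>w. w \<notin> K \<Longrightarrow> s w ^ 2 = discr (fst (f w)) (snd (f w))"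
    "s z\<^sub>0 = vandermonde x y z"
proof -
  define D where "D w = discr (fst (f w)) (snd (f w))" for w
  have D: "continuous_on (- K) D" "D \<in> - K \<rightarrow> - {0}"
    using f unfolding D_def discr_def
    by (auto simp: root_base_def image_subset_iff discr_def intro!: continuous_intros)
  have vand: "vandermonde u v w ^ 2 = discr (fst c) (snd c)"
    if h: "root_set c = {u, v, w}" "c \<in> root_base" "u \<noteq> v" "u \<noteq> w" "v \<noteq> w" for u v w c
  proof -
    obtain u' v' w' where *: "root_set c = {u', v', w'}" "u' \<noteq> v'" "u' \<noteq> w'" "v' \<noteq> w'"
      "discr (fst c) (snd c) = ((u' - v') * (v' - w') * (w' - u')) ^ 2"
      by (rule root_set_eq[OF h(2)])
    have "u' \<in> {u, v, w}" "v' \<in> {u, v, w}" "w' \<in> {u, v, w}"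
      unfolding h(1)[symmetric] *(1) by simp_all
    then have "(u', v', w') \<in> {(u,v,w), (u,w,v), (v,u,w), (v,w,u), (w,u,v), (w,v,u)}"
      using *(2-4) by (elim insertE emptyE) simp_all
    moreover have "vandermonde u w v = - vandermonde u v w" "vandermonde v u w = - vandermonde u v w"
      "vandermonde v w u = vandermonde u v w" "vandermonde w u v = vandermonde u v w"
      "vandermonde w v u = - vandermonde u v w"
      by (simp_all add: vandermonde_def algebra_simps)
    ultimately show ?thesis unfolding *(5) vandermonde_def[symmetric] by auto
  qed
  have z0: "f z\<^sub>0 \<in> root_base" using f(2) K(2) by auto
  have hom: "\<exists>q. path q \<and> path_image q \<subseteq> - {0} \<and> pathstart q = vandermonde x y z \<and> pathfinish q = vandermonde x y z \<and>
      homotopic_paths (- {0}) (D \<circ> r) ((\<lambda>z. z ^ 2) \<circ> q)"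
    if r: "path r" "path_image r \<subseteq> - K" "pathstart r = z\<^sub>0" "pathfinish r = z\<^sub>0" for r
  proof -
    have fr: "path (f \<circ> r)" "path_image (f \<circ> r) \<subseteq> root_base"
      using r f by (auto simp: path_image_compose intro!: path_continuous_image continuous_on_subset[OF f(1)])
    have r01: "r 0 = z\<^sub>0" "r 1 = z\<^sub>0" using r by (auto simp: pathstart_def pathfinish_def)
    obtain \<sigma> where \<sigma>: "\<sigma> permutes {x, y, z}" "induces (f \<circ> r) \<sigma>"
      using induces_exists[OF fr] r01 xyz(1) by auto
    have ev: "vandermonde (\<sigma> x) (\<sigma> y) (\<sigma> z) = vandermonde x y z"
      by (rule even[OF r(1,2) r01 \<sigma>(2,1)])
    have rs: "root_set ((f \<circ> r) 0) = {x, y, z}" using r01 xyz(1) by simp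
    obtain h\<^sub>1 h\<^sub>2 h\<^sub>3 where h: "root_path (f \<circ> r) h\<^sub>1" "h\<^sub>1 0 = x" "h\<^sub>1 1 = \<sigma> x"
      "root_path (f \<circ> r) h\<^sub>2" "h\<^sub>2 0 = y" "h\<^sub>2 1 = \<sigma> y" "root_path (f \<circ> r) h\<^sub>3" "h\<^sub>3 0 = z" "h\<^sub>3 1 = \<sigma> z"
      using \<sigma>(2) unfolding induces_def rs by auto
    let ?q = "\<lambda>s. vandermonde (h\<^sub>1 s) (h\<^sub>2 s) (h\<^sub>3 s)"
    have sq: "?q s ^ 2 = D (r s)" if s: "s \<in> {0..1}" for s
    proof -
      have ne: "h\<^sub>1 s \<noteq> h\<^sub>2 s" "h\<^sub>1 s \<noteq> h\<^sub>3 s" "h\<^sub>2 s \<noteq> h\<^sub>3 s"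
        using root_path_unique[OF fr h(1,4) s, of 0] root_path_unique[OF fr h(1,7) s, of 0]
          root_path_unique[OF fr h(4,7) s, of 0] h(2,5,8) xyz(2-4) by auto
      have b: "f (r s) \<in> root_base" using fr(2) s by (auto simp: path_image_def)
      have sub: "{h\<^sub>1 s, h\<^sub>2 s, h\<^sub>3 s} \<subseteq> root_set (f (r s))"
        using h s by (auto simp: root_path_def root_set_def)
      obtain u v w where "root_set (f (r s)) = {u, v, w}" by (rule root_set_eq[OF b])
      with ne sub have "root_set (f (r s)) = {h\<^sub>1 s, h\<^sub>2 s, h\<^sub>3 s}" by auto
      then show ?thesis unfolding D_def by (rule vand) (use b ne in auto)
    qed
    have Dr: "path_image (D \<circ> r) \<subseteq> - {0}" using D(2) r(2) by (auto simp: path_image_def Pi_iff image_subset_iff)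
    have pDr: "path (D \<circ> r)" using r(1,2) D(1) by (intro path_continuous_image) (auto intro: continuous_on_subset)
    have "path ?q" using h unfolding root_path_def path_def vandermonde_def by (auto intro!: continuous_intros)
    moreover have "path_image ?q \<subseteq> - {0}"
      using sq Dr by (force simp: path_image_def)
    moreover have "homotopic_paths (- {0}) (D \<circ> r) ((\<lambda>z. z ^ 2) \<circ> ?q)"
      using sq by (intro homotopic_paths_eq[OF pDr Dr]) auto
    ultimately show ?thesis
      using h ev by (intro exI[of _ ?q]) (auto simp: pathstart_def pathfinish_def)
  qed
  have "D z\<^sub>0 = vandermonde x y z ^ 2" unfolding D_def by (rule vand[OF xyz(1) z0 xyz(2-), symmetric])
  moreover have "vandermonde x y z \<in> - {0}" using xyz by (simp add: vandermonde_def)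
  moreover have "z\<^sub>0 \<in> - K" using K(2) by simp
  ultimately obtain s where "continuous_on (- K) s" "s z\<^sub>0 = vandermonde x y z" "\<And>w. w \<in> - K \<Longrightarrow> s w ^ 2 = D w"
    using covering_space_lift_general[OF covering_space_square_punctured_plane _ _ punctured_plane(1,2)[OF K(1)] D _ hom]
    by blast
  then show thesis by (intro that[of s]) (auto simp: D_def)
qed

section \<open>Algebraic functions of polynomial growth\<close>

text \<open>The growth bound makes \<open>h\<close> bounded near every point of \<open>K\<close>, so
  the singularities are removable, and the entire extension is a polynomial by the theorem of
  Liouville.\<close>

lemma polynomial_growth_off_finite:
  assumes K: "finite K" and hol: "h holomorphic_on - K"
    and bound: "\<And>z. z \<notin> K \<Longrightarrow> norm (h z) \<le> A * (1 + norm z) ^ n"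
  obtains c :: "nat \<Rightarrow> complex" where "\<And>z. z \<notin> K \<Longrightarrow> h z = (\<Sum>k\<le>n. c k * z ^ k)"
proof -
  define B where "B = max A 0"
  have B: "norm (h z) \<le> B * (1 + norm z) ^ n" if "z \<notin> K" for z
  proof -
    have "A * (1 + norm z) ^ n \<le> B * (1 + norm z) ^ n" by (intro mult_right_mono) (auto simp: B_def)
    with bound[OF that] show ?thesis by linarith
  qed
  have "h \<in> O[at z](\<lambda>_. 1)" for z
  proof (rule bigoI)
    have "eventually (\<lambda>w. w \<in> ball z 1 - (K - {z})) (at z)"
      using K by (intro eventually_at_in_open') (auto intro!: open_Diff finite_imp_closed)
    moreover have "eventually (\<lambda>w. w \<noteq> z) (at z)" by (simp add: eventually_at_filter)
    ultimately show "\<forall>\<^sub>F w in at z. norm (h w) \<le> (B * (2 + norm z) ^ n) * norm (1 :: complex)"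
    proof eventually_elim
      case (elim w)
      have "norm w \<le> norm z + norm (w - z)" by (metis norm_triangle_sub add.commute)
      also have "norm (w - z) < 1" using elim by (simp add: dist_norm norm_minus_commute)
      finally have "norm w \<le> norm z + 1" by simp
      then have "B * (1 + norm w) ^ n \<le> B * (2 + norm z) ^ n"
        by (intro mult_left_mono power_mono) (auto simp: B_def)
      moreover have "w \<notin> K" using elim by auto
      ultimately show ?case using B[of w] by simp
    qed
  qed
  then obtain g where g: "g holomorphic_on UNIV" "\<And>z. z \<notin> K \<Longrightarrow> g z = h z"
    using removable_singularities[OF K, of UNIV h] hol by (auto simp: Compl_eq_Diff_UNIV)
  obtain R where R: "\<And>z. z \<in> K \<Longrightarrow> norm z \<le> R"
    using finite_imp_bounded[OF K] by (auto simp: bounded_iff)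
  have "norm (g z) \<le> (B * 2 ^ n) * norm z ^ n" if "max 1 (R + 1) \<le> norm z" for z
  proof -
    have "z \<notin> K" using R[of z] that by auto
    then have "norm (g z) \<le> B * (1 + norm z) ^ n" using g B by simp
    also have "\<dots> \<le> B * (2 * norm z) ^ n"
      using that by (intro mult_left_mono power_mono) (auto simp: B_def)
    finally show ?thesis by (simp add: power_mult_distrib mult.assoc)
  qed
  then have "g z = (\<Sum>k\<le>n. (deriv ^^ k) g 0 / fact k * z ^ k)" for z
    by (rule Liouville_polynomial[OF g(1)])
  with g(2) show thesis by (intro that[of "\<lambda>k. (deriv ^^ k) g 0 / fact k"]) simp
qed

text \<open>Subtracting the cubic equations at \<open>w\<close> and \<open>z\<close> exhibits
  \<open>g w - g z\<close> as a quotient whose denominator \<open>E w\<close> tends to the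
  derivative \<open>3 * g z ^ 2 + P z\<close>. This is nonzero at a simple root, so continuity of
  \<open>g\<close> already gives the limit of the difference quotient.\<close>

lemma holomorphic_root:
  assumes S: "open S" and P: "P holomorphic_on S" and Q: "Q holomorphic_on S"
    and g: "continuous_on S g" and root: "\<And>z. z \<in> S \<Longrightarrow> dcubic (P z) (Q z) (g z) = 0"
    and nz: "\<And>z. z \<in> S \<Longrightarrow> discr (P z) (Q z) \<noteq> 0"
  shows "g holomorphic_on S"
proof -
  have "g field_differentiable at z" if z: "z \<in> S" for z
  proof -
    obtain P' Q' where D: "(P has_field_derivative P') (at z)" "(Q has_field_derivative Q') (at z)"
      using P Q S z by (meson field_differentiable_def holomorphic_on_imp_differentiable_at)
    define N where "N w = (P w - P z) / (w - z) * g z + (Q w - Q z) / (w - z)" for w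
    define E where "E w = g w ^ 2 + g w * g z + g z ^ 2 + P w" for w
    have gz: "(g \<longlongrightarrow> g z) (at z)"
      using g S z by (simp add: continuous_on_eq_continuous_at continuous_at)
    have Pz: "(P \<longlongrightarrow> P z) (at z)" using DERIV_isCont[OF D(1)] by (simp add: isCont_def)
    have "(E \<longlongrightarrow> g z ^ 2 + g z * g z + g z ^ 2 + P z) (at z)"
      unfolding E_def by (intro tendsto_intros gz Pz)
    then have E: "(E \<longlongrightarrow> 3 * g z ^ 2 + P z) (at z)" by (simp add: power2_eq_square algebra_simps)
    have E0: "3 * g z ^ 2 + P z \<noteq> 0" by (rule dcubic_simple_root[OF root[OF z] nz[OF z]])
    have "(N \<longlongrightarrow> P' * g z + Q') (at z)"
      unfolding N_def using D by (intro tendsto_intros) (auto simp: has_field_derivative_iff)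
    then have "((\<lambda>w. - N w / E w) \<longlongrightarrow> - (P' * g z + Q') / (3 * g z ^ 2 + P z)) (at z)"
      by (intro tendsto_intros E E0)
    moreover have "eventually (\<lambda>w. - N w / E w = (g w - g z) / (w - z)) (at z)"
    proof -
      have "eventually (\<lambda>w. E w \<noteq> 0) (at z)" using tendsto_imp_eventually_ne[OF E E0] .
      moreover have "eventually (\<lambda>w. w \<in> S) (at z)" using S z by (rule eventually_at_in_open')
      moreover have "eventually (\<lambda>w. w \<noteq> z) (at z)" by (simp add: eventually_at_filter)
      ultimately show ?thesis
      proof eventually_elim
        case (elim w)
        have "(g w - g z) * E w + ((P w - P z) * g z + (Q w - Q z)) =
            dcubic (P w) (Q w) (g w) - dcubic (P z) (Q z) (g z)"
          by (simp add: E_def dcubic_def power2_eq_square power3_eq_cube algebra_simps)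
        also have "\<dots> = 0" using root[OF elim(2)] root[OF z] by simp
        finally have "(g w - g z) * E w = - ((P w - P z) * g z + (Q w - Q z))"
          by (rule add_eq_0_iff2[THEN iffD1])
        moreover have d: "w - z \<noteq> 0" using elim(3) by simp
        have "(a / e * c + b / e) * e = a * c + b" if "e \<noteq> 0" for a b c e :: complex
          using that by (simp add: field_simps)
        then have "N w * (w - z) = (P w - P z) * g z + (Q w - Q z)"
          unfolding N_def using d by blast
        ultimately have "- N w * (w - z) = (g w - g z) * E w" by (metis minus_mult_left)
        then show ?case by (rule frac_eq_eq[OF elim(1) d, THEN iffD2])
      qed
    qed
    ultimately have "((\<lambda>w. (g w - g z) / (w - z)) \<longlongrightarrow> - (P' * g z + Q') / (3 * g z ^ 2 + P z)) (at z)"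
      by (rule Lim_transform_eventually)
    then show ?thesis unfolding field_differentiable_def has_field_derivative_iff by blast
  qed
  then show ?thesis using S by (simp add: holomorphic_on_open field_differentiable_def)
qed

text \<open>As for roots of cubics, with \<open>(s w - s z) * (s w + s z) = D w - D z\<close> and
  the limit \<open>s z + s z\<close> of the denominator.\<close>

lemma holomorphic_sqrt:
  assumes S: "open S" and D: "D holomorphic_on S" and s: "continuous_on S s"
    and sq: "\<And>z. z \<in> S \<Longrightarrow> s z ^ 2 = D z" and nz: "\<And>z. z \<in> S \<Longrightarrow> D z \<noteq> 0"
  shows "s holomorphic_on S"
proof -
  have "s field_differentiable at z" if z: "z \<in> S" for z
  proof -
    obtain D' where D: "(D has_field_derivative D') (at z)"
      using D S z by (meson field_differentiable_def holomorphic_on_imp_differentiable_at)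
    have sz: "(s \<longlongrightarrow> s z) (at z)"
      using s S z by (simp add: continuous_on_eq_continuous_at continuous_at)
    have E: "((\<lambda>w. s w + s z) \<longlongrightarrow> s z + s z) (at z)" by (intro tendsto_intros sz)
    have E0: "s z + s z \<noteq> 0" using sq[OF z] nz[OF z] by auto
    have "((\<lambda>w. (D w - D z) / (w - z) / (s w + s z)) \<longlongrightarrow> D' / (s z + s z)) (at z)"
      using D by (intro tendsto_divide E E0) (simp add: has_field_derivative_iff)
    moreover have "eventually (\<lambda>w. (D w - D z) / (w - z) / (s w + s z) = (s w - s z) / (w - z)) (at z)"
    proof -
      have "eventually (\<lambda>w. s w + s z \<noteq> 0) (at z)" using tendsto_imp_eventually_ne[OF E E0] .
      moreover have "eventually (\<lambda>w. w \<in> S) (at z)" using S z by (rule eventually_at_in_open')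
      moreover have "eventually (\<lambda>w. w \<noteq> z) (at z)" by (simp add: eventually_at_filter)
      ultimately show ?thesis
      proof eventually_elim
        case (elim w)
        have "D w - D z = (s w - s z) * (s w + s z)"
          unfolding sq[OF elim(2), symmetric] sq[OF z, symmetric] by (simp add: power2_eq_square algebra_simps)
        then show ?case using elim by simp
      qed
    qed
    ultimately have "((\<lambda>w. (s w - s z) / (w - z)) \<longlongrightarrow> D' / (s z + s z)) (at z)"
      by (rule Lim_transform_eventually)
    then show ?thesis unfolding field_differentiable_def has_field_derivative_iff by blast
  qed
  then show ?thesis using S by (simp add: holomorphic_on_open field_differentiable_def)
qed

text \<open>The coefficients of a cubic on a line along which the first derivative of \<open>p\<close> vanishes at \<open>0\<close>.\<close>

locale cubic_pencil =
  fixes p\<^sub>0 p\<^sub>2 q\<^sub>0 q\<^sub>1 q\<^sub>2 q\<^sub>3 :: complex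
begin

definition "P z = p\<^sub>0 + p\<^sub>2 * z ^ 2"

definition "Q z = q\<^sub>0 + q\<^sub>1 * z + q\<^sub>2 * z ^ 2 + q\<^sub>3 * z ^ 3"

definition "K = {z. discr (P z) (Q z) = 0}"

text \<open>The summand \<open>1\<close> gives \<open>M \<le> M ^ 2\<close> and
  \<open>M \<le> M ^ 3\<close>, so one constant serves both weights in the bounds of
  \<open>P\<close> and \<open>Q\<close>.\<close>

definition "M = 1 + norm p\<^sub>0 + norm p\<^sub>2 + norm q\<^sub>0 + norm q\<^sub>1 + norm q\<^sub>2 + norm q\<^sub>3"

lemma poly_P: "poly [:p\<^sub>0, 0, p\<^sub>2:] z = P z"
  by (simp add: P_def power2_eq_square)

lemma poly_Q: "poly [:q\<^sub>0, q\<^sub>1, q\<^sub>2, q\<^sub>3:] z = Q z"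
  by (simp add: Q_def power2_eq_square power3_eq_cube algebra_simps)

lemma finite_K:
  assumes "z \<notin> K"
  shows "finite K"
proof -
  define D where "D = smult (-4) ([:p\<^sub>0, 0, p\<^sub>2:] ^ 3) - smult 27 ([:q\<^sub>0, q\<^sub>1, q\<^sub>2, q\<^sub>3:] ^ 2)"
  have D: "poly D z = discr (P z) (Q z)" for z
    unfolding D_def discr_def poly_P[symmetric] poly_Q[symmetric] by simp
  then have "D \<noteq> 0" using assms by (auto simp: K_def)
  then show ?thesis using poly_roots_finite[of D] by (simp add: K_def D)
qed

lemma continuous_PQ: "continuous_on A (\<lambda>z. (P z, Q z))"
  unfolding P_def Q_def by (intro continuous_intros)

lemma holomorphic_P: "P holomorphic_on A" and holomorphic_Q: "Q holomorphic_on A"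
  unfolding P_def[abs_def] Q_def[abs_def] by (intro holomorphic_intros)+

lemma M_ge_1: "M \<ge> 1"
  by (simp add: M_def)

lemma norm_P_le: "norm (P z) \<le> (M * (1 + norm z)) ^ 2"
proof -
  define x where "x = 1 + norm z"
  have x: "1 \<le> x" "norm z \<le> x" by (simp_all add: x_def)
  have x2: "1 \<le> x ^ 2" using x by simp
  have z2: "norm z ^ 2 \<le> x ^ 2" using x by (intro power_mono) auto
  have "norm (P z) \<le> norm p\<^sub>0 * 1 + norm p\<^sub>2 * norm z ^ 2"
    unfolding P_def by (metis norm_triangle_ineq norm_mult norm_power mult_1_right)
  also have "\<dots> \<le> norm p\<^sub>0 * x ^ 2 + norm p\<^sub>2 * x ^ 2" using x2 z2 by (intro add_mono mult_left_mono) auto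
  also have "\<dots> = (norm p\<^sub>0 + norm p\<^sub>2) * x ^ 2" by (simp add: algebra_simps)
  also have "\<dots> \<le> M ^ 2 * x ^ 2"
  proof (intro mult_right_mono)
    have "norm p\<^sub>0 + norm p\<^sub>2 \<le> M" by (simp add: M_def)
    also have "M \<le> M ^ 2" using M_ge_1 by (simp add: self_le_power)
    finally show "norm p\<^sub>0 + norm p\<^sub>2 \<le> M ^ 2" .
  qed simp
  finally show ?thesis by (simp add: power_mult_distrib x_def)
qed

lemma norm_Q_le: "norm (Q z) \<le> (M * (1 + norm z)) ^ 3"
proof -
  define x where "x = 1 + norm z"
  have x: "1 \<le> x" "norm z \<le> x" by (simp_all add: x_def)
  have x3: "1 \<le> x ^ 3" using x by simp
  have z1: "norm z \<le> x ^ 3" using x self_le_power[of x 3] by linarith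
  have "norm z ^ 2 \<le> x ^ 2" using x by (intro power_mono) auto
  also have "x ^ 2 \<le> x ^ 3" using x by (intro power_increasing) auto
  finally have z2: "norm z ^ 2 \<le> x ^ 3" .
  have z3: "norm z ^ 3 \<le> x ^ 3" using x by (intro power_mono) auto
  have "norm (Q z) \<le> norm (q\<^sub>0 + q\<^sub>1 * z + q\<^sub>2 * z ^ 2) + norm (q\<^sub>3 * z ^ 3)"
    unfolding Q_def by (rule norm_triangle_ineq)
  also have "norm (q\<^sub>0 + q\<^sub>1 * z + q\<^sub>2 * z ^ 2) \<le> norm (q\<^sub>0 + q\<^sub>1 * z) + norm (q\<^sub>2 * z ^ 2)"
    by (rule norm_triangle_ineq)
  also have "norm (q\<^sub>0 + q\<^sub>1 * z) \<le> norm q\<^sub>0 + norm (q\<^sub>1 * z)" by (rule norm_triangle_ineq)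
  finally have "norm (Q z) \<le> norm q\<^sub>0 * 1 + norm q\<^sub>1 * norm z + norm q\<^sub>2 * norm z ^ 2 + norm q\<^sub>3 * norm z ^ 3"
    by (simp add: norm_mult norm_power)
  also have "\<dots> \<le> norm q\<^sub>0 * x ^ 3 + norm q\<^sub>1 * x ^ 3 + norm q\<^sub>2 * x ^ 3 + norm q\<^sub>3 * x ^ 3"
    using x3 z1 z2 z3 by (intro add_mono mult_left_mono) auto
  also have "\<dots> = (norm q\<^sub>0 + norm q\<^sub>1 + norm q\<^sub>2 + norm q\<^sub>3) * x ^ 3" by (simp add: algebra_simps)
  also have "\<dots> \<le> M ^ 3 * x ^ 3"
  proof (intro mult_right_mono)
    have "norm q\<^sub>0 + norm q\<^sub>1 + norm q\<^sub>2 + norm q\<^sub>3 \<le> M" by (simp add: M_def)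
    also have "M \<le> M ^ 3" using M_ge_1 by (simp add: self_le_power)
    finally show "norm q\<^sub>0 + norm q\<^sub>1 + norm q\<^sub>2 + norm q\<^sub>3 \<le> M ^ 3" .
  qed (use x in simp)
  finally show ?thesis by (simp add: power_mult_distrib x_def)
qed

text \<open>Linear growth makes the root a polynomial \<open>c 0 + c 1 * z\<close>, and the cubic
  equation becomes an identity of polynomials that holds on \<open>K\<close> as well. Its linear
  coefficient is \<open>(3 * c 0 ^ 2 + p\<^sub>0) * c 1 + q\<^sub>1\<close>, because
  \<open>P\<close> has no linear term. Thus the value at \<open>0\<close> determines the whole root,
  with a slope proportional to \<open>q\<^sub>1\<close>.\<close>

lemma linear_root:
  assumes K0: "0 \<notin> K" and g: "continuous_on (- K) g" "\<And>z. z \<notin> K \<Longrightarrow> g z \<in> root_set (P z, Q z)"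
  shows "dcubic (P z) (Q z) (g 0 - q\<^sub>1 / (3 * g 0 ^ 2 + p\<^sub>0) * z) = 0"
proof -
  have fin: "finite K" using K0 by (rule finite_K)
  have root: "dcubic (P z) (Q z) (g z) = 0" if "z \<notin> K" for z
    using g(2)[OF that] by (simp add: root_set_def)
  have "norm (g z) \<le> (2 * M) * (1 + norm z) ^ 1" if "z \<notin> K" for z
  proof -
    have "0 < M * (1 + norm z)" using M_ge_1 norm_ge_zero[of z] by (intro mult_pos_pos) linarith+
    then show ?thesis
      using dcubic_root_bound[OF root[OF that] norm_P_le norm_Q_le] by (simp add: mult.assoc)
  qed
  moreover have "g holomorphic_on - K"
  proof (rule holomorphic_root)
    show "open (- K)" by (rule punctured_plane(3)[OF fin])
    show "P holomorphic_on - K" "Q holomorphic_on - K" by (rule holomorphic_P holomorphic_Q)+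
    show "dcubic (P z) (Q z) (g z) = 0" "discr (P z) (Q z) \<noteq> 0" if "z \<in> - K" for z
      using that root by (simp_all add: K_def)
  qed (rule g(1))
  ultimately obtain c where c: "\<And>z. z \<notin> K \<Longrightarrow> g z = (\<Sum>k\<le>1. c k * z ^ k)"
    using polynomial_growth_off_finite[OF fin, of g "2 * M" 1] by blast
  have c': "g z = c 0 + c 1 * z" if "z \<notin> K" for z using c[OF that] by simp
  define \<Phi> where "\<Phi> = [:c 0, c 1:] ^ 3 + [:p\<^sub>0, 0, p\<^sub>2:] * [:c 0, c 1:] + [:q\<^sub>0, q\<^sub>1, q\<^sub>2, q\<^sub>3:]"
  have \<Phi>: "poly \<Phi> z = dcubic (P z) (Q z) (c 0 + c 1 * z)" for z
  proof -
    have "poly \<Phi> z = (poly [:c 0, c 1:] z) ^ 3 + poly [:p\<^sub>0, 0, p\<^sub>2:] z * poly [:c 0, c 1:] z + poly [:q\<^sub>0, q\<^sub>1, q\<^sub>2, q\<^sub>3:] z"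
      unfolding \<Phi>_def by (simp only: poly_add poly_mult poly_power)
    then show ?thesis unfolding poly_P poly_Q by (simp add: dcubic_def mult.commute)
  qed
  have "- K \<subseteq> {z. poly \<Phi> z = 0}" using root c' by (auto simp: \<Phi>)
  then have "infinite {z. poly \<Phi> z = 0}" using punctured_plane(4)[OF fin] finite_subset by blast
  then have "\<Phi> = 0" using poly_roots_finite by blast
  then have "coeff \<Phi> 1 = 0" by simp
  then have "3 * c 0 ^ 2 * c 1 + p\<^sub>0 * c 1 + q\<^sub>1 = 0"
    by (simp add: \<Phi>_def power3_eq_cube power2_eq_square algebra_simps)
  then have "(3 * c 0 ^ 2 + p\<^sub>0) * c 1 = - q\<^sub>1"
    by (simp add: algebra_simps eq_neg_iff_add_eq_0)
  moreover have g0: "g 0 = c 0" using c'[OF K0] by simp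
  moreover have "3 * c 0 ^ 2 + p\<^sub>0 \<noteq> 0"
    using dcubic_simple_root[OF root[OF K0]] K0 by (simp add: K_def P_def flip: g0)
  ultimately have "c 1 = - q\<^sub>1 / (3 * c 0 ^ 2 + p\<^sub>0)" by (metis nonzero_eq_divide_eq mult.commute)
  then have "g 0 - q\<^sub>1 / (3 * g 0 ^ 2 + p\<^sub>0) * z = c 0 + c 1 * z" by (simp add: g0)
  then show ?thesis using \<Phi>[of z] \<open>\<Phi> = 0\<close> by simp
qed

text \<open>The discriminant grows with order at most \<open>6\<close>, so its square root is a
  polynomial of degree at most \<open>3\<close>. Comparing linear coefficients in its square gives
  \<open>s 0 * c 1 = - 27 * q\<^sub>0 * q\<^sub>1\<close>, where \<open>P\<close> contributes
  nothing. The slope is proportional to \<open>q\<^sub>1\<close>; the higher coefficients remain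
  unspecified.\<close>

lemma cubic_sqrt:
  assumes K0: "0 \<notin> K" and s: "continuous_on (- K) s" "\<And>z. z \<notin> K \<Longrightarrow> s z ^ 2 = discr (P z) (Q z)"
  obtains s\<^sub>2 s\<^sub>3 where
    "\<And>z. (s 0 - 27 * q\<^sub>0 * q\<^sub>1 / s 0 * z + s\<^sub>2 * z ^ 2 + s\<^sub>3 * z ^ 3) ^ 2 = discr (P z) (Q z)"
proof -
  have fin: "finite K" using K0 by (rule finite_K)
  have "norm (s z) \<le> (6 * M ^ 3) * (1 + norm z) ^ 3" if "z \<notin> K" for z
  proof (rule power2_le_imp_le)
    define y where "y = M * (1 + norm z)"
    have y: "y \<ge> 0" using M_ge_1 by (simp add: y_def)
    have P3: "norm (P z) ^ 3 \<le> (y ^ 2) ^ 3" using norm_P_le[of z] by (intro power_mono) (auto simp: y_def)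
    have Q2: "norm (Q z) ^ 2 \<le> (y ^ 3) ^ 2" using norm_Q_le[of z] by (intro power_mono) (auto simp: y_def)
    have "norm (s z) ^ 2 = norm (discr (P z) (Q z))" using s(2)[OF that] by (metis norm_power)
    also have "\<dots> \<le> norm (- 4 * P z ^ 3) + norm (27 * Q z ^ 2)" unfolding discr_def by (rule norm_triangle_ineq4)
    also have "\<dots> = 4 * norm (P z) ^ 3 + 27 * norm (Q z) ^ 2" by (simp add: norm_mult norm_power)
    \<comment> \<open>The sum \<open>4 + 27\<close> is rounded up to a square, whose root is the
      constant \<open>6\<close> of the bound.\<close>
    also have "\<dots> \<le> 36 * y ^ 6" 
    proof -
      have "(y ^ 2) ^ 3 = y ^ 6" "(y ^ 3) ^ 2 = y ^ 6" by (simp_all flip: power_mult)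
      then show ?thesis using P3 Q2 zero_le_power[OF y, of 6] by linarith
    qed
    also have "\<dots> = (6 * M ^ 3 * (1 + norm z) ^ 3) ^ 2" by (simp add: y_def power_mult_distrib flip: power_mult)
    finally show "norm (s z) ^ 2 \<le> (6 * M ^ 3 * (1 + norm z) ^ 3) ^ 2" .
  qed (use M_ge_1 in simp)
  moreover have "s holomorphic_on - K"
  proof (rule holomorphic_sqrt[where D = "\<lambda>z. discr (P z) (Q z)"])
    show "(\<lambda>z. discr (P z) (Q z)) holomorphic_on - K"
      unfolding discr_def by (intro holomorphic_intros holomorphic_P holomorphic_Q)
  qed (use s punctured_plane(3)[OF fin] in \<open>auto simp: K_def\<close>)
  ultimately obtain c where c: "\<And>z. z \<notin> K \<Longrightarrow> s z = (\<Sum>k\<le>3. c k * z ^ k)"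
    using polynomial_growth_off_finite[OF fin, of s "6 * M ^ 3" 3] by blast
  have c': "s z = c 0 + c 1 * z + c 2 * z ^ 2 + c 3 * z ^ 3" if "z \<notin> K" for z
    using c[OF that] by (simp add: eval_nat_numeral)
  define \<Phi> where "\<Phi> = [:c 0, c 1, c 2, c 3:] ^ 2 - (smult (-4) ([:p\<^sub>0, 0, p\<^sub>2:] ^ 3) - smult 27 ([:q\<^sub>0, q\<^sub>1, q\<^sub>2, q\<^sub>3:] ^ 2))"
  have \<Phi>: "poly \<Phi> z = (c 0 + c 1 * z + c 2 * z ^ 2 + c 3 * z ^ 3) ^ 2 - discr (P z) (Q z)" for z
  proof -
    have "poly [:c 0, c 1, c 2, c 3:] z = c 0 + c 1 * z + c 2 * z ^ 2 + c 3 * z ^ 3"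
      by (simp add: power2_eq_square power3_eq_cube algebra_simps)
    moreover have "poly \<Phi> z = poly [:c 0, c 1, c 2, c 3:] z ^ 2 -
        (- 4 * poly [:p\<^sub>0, 0, p\<^sub>2:] z ^ 3 - 27 * poly [:q\<^sub>0, q\<^sub>1, q\<^sub>2, q\<^sub>3:] z ^ 2)"
      unfolding \<Phi>_def by (simp only: poly_diff poly_smult poly_power)
    ultimately show ?thesis unfolding poly_P poly_Q by (simp only: discr_def)
  qed
  have "- K \<subseteq> {z. poly \<Phi> z = 0}" using s(2) c' by (auto simp: \<Phi>)
  then have "infinite {z. poly \<Phi> z = 0}" using punctured_plane(4)[OF fin] finite_subset by blast
  then have \<Phi>0: "\<Phi> = 0" using poly_roots_finite by blast
  then have "coeff \<Phi> 1 = 0" by simp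
  then have "2 * (c 0 * c 1 + 27 * q\<^sub>0 * q\<^sub>1) = 0"
    by (simp add: \<Phi>_def power3_eq_cube power2_eq_square algebra_simps)
  then have "c 0 * c 1 + 27 * q\<^sub>0 * q\<^sub>1 = 0" by (metis mult_eq_0_iff zero_neq_numeral)
  then have "c 0 * c 1 = - (27 * q\<^sub>0 * q\<^sub>1)" by (simp add: eq_neg_iff_add_eq_0)
  moreover have s0: "s 0 = c 0" using c'[OF K0] by simp
  moreover have "c 0 \<noteq> 0" using s(2)[OF K0] K0 s0 by (auto simp: K_def)
  ultimately have c1: "c 1 = - (27 * q\<^sub>0 * q\<^sub>1 / s 0)" by (simp add: field_simps)
  show thesis
  proof
    show "(s 0 - 27 * q\<^sub>0 * q\<^sub>1 / s 0 * z + c 2 * z ^ 2 + c 3 * z ^ 3) ^ 2 = discr (P z) (Q z)" for z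
      using \<Phi>[of z] \<Phi>0 c1 s0 by simp
  qed
qed

end

section \<open>Cubic surfaces with small monodromy\<close>

lemma poly_eq_by_eval:
  fixes A B :: "complex poly"
  assumes "\<And>z. poly A z = poly B z"
  shows "A = B"
  using assms poly_eq_poly_eq_iff by blast

text \<open>
  A polynomial dividing \<open>(1 + r z\<^sup>2)\<^sup>3\<close> together with its cofactor has all its reciprocal roots among
  the two square roots of \<open>- r\<close>, so \<open>r\<close> is determined by the linear coefficient.
\<close>

lemma factor_of_cube:
  fixes a\<^sub>1 a\<^sub>2 a\<^sub>3 b\<^sub>1 b\<^sub>2 b\<^sub>3 r :: complex
  assumes eq: "[:1, a\<^sub>1, a\<^sub>2, a\<^sub>3:] * [:1, b\<^sub>1, b\<^sub>2, b\<^sub>3:] = [:1, 0, r:] ^ 3"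
  shows "r = - (a\<^sub>1 ^ 2) \<and> [:1, a\<^sub>1, a\<^sub>2, a\<^sub>3:] = [:1, a\<^sub>1:] ^ 2 * [:1, - a\<^sub>1:] \<and>
           [:1, b\<^sub>1, b\<^sub>2, b\<^sub>3:] = [:1, - a\<^sub>1:] ^ 2 * [:1, a\<^sub>1:] \<or>
         9 * r = - (a\<^sub>1 ^ 2) \<and> [:1, a\<^sub>1, a\<^sub>2, a\<^sub>3:] = [:1, a\<^sub>1 / 3:] ^ 3 \<and>
           [:1, b\<^sub>1, b\<^sub>2, b\<^sub>3:] = [:1, - a\<^sub>1 / 3:] ^ 3"
proof -
  let ?A = "[:1, a\<^sub>1, a\<^sub>2, a\<^sub>3:]" and ?B = "[:1, b\<^sub>1, b\<^sub>2, b\<^sub>3:]"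
  obtain x y z where f: "\<And>t. t ^ 3 + a\<^sub>1 * t ^ 2 + a\<^sub>2 * t + a\<^sub>3 = (t - x) * (t - y) * (t - z)"
    using monic_cubic_splits by blast
  have "[:a\<^sub>3, a\<^sub>2, a\<^sub>1, 1:] = [:- x, 1:] * [:- y, 1:] * [:- z, 1:]"
  proof (rule poly_eq_by_eval)
    fix t
    have "poly [:a\<^sub>3, a\<^sub>2, a\<^sub>1, 1:] t = t ^ 3 + a\<^sub>1 * t ^ 2 + a\<^sub>2 * t + a\<^sub>3"
      by (simp add: power2_eq_square power3_eq_cube algebra_simps)
    then show "poly [:a\<^sub>3, a\<^sub>2, a\<^sub>1, 1:] t = poly ([:- x, 1:] * [:- y, 1:] * [:- z, 1:]) t"
      unfolding f by (simp add: algebra_simps)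
  qed
  then have a: "a\<^sub>1 = - x - y - z" "a\<^sub>2 = x * y + x * z + y * z" "a\<^sub>3 = - x * y * z"
    by (simp_all add: algebra_simps)
  \<comment> \<open>Here \<open>x\<close>, \<open>y\<close>, \<open>z\<close> are the reciprocal
    roots of the first factor. The value \<open>0\<close> occurs when that factor has degree below
    \<open>3\<close>; then the coefficient of degree \<open>6\<close> of the product forces
    \<open>r = 0\<close>.\<close>
  have sq: "t ^ 2 = - r" if t: "(t - x) * (t - y) * (t - z) = 0" for t
  proof (cases "t = 0")
    case True
    then have "a\<^sub>3 = 0" using f[of 0] t by simp
    have "coeff (?A * ?B) 6 = coeff ([:1, 0, r:] ^ 3) 6" by (simp only: eq)
    then have "r ^ 3 = 0" using \<open>a\<^sub>3 = 0\<close> by (simp add: eval_nat_numeral)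
    then show ?thesis using True by simp
  next
    case False
    have "poly ?A (1 / t) * t ^ 3 = t ^ 3 + a\<^sub>1 * t ^ 2 + a\<^sub>2 * t + a\<^sub>3"
      using False by (simp add: field_simps power2_eq_square power3_eq_cube)
    then have "poly ?A (1 / t) = 0" using f[of t] t False by simp
    then have "poly ([:1, 0, r:] ^ 3) (1 / t) = 0" unfolding eq[symmetric] by (simp only: poly_mult mult_zero_left)
    then have "1 + r / (t * t) = 0" by (simp add: poly_power)
    then show ?thesis using False by (simp add: field_simps power2_eq_square add_eq_0_iff)
  qed
  have sqs: "x ^ 2 = - r" "y ^ 2 = - r" "z ^ 2 = - r" by (rule sq; simp)+
  then have r: "r = - (x ^ 2)" by simp
  have "y ^ 2 = x ^ 2" "z ^ 2 = x ^ 2" using sqs by simp_all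
  then have yz: "y = x \<or> y = - x" "z = x \<or> z = - x" by (simp_all only: power2_eq_iff)
  have A0: "?A \<noteq> 0" by simp
  have cancel: "?B = C" if "?A * C = [:1, 0, r:] ^ 3" for C
    using that eq A0 by (metis mult_cancel_left)
  \<comment> \<open>The reciprocal roots agree up to sign: all three may be equal, which makes the
    factor a cube, or two of them are opposite to the third or to each other, which gives the first
    shape.\<close>
  consider (1) "r = - (a\<^sub>1 ^ 2)" "?A = [:1, a\<^sub>1:] ^ 2 * [:1, - a\<^sub>1:]"
    | (2) "9 * r = - (a\<^sub>1 ^ 2)" "?A = [:1, a\<^sub>1 / 3:] ^ 3"
    using yz
  proof (elim disjE)
    assume "y = x" "z = x"
    then show thesis by (intro 2) (simp_all add: a r power2_eq_square power3_eq_cube algebra_simps)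
  qed (rule 1; simp add: a r power2_eq_square algebra_simps)+
  then show ?thesis
  proof cases
    case 1
    have "?A * ([:1, - a\<^sub>1:] ^ 2 * [:1, a\<^sub>1:]) = [:1, 0, r:] ^ 3"
      unfolding 1(2) by (subst 1(1)) (simp add: power2_eq_square power3_eq_cube algebra_simps)
    from cancel[OF this] 1 show ?thesis by blast
  next
    case 2
    have "r = - ((a\<^sub>1 / 3) ^ 2)" using 2(1) by (simp add: power2_eq_square field_simps)
    then have "?A * [:1, - a\<^sub>1 / 3:] ^ 3 = [:1, 0, r:] ^ 3"
      unfolding 2(2) by (simp add: power2_eq_square power3_eq_cube algebra_simps)
    from cancel[OF this] 2 show ?thesis by blast
  qed
qed

text \<open>A replacement for a continuity argument: an identity known where \<open>phi\<close> is
  nonzero is moved to a point with \<open>phi = 0\<close> by adding \<open>s\<close> times a vector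
  with \<open>phi = 1\<close> and reading off the constant term in \<open>s\<close>.\<close>

lemma cubic_vanishes_at_zero:
  fixes a b c d :: complex
  assumes "\<And>s. s \<noteq> 0 \<Longrightarrow> a + b * s + c * s ^ 2 + d * s ^ 3 = 0"
  shows "a = 0"
proof -
  have "a + b + c + d = 0" "a - b + c - d = 0" "a + b * 2 + c * 4 + d * 8 = 0" "a - b * 2 + c * 4 - d * 8 = 0"
    using assms[of 1] assms[of "-1"] assms[of 2] assms[of "-2"] by simp_all
  then have "6 * a = 0" by algebra
  then show ?thesis by simp
qed

text \<open>\<open>u\<close> is a vector of the centre of projection, scaled so that the cubic has
  value \<open>1\<close> there. The base point \<open>e\<close> lies on the polar plane of
  \<open>u\<close>, and \<open>e_nonzero\<close> says that the quadratic form \<open>p\<close> does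
  not vanish at it.\<close>

locale polarized_cubic = cubic_polarization +
  fixes u e :: "complex^4"
  assumes unit: "\<tau> u u u = 1" and e_polar: "\<tau> u u e = 0" and e_nonzero: "\<tau> u e e \<noteq> 0"
begin

definition "f x = \<tau> x x x"
definition "lam x = \<tau> u u x"
text \<open>The polar of \<open>e\<close> with respect to \<open>p\<close>, scaled to be
  \<open>1\<close> at \<open>e\<close>. Together, \<open>lam\<close> and \<open>phi\<close> split
  the space into the lines of \<open>u\<close> and \<open>e\<close> and the complement
  \<open>V\<close>.\<close>

definition "phi x = \<tau> u e x / \<tau> u e e"
definition "V = {w. lam w = 0 \<and> phi w = 0}"
definition "p v = 3 * \<tau> u v v"
definition "q v = \<tau> v v v"
definition "rest x = x - lam x *s u - phi x *s e"

lemma lam_simps: "lam (x + y) = lam x + lam y" "lam (x - y) = lam x - lam y" "lam (k *s x) = k * lam x"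
  "lam u = 1" "lam e = 0" "lam 0 = 0"
  by (simp_all add: lam_def expand unit e_polar zero_3)

lemma phi_simps: "phi (x + y) = phi x + phi y" "phi (x - y) = phi x - phi y" "phi (k *s x) = k * phi x"
  "phi u = 0" "phi e = 1" "phi 0 = 0"
  using e_polar e_nonzero by (simp_all add: phi_def expand add_divide_distrib diff_divide_distrib zero_3 commute_23[of u e u])

lemma f_scale: "f (k *s x) = k ^ 3 * f x"
  by (simp add: f_def expand power3_eq_cube)

lemma f_add: "f (x + k *s y) = f x + 3 * \<tau> x x y * k + 3 * \<tau> x y y * k ^ 2 + f y * k ^ 3"
  by (simp add: f_def expand commute algebra_simps power2_eq_square power3_eq_cube)

lemma f_dcubic:
  assumes "lam v = 0"
  shows "f (v + t *s u) = dcubic (p v) (q v) t"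
proof -
  have "\<tau> v u u = 0" using assms commute_12 commute_23 unfolding lam_def by metis
  moreover have "\<tau> v v u = \<tau> u v v" using commute_12 commute_23 by metis
  ultimately show ?thesis
    unfolding f_add by (simp add: dcubic_def p_def q_def unit f_def)
qed

lemma V_iff: "w \<in> V \<longleftrightarrow> \<tau> u u w = 0 \<and> \<tau> u e w = 0"
  using e_nonzero by (simp add: V_def lam_def phi_def)

lemma V_simps: "w \<in> V \<Longrightarrow> w' \<in> V \<Longrightarrow> w + w' \<in> V" "w \<in> V \<Longrightarrow> k *s w \<in> V" "rest x \<in> V"
  by (auto simp: V_def lam_simps phi_simps rest_def)

lemma decompose: "x = phi x *s e + rest x + lam x *s u"
  by (simp add: rest_def)

lemma p_line: "w \<in> V \<Longrightarrow> p (e + z *s w) = p e + p w * z ^ 2"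
  by (simp add: V_iff p_def expand commute_23[of u w e] algebra_simps power2_eq_square)

lemma q_line: "q (e + z *s w) = q e + 3 * \<tau> e e w * z + 3 * \<tau> e w w * z ^ 2 + q w * z ^ 3"
  using f_add[of e z w] by (simp add: f_def q_def)

lemma normalize:
  assumes "phi x \<noteq> 0"
  obtains w t where "w \<in> V" "x = phi x *s (e + w + t *s u)" "rest x = phi x *s w" "lam x = phi x * t"
proof
  show "inverse (phi x) *s rest x \<in> V" by (intro V_simps)
  show "x = phi x *s (e + inverse (phi x) *s rest x + (lam x / phi x) *s u)"
    using assms by (subst decompose) (simp add: vec.scale_right_distrib)
qed (use assms in simp_all)

text \<open>Since \<open>l u = 1\<close>, every \<open>x\<close> is \<open>y + l x *s u\<close> with
  \<open>l y = 0\<close>. In the expansion of \<open>f\<close> along \<open>u\<close> the term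
  \<open>f y\<close> vanishes and all others are multiples of \<open>l x\<close>, which gives the
  quadratic cofactor explicitly; what remains is to write both factors in coordinates.\<close>

lemma reducible_if_linear_root:
  fixes l :: "complex^4 \<Rightarrow> complex"
  assumes l: "\<And>x y. l (x + y) = l x + l y" "\<And>k x. l (k *s x) = k * l x" "l u = 1"
    and vanish: "\<And>x. l x = 0 \<Longrightarrow> f x = 0"
  shows "reducible_cubic f"
proof -
  have f: "f x = l x * (3 * \<tau> u x x - 3 * l x * lam x + l x ^ 2)" for x
  proof -
    define y where "y = x + (- l x) *s u"
    have x: "x = y + l x *s u" by (simp add: y_def)
    have "l y = l x + (- l x) * l u" unfolding y_def by (simp only: l(1,2))
    then have "l y = 0" by (simp add: l(3))
    then have fy: "f y = 0" by (rule vanish)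
    have ty: "\<tau> y y u = \<tau> u x x - 2 * l x * lam x + l x ^ 2"
      by (simp add: y_def expand commute lam_def unit power2_eq_square algebra_simps)
    have tu: "\<tau> y u u = lam x - l x"
      by (simp add: y_def expand commute lam_def unit algebra_simps)
    have "f x = 3 * \<tau> y y u * l x + 3 * \<tau> y u u * l x ^ 2 + f u * l x ^ 3"
      by (subst x) (simp only: f_add fy add_0_left)
    then show ?thesis
      unfolding ty tu by (simp add: f_def unit power2_eq_square power3_eq_cube algebra_simps)
  qed
  define b where "b k = axis k (1 :: complex)" for k :: 4
  have expansion: "x = x $ 1 *s b 1 + x $ 2 *s b 2 + x $ 3 *s b 3 + x $ 4 *s b 4" for x
    using basis_expansion[of x] by (simp add: sum_4 b_def)
  have lx: "l x = (\<Sum>j\<in>UNIV. x $ j * l (b j))" for x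
    by (subst expansion[of x]) (simp add: l(1,2) sum_4)
  have lamx: "lam x = (\<Sum>k\<in>UNIV. x $ k * lam (b k))" for x
    unfolding lam_def b_def by (rule coordinates_3)
  define m where "m j k = 3 * \<tau> u (b j) (b k) - 3 * (l (b j) * lam (b k)) + l (b j) * l (b k)" for j k
  have quadric: "3 * \<tau> u x x - 3 * l x * lam x + l x ^ 2 = (\<Sum>j\<in>UNIV. \<Sum>k\<in>UNIV. x $ j * x $ k * m j k)" for x
  proof -
    have "\<tau> u x x = (\<Sum>j\<in>UNIV. \<Sum>k\<in>UNIV. x $ j * x $ k * \<tau> u (b j) (b k))"
      unfolding b_def by (rule coordinates_23)
    moreover have "l x * lam x = (\<Sum>j\<in>UNIV. \<Sum>k\<in>UNIV. x $ j * x $ k * (l (b j) * lam (b k)))"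
      unfolding lx[of x] lamx[of x] sum_product by (intro sum.cong refl) (simp only: mult_ac)
    moreover have "l x ^ 2 = (\<Sum>j\<in>UNIV. \<Sum>k\<in>UNIV. x $ j * x $ k * (l (b j) * l (b k)))"
      unfolding power2_eq_square lx[of x] sum_product by (intro sum.cong refl) (simp only: mult_ac)
    ultimately have "3 * \<tau> u x x - 3 * l x * lam x + l x ^ 2 =
        (\<Sum>j\<in>UNIV. \<Sum>k\<in>UNIV. 3 * (x $ j * x $ k * \<tau> u (b j) (b k)) -
           3 * (x $ j * x $ k * (l (b j) * lam (b k))) + x $ j * x $ k * (l (b j) * l (b k)))"
      by (simp only: mult.assoc sum_distrib_left sum.distrib sum_subtractf)
    also have "\<dots> = (\<Sum>j\<in>UNIV. \<Sum>k\<in>UNIV. x $ j * x $ k * m j k)"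
      by (intro sum.cong refl) (simp add: m_def algebra_simps)
    finally show ?thesis .
  qed
  define \<theta> where "\<theta> = (!) [l (b 1), l (b 2), l (b 3), l (b 4), m 1 1, m 2 2, m 3 3, m 4 4,
    m 1 2 + m 2 1, m 1 3 + m 3 1, m 1 4 + m 4 1, m 2 3 + m 3 2, m 2 4 + m 4 2, m 3 4 + m 4 3]"
  have "f x =
     (\<theta> 0 * x $ 1 + \<theta> 1 * x $ 2 + \<theta> 2 * x $ 3 + \<theta> 3 * x $ 4) *
     (\<theta> 4 * x $ 1 * x $ 1 + \<theta> 5 * x $ 2 * x $ 2 + \<theta> 6 * x $ 3 * x $ 3 + \<theta> 7 * x $ 4 * x $ 4 +
      \<theta> 8 * x $ 1 * x $ 2 + \<theta> 9 * x $ 1 * x $ 3 + \<theta> 10 * x $ 1 * x $ 4 +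
      \<theta> 11 * x $ 2 * x $ 3 + \<theta> 12 * x $ 2 * x $ 4 + \<theta> 13 * x $ 3 * x $ 4)" for x
  proof -
    have A: "(\<Sum>j\<in>UNIV. x $ j * l (b j)) = \<theta> 0 * x $ 1 + \<theta> 1 * x $ 2 + \<theta> 2 * x $ 3 + \<theta> 3 * x $ 4"
      by (simp add: \<theta>_def sum_4 mult.commute)
    have B: "(\<Sum>j\<in>UNIV. \<Sum>k\<in>UNIV. x $ j * x $ k * m j k) =
      \<theta> 4 * x $ 1 * x $ 1 + \<theta> 5 * x $ 2 * x $ 2 + \<theta> 6 * x $ 3 * x $ 3 + \<theta> 7 * x $ 4 * x $ 4 +
      \<theta> 8 * x $ 1 * x $ 2 + \<theta> 9 * x $ 1 * x $ 3 + \<theta> 10 * x $ 1 * x $ 4 +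
      \<theta> 11 * x $ 2 * x $ 3 + \<theta> 12 * x $ 2 * x $ 4 + \<theta> 13 * x $ 3 * x $ 4"
      by (simp add: \<theta>_def sum_4 algebra_simps)
    have C: "f x = l x * (\<Sum>j\<in>UNIV. \<Sum>k\<in>UNIV. x $ j * x $ k * m j k)"
      using f[of x] unfolding quadric .
    show ?thesis unfolding C B lx[of x] A ..
  qed
  then show ?thesis unfolding reducible_cubic_def by blast
qed

text \<open>The slope is linear in \<open>w\<close>, so the roots on all lines through
  \<open>e\<close> are described by one linear form. Homogeneity gives the vanishing of
  \<open>f\<close> on its kernel where \<open>phi\<close> is nonzero, and a polynomial argument the
  rest.\<close>

lemma reducible_if_fixed_root:
  assumes root: "\<And>w z. w \<in> V \<Longrightarrow> dcubic (p (e + z *s w)) (q (e + z *s w)) (t\<^sub>0 - 3 * \<tau> e e w / B * z) = 0"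
  shows "reducible_cubic f"
proof -
  \<comment> \<open>At \<open>e + w + t *s u\<close> with \<open>w\<close> in \<open>V\<close>, this
    form vanishes exactly when \<open>t\<close> is the value at \<open>z = 1\<close> of the root on
    the line in direction \<open>w\<close>.\<close>
  define l where "l x = lam x - t\<^sub>0 * phi x + 3 * \<tau> e e (rest x) / B" for x
  have rest: "rest (x + y) = rest x + rest y" "rest (k *s x) = k *s rest x" for x y k
    by (simp_all add: rest_def lam_simps phi_simps vec.scale_right_distrib vec.scale_left_distrib
        vec.scale_right_diff_distrib)
  have rest_0: "rest u = 0" "rest e = 0" by (simp_all add: rest_def lam_simps phi_simps)
  have l: "l (x + y) = l x + l y" "l (k *s x) = k * l x" for x y k
    by (simp_all add: l_def lam_simps phi_simps rest expand algebra_simps add_divide_distrib)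
  have lu: "l u = 1" by (simp add: l_def lam_simps phi_simps rest_0 zero_3)
  have le: "l (e + t\<^sub>0 *s u) = 0" unfolding l by (simp add: l_def lam_simps phi_simps rest_0 zero_3)
  have nz: "f x = 0" if lx: "l x = 0" and px: "phi x \<noteq> 0" for x
  proof -
    obtain w t where w: "w \<in> V" "x = phi x *s (e + w + t *s u)" "rest x = phi x *s w" "lam x = phi x * t"
      by (rule normalize[OF px])
    have "phi x * (t - t\<^sub>0 + 3 * \<tau> e e w / B) = 0"
      using lx unfolding l_def w(3,4) by (simp add: expand algebra_simps)
    then have z: "t - t\<^sub>0 + 3 * \<tau> e e w / B = 0" using px mult_eq_0_iff by blast
    have "t = (t - t\<^sub>0 + 3 * \<tau> e e w / B) + (t\<^sub>0 - 3 * \<tau> e e w / B)" by simp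
    then have t: "t = t\<^sub>0 - 3 * \<tau> e e w / B" unfolding z by simp
    have "lam (e + w) = 0" using w(1) by (simp add: lam_simps V_def)
    moreover have "dcubic (p (e + w)) (q (e + w)) t = 0" using root[OF w(1), of 1] by (simp add: t)
    ultimately have "f (e + w + t *s u) = 0" by (simp only: f_dcubic)
    moreover have "f x = phi x ^ 3 * f (e + w + t *s u)" by (subst w(2)) (rule f_scale)
    ultimately show ?thesis by simp
  qed
  have "f x = 0" if "l x = 0" for x
  proof (cases "phi x = 0")
    case True
    \<comment> \<open>This vector is in the kernel of \<open>l\<close> and has
      \<open>phi ?y = 1\<close>, so adding nonzero multiples of it to \<open>x\<close> stays in the
      kernel and leaves the plane \<open>phi = 0\<close>.\<close>
    let ?y = "e + t\<^sub>0 *s u"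
    have "f x + 3 * \<tau> x x ?y * s + 3 * \<tau> x ?y ?y * s ^ 2 + f ?y * s ^ 3 = 0" if "s \<noteq> 0" for s
    proof -
      have "l (x + s *s ?y) = l x + s * l ?y" by (simp only: l(1)[of x] l(2)[of s])
      then have "l (x + s *s ?y) = 0" by (simp only: le \<open>l x = 0\<close> mult_zero_right add_0_left)
      moreover have "phi (x + s *s ?y) = s" using True by (simp add: phi_simps)
      ultimately have "f (x + s *s ?y) = 0" using nz that by metis
      then show ?thesis by (simp only: f_add)
    qed
    then show ?thesis by (rule cubic_vanishes_at_zero)
  qed (use nz that in blast)
  then show ?thesis by (intro reducible_if_linear_root[of l] l lu)
qed

text \<open>Three linear conditions on four coordinates. The slopes at \<open>e\<close> depend on
  the direction only through \<open>\<tau> e e w\<close>, so they do not change along this vector;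
  it becomes the vertex of a cone.\<close>

lemma kernel_vector:
  obtains w where "w \<noteq> 0" "w \<in> V" "\<tau> e e w = 0"
proof -
  define M where "M k n = (if n = 0 then \<tau> u u (axis k 1) else if n = 1 then \<tau> u e (axis k 1) else \<tau> e e (axis k 1))"
    for k :: 4 and n :: nat
  obtain a where a: "\<exists>k\<in>UNIV. a k \<noteq> 0" "\<forall>n\<in>{0, 1, 2}. (\<Sum>k\<in>UNIV. a k * M k n) = 0"
    using nontrivial_solution_exists[of "{0, 1, 2 :: nat}" "UNIV :: 4 set" M] by auto
  define w where "w = (\<chi> k. a k)"
  have wk: "w $ k = a k" for k by (simp add: w_def)
  have "w \<noteq> 0" using a(1) by (auto simp: wk vec_eq_iff)
  moreover have "\<tau> u u w = 0" "\<tau> u e w = 0" "\<tau> e e w = 0"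
    using a(2) by (simp_all add: coordinates_3[of _ _ w] wk M_def)
  ultimately show thesis using that by (simp add: V_iff)
qed

text \<open>
  With \<open>k\<^sup>2 = - 27\<close>, a square root \<open>s\<close> of the discriminant gives the factorization
  \<open>(s + k q) (s - k q) = - 4 p\<^sup>3\<close>.
\<close>

lemma line_dichotomy:
  assumes w: "w \<in> V" and k: "k ^ 2 = - 27"
    and s: "\<And>z. (s\<^sub>0 + s\<^sub>1 * z + s\<^sub>2 * z ^ 2 + s\<^sub>3 * z ^ 3) ^ 2 = discr (p (e + z *s w)) (q (e + z *s w))"
    and a: "a\<^sub>1 = (s\<^sub>1 + k * (3 * \<tau> e e w)) / (s\<^sub>0 + k * q e)"
  shows "p w / p e = - (a\<^sub>1 ^ 2) \<and> 2 * k * q (e + w) =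
       (s\<^sub>0 + k * q e) * ((1 + a\<^sub>1) ^ 2 * (1 - a\<^sub>1)) - (s\<^sub>0 - k * q e) * ((1 - a\<^sub>1) ^ 2 * (1 + a\<^sub>1)) \<or>
     9 * (p w / p e) = - (a\<^sub>1 ^ 2) \<and> 2 * k * q (e + w) =
       (s\<^sub>0 + k * q e) * (1 + a\<^sub>1 / 3) ^ 3 - (s\<^sub>0 - k * q e) * (1 - a\<^sub>1 / 3) ^ 3"
proof -
  define a\<^sub>0 b\<^sub>0 where "a\<^sub>0 = s\<^sub>0 + k * q e" and "b\<^sub>0 = s\<^sub>0 - k * q e"
  have pe: "p e \<noteq> 0" using e_nonzero by (simp add: p_def)
  define A B where "A = [:a\<^sub>0, s\<^sub>1 + k * (3 * \<tau> e e w), s\<^sub>2 + k * (3 * \<tau> e w w), s\<^sub>3 + k * q w:]"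
    and "B = [:b\<^sub>0, s\<^sub>1 - k * (3 * \<tau> e e w), s\<^sub>2 - k * (3 * \<tau> e w w), s\<^sub>3 - k * q w:]"
  have pA: "poly A z = (s\<^sub>0 + s\<^sub>1 * z + s\<^sub>2 * z ^ 2 + s\<^sub>3 * z ^ 3) + k * q (e + z *s w)"
    and pB: "poly B z = (s\<^sub>0 + s\<^sub>1 * z + s\<^sub>2 * z ^ 2 + s\<^sub>3 * z ^ 3) - k * q (e + z *s w)" for z
    unfolding q_line by (simp_all add: A_def B_def a\<^sub>0_def b\<^sub>0_def power2_eq_square power3_eq_cube algebra_simps)
  have AB: "poly A z * poly B z = - 4 * p (e + z *s w) ^ 3" for z
  proof -
    have "poly A z * poly B z = (s\<^sub>0 + s\<^sub>1 * z + s\<^sub>2 * z ^ 2 + s\<^sub>3 * z ^ 3) ^ 2 - k ^ 2 * q (e + z *s w) ^ 2"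
      unfolding pA pB by algebra
    then show ?thesis unfolding s k by (simp add: discr_def)
  qed
  have ab: "a\<^sub>0 * b\<^sub>0 = - 4 * p e ^ 3" using AB[of 0] by (simp add: A_def B_def)
  then have nz: "a\<^sub>0 \<noteq> 0" "b\<^sub>0 \<noteq> 0" using pe by auto
  define r where "r = p w / p e"
  have "smult (inverse a\<^sub>0) A * smult (inverse b\<^sub>0) B = [:1, 0, r:] ^ 3"
  proof (rule poly_eq_by_eval)
    fix z
    have "poly (smult (inverse a\<^sub>0) A * smult (inverse b\<^sub>0) B) z = (poly A z * poly B z) / (a\<^sub>0 * b\<^sub>0)"
      by (simp add: field_simps)
    also have "\<dots> = (p (e + z *s w) / p e) ^ 3" unfolding AB ab using pe by (simp add: power_divide)
    also have "p (e + z *s w) / p e = poly [:1, 0, r:] z"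
      unfolding p_line[OF w] using pe by (simp add: r_def field_simps power2_eq_square)
    finally show "poly (smult (inverse a\<^sub>0) A * smult (inverse b\<^sub>0) B) z = poly ([:1, 0, r:] ^ 3) z"
      by (simp only: poly_power)
  qed
  moreover obtain a\<^sub>2 a\<^sub>3 where A': "smult (inverse a\<^sub>0) A = [:1, a\<^sub>1, a\<^sub>2, a\<^sub>3:]"
    using nz by (simp add: A_def a divide_inverse mult.commute flip: a\<^sub>0_def)
  moreover obtain b\<^sub>1 b\<^sub>2 b\<^sub>3 where B': "smult (inverse b\<^sub>0) B = [:1, b\<^sub>1, b\<^sub>2, b\<^sub>3:]"
    using nz by (simp add: B_def)
  ultimately have *: "[:1, a\<^sub>1, a\<^sub>2, a\<^sub>3:] * [:1, b\<^sub>1, b\<^sub>2, b\<^sub>3:] = [:1, 0, r:] ^ 3" by simp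
  have A1: "poly A 1 = a\<^sub>0 * poly [:1, a\<^sub>1, a\<^sub>2, a\<^sub>3:] 1" using nz by (simp flip: A')
  have B1: "poly B 1 = b\<^sub>0 * poly [:1, b\<^sub>1, b\<^sub>2, b\<^sub>3:] 1" using nz by (simp flip: B')
  \<comment> \<open>The two factors differ by \<open>2 * k * q\<close>, so their values at
    \<open>1\<close> recover \<open>q (e + w)\<close>.\<close>
  have q1: "2 * k * q (e + w) = poly A 1 - poly B 1" using pA[of 1] pB[of 1] by simp
  from factor_of_cube[OF *] show ?thesis
  proof (elim disjE conjE)
    assume h: "r = - (a\<^sub>1 ^ 2)" "[:1, a\<^sub>1, a\<^sub>2, a\<^sub>3:] = [:1, a\<^sub>1:] ^ 2 * [:1, - a\<^sub>1:]"
       "[:1, b\<^sub>1, b\<^sub>2, b\<^sub>3:] = [:1, - a\<^sub>1:] ^ 2 * [:1, a\<^sub>1:]"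
    have "2 * k * q (e + w) = a\<^sub>0 * ((1 + a\<^sub>1) ^ 2 * (1 - a\<^sub>1)) - b\<^sub>0 * ((1 - a\<^sub>1) ^ 2 * (1 + a\<^sub>1))"
      unfolding q1 A1 B1 h(2,3) by (simp add: poly_power algebra_simps)
    with h(1) show ?thesis by (simp add: r_def a\<^sub>0_def b\<^sub>0_def)
  next
    assume h: "9 * r = - (a\<^sub>1 ^ 2)" "[:1, a\<^sub>1, a\<^sub>2, a\<^sub>3:] = [:1, a\<^sub>1 / 3:] ^ 3"
       "[:1, b\<^sub>1, b\<^sub>2, b\<^sub>3:] = [:1, - a\<^sub>1 / 3:] ^ 3"
    have "2 * k * q (e + w) = a\<^sub>0 * (1 + a\<^sub>1 / 3) ^ 3 - b\<^sub>0 * (1 - a\<^sub>1 / 3) ^ 3"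
      unfolding q1 A1 B1 h(2,3) by (simp add: poly_power algebra_simps)
    with h(1) show ?thesis by (simp add: r_def a\<^sub>0_def b\<^sub>0_def)
  qed
qed

text \<open>On each line the factorization leaves two possible values for \<open>p w\<close> and for
  \<open>q (e + w)\<close>, both determined by \<open>a w\<close>, which is constant along
  \<open>w\<^sub>0\<close>. Polynomial dependence excludes a jump between them, so \<open>p\<close>
  and \<open>q\<close> are invariant under \<open>w\<^sub>0\<close> and the surface is a cone with
  this vertex. With \<open>s\<^sub>0 = m = 0\<close> this also covers a discriminant that vanishes
  on these lines.\<close>

lemma cyclic_if_square_discriminant:
  assumes s: "\<And>w. w \<in> V \<Longrightarrow> \<exists>s\<^sub>2 s\<^sub>3. \<forall>z. (s\<^sub>0 + m * \<tau> e e w * z + s\<^sub>2 * z ^ 2 + s\<^sub>3 * z ^ 3) ^ 2 =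
      discr (p (e + z *s w)) (q (e + z *s w))"
  shows "cyclic_cubic f"
proof -
  define k where "k = \<i> * of_real (sqrt 27)"
  have k2: "k ^ 2 = - 27" by (simp add: k_def power_mult_distrib flip: of_real_power)
  then have k0: "k \<noteq> 0" by auto
  obtain w\<^sub>0 where w\<^sub>0: "w\<^sub>0 \<noteq> 0" "w\<^sub>0 \<in> V" "\<tau> e e w\<^sub>0 = 0" using kernel_vector by blast
  define a where "a w = (m * \<tau> e e w + k * (3 * \<tau> e e w)) / (s\<^sub>0 + k * q e)" for w
  define F where "F x = (s\<^sub>0 + k * q e) * ((1 + x) ^ 2 * (1 - x)) - (s\<^sub>0 - k * q e) * ((1 - x) ^ 2 * (1 + x))" for x
  define G where "G x = (s\<^sub>0 + k * q e) * (1 + x / 3) ^ 3 - (s\<^sub>0 - k * q e) * (1 - x / 3) ^ 3" for x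
  have pe: "p e \<noteq> 0" using e_nonzero by (simp add: p_def)
  have dich: "p w / p e = - (a w ^ 2) \<and> 2 * k * q (e + w) = F (a w) \<or>
      9 * (p w / p e) = - (a w ^ 2) \<and> 2 * k * q (e + w) = G (a w)" if w: "w \<in> V" for w
  proof -
    obtain s\<^sub>2 s\<^sub>3 where "\<And>z. (s\<^sub>0 + m * \<tau> e e w * z + s\<^sub>2 * z ^ 2 + s\<^sub>3 * z ^ 3) ^ 2 =
      discr (p (e + z *s w)) (q (e + z *s w))" using s[OF w] by blast
    from line_dichotomy[OF w k2 this a_def] show ?thesis by (simp only: F_def G_def)
  qed
  have p_inv: "p (w + c *s w\<^sub>0) = p w" and q_inv: "q (e + (w + c *s w\<^sub>0)) = q (e + w)" if w: "w \<in> V" for w c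
  proof -
    have a_inv: "a (w + c *s w\<^sub>0) = a w" for c by (simp add: a_def expand w\<^sub>0)
    have inV: "w + c *s w\<^sub>0 \<in> V" for c using w w\<^sub>0 by (intro V_simps)
    have pc: "p (w + c *s w\<^sub>0) = p w + 6 * \<tau> u w w\<^sub>0 * c + p w\<^sub>0 * c ^ 2" for c
      by (simp add: p_def expand commute_23[of u w\<^sub>0 w] algebra_simps power2_eq_square)
    define v\<^sub>1 v\<^sub>2 where "v\<^sub>1 = - (a w ^ 2) * p e" and "v\<^sub>2 = - (a w ^ 2) * p e / 9"
    have "p (w + c *s w\<^sub>0) = v\<^sub>1 \<or> p (w + c *s w\<^sub>0) = v\<^sub>2" for c
      using dich[OF inV, of c] pe unfolding a_inv v\<^sub>1_def v\<^sub>2_def by (auto simp: field_simps)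
    moreover have "poly [:p w - v, 6 * \<tau> u w w\<^sub>0, p w\<^sub>0:] c = p (w + c *s w\<^sub>0) - v" for v c
      unfolding pc by (simp add: algebra_simps power2_eq_square)
    \<comment> \<open>A polynomial in \<open>c\<close> with at most two values is constant: the
      product of its differences from both values vanishes identically, so one factor is the zero
      polynomial.\<close>
    ultimately have "poly ([:p w - v\<^sub>1, 6 * \<tau> u w w\<^sub>0, p w\<^sub>0:] * [:p w - v\<^sub>2, 6 * \<tau> u w w\<^sub>0, p w\<^sub>0:]) c = 0" for c
      unfolding poly_mult by (metis eq_iff_diff_eq_0 mult_eq_0_iff)
    then have "[:p w - v\<^sub>1, 6 * \<tau> u w w\<^sub>0, p w\<^sub>0:] * [:p w - v\<^sub>2, 6 * \<tau> u w w\<^sub>0, p w\<^sub>0:] = 0"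
      using poly_all_0_iff_0 by blast
    then have "\<tau> u w w\<^sub>0 = 0" "p w\<^sub>0 = 0" by auto
    then show pw: "p (w + c *s w\<^sub>0) = p w" by (simp add: pc)
    \<comment> \<open>The value of \<open>p w\<close> decides between the two alternatives unless
      both hold; then \<open>a w = 0\<close>, and \<open>F\<close> and \<open>G\<close> agree at
      \<open>0\<close>.\<close>
    have FG: "F (a w) = G (a w)" if "p w / p e = - (a w ^ 2)" "9 * (p w / p e) = - (a w ^ 2)"
    proof -
      have "a w ^ 2 = 0" using that by simp
      then show ?thesis by (simp add: F_def G_def)
    qed
    have "2 * k * q (e + (w + c *s w\<^sub>0)) = 2 * k * q (e + w)"
      using dich[OF inV, of c] dich[OF w] FG unfolding a_inv pw by metis
    then show "q (e + (w + c *s w\<^sub>0)) = q (e + w)" using k0 by simp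
  qed
  have lam0: "lam w\<^sub>0 = 0" and phi0: "phi w\<^sub>0 = 0" using w\<^sub>0(2) by (simp_all add: V_def)
  have nz: "f (x + c *s w\<^sub>0) = f x" if px: "phi x \<noteq> 0" for x c
  proof -
    obtain w t where w: "w \<in> V" "x = phi x *s (e + w + t *s u)" by (rule normalize[OF px])
    have fx: "f x = phi x ^ 3 * f (e + w + t *s u)" by (subst w(2)) (rule f_scale)
    define c' where "c' = c / phi x"
    have "x + c *s w\<^sub>0 = phi x *s (e + w + t *s u) + (phi x * c') *s w\<^sub>0"
      using px w(2) by (simp add: c'_def)
    also have "\<dots> = phi x *s (e + (w + c' *s w\<^sub>0) + t *s u)"
      by (simp add: vec.scale_right_distrib add_ac)
    finally have "f (x + c *s w\<^sub>0) = phi x ^ 3 * f (e + (w + c' *s w\<^sub>0) + t *s u)" by (simp only: f_scale)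
    also have "f (e + (w + c' *s w\<^sub>0) + t *s u) = f (e + w + t *s u)"
    proof -
      have le: "lam (e + w) = 0" "lam (e + (w + c' *s w\<^sub>0)) = 0"
        using w(1) lam0 by (simp_all add: lam_simps V_def)
      have "w + c' *s w\<^sub>0 \<in> V" using w(1) w\<^sub>0 by (intro V_simps)
      then have "p (e + (w + c' *s w\<^sub>0)) = p (e + w)"
        using p_line[of "w + c' *s w\<^sub>0" 1] p_line[OF w(1), of 1] p_inv[OF w(1)] by simp
      then show ?thesis unfolding f_dcubic[OF le(1)] f_dcubic[OF le(2)] q_inv[OF w(1)] by simp
    qed
    also have "phi x ^ 3 * f (e + w + t *s u) = f x" by (rule fx[symmetric])
    finally show ?thesis .
  qed
  have inv: "f (x + c *s w\<^sub>0) = f x" for x c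
  proof (cases "phi x = 0")
    case True
    let ?y = "x + c *s w\<^sub>0"
    \<comment> \<open>Both expansions in \<open>s\<close> have the leading coefficient
      \<open>f e\<close>, hence the \<open>0\<close> in front of \<open>s ^ 3\<close>.\<close>
    have "(f ?y - f x) + (3 * \<tau> ?y ?y e - 3 * \<tau> x x e) * s + (3 * \<tau> ?y e e - 3 * \<tau> x e e) * s ^ 2 + 0 * s ^ 3 = 0"
      if "s \<noteq> 0" for s
    proof -
      have "f ((x + s *s e) + c *s w\<^sub>0) = f (x + s *s e)"
        using that True by (intro nz) (simp add: phi_simps)
      moreover have "(x + s *s e) + c *s w\<^sub>0 = ?y + s *s e" by (simp add: add_ac)
      ultimately have "f (?y + s *s e) - f (x + s *s e) = 0" by simp
      then show ?thesis unfolding f_add[of ?y s e] f_add[of x s e] by algebra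
    qed
    then have "f ?y - f x = 0" by (rule cubic_vanishes_at_zero)
    then show ?thesis by simp
  qed (rule nz)
  show ?thesis
    unfolding cyclic_cubic_def by (intro exI[of _ "\<lambda>_. 0"] exI[of _ w\<^sub>0]) (simp add: w\<^sub>0 inv)
qed

end

text \<open>If the quadratic form vanishes on the polar plane, then \<open>f\<close> minus the cube
  of \<open>\<tau> u u\<close> depends only on the projection of \<open>x\<close> to this plane
  along \<open>u\<close>, so \<open>u\<close> is an invariant direction. Read contrapositively, this
  supplies a base point for a cubic that is not cyclic.\<close>

lemma (in cubic_polarization) cyclic_if_polar_vanishes:
  assumes unit: "\<tau> u u u = 1" and p0: "\<And>v. \<tau> u u v = 0 \<Longrightarrow> \<tau> u v v = 0"
  shows "cyclic_cubic (\<lambda>x. \<tau> x x x)"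
proof -
  have *: "\<tau> x x x - \<tau> u u x ^ 3 = \<tau> (x - \<tau> u u x *s u) (x - \<tau> u u x *s u) (x - \<tau> u u x *s u)" for x
  proof -
    define t where "t = \<tau> u u x"
    define v where "v = x - t *s u"
    have x: "x = v + t *s u" by (simp add: v_def)
    have v0: "\<tau> u u v = 0" by (simp add: v_def expand unit t_def)
    have "\<tau> x x x = \<tau> v v v + 3 * \<tau> u v v * t + 3 * \<tau> u u v * t ^ 2 + \<tau> u u u * t ^ 3"
      by (subst (1 2 3) x) (simp add: expand commute algebra_simps power2_eq_square power3_eq_cube)
    then show ?thesis using v0 p0[OF v0] unit by (simp add: v_def t_def)
  qed
  have u0: "u \<noteq> 0" using unit zero_1 by force
  have "\<tau> (x + k *s u) (x + k *s u) (x + k *s u) - \<tau> u u (x + k *s u) ^ 3 = \<tau> x x x - \<tau> u u x ^ 3" for k x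
  proof -
    have eq: "x + k *s u - \<tau> u u (x + k *s u) *s u = x - \<tau> u u x *s u"
      by (simp add: add_3 scale_3 unit vec.scale_left_distrib)
    show ?thesis unfolding *[of "x + k *s u"] *[of x] eq ..
  qed
  then show ?thesis
    unfolding cyclic_cubic_def using u0
    by (intro exI[of _ "\<tau> u u"] exI[of _ u]) (simp add: add_3 scale_3)
qed

section \<open>Topology of the projection\<close>

lemma is_form_cast: "is_form d h \<Longrightarrow> d = e \<Longrightarrow> is_form e h"
  by simp

lemma span_Un_span: "vec.span (vec.span A \<union> vec.span B) = vec.span (A \<union> B)"
proof (rule subset_antisym)
  have "vec.span A \<subseteq> vec.span (A \<union> B)" "vec.span B \<subseteq> vec.span (A \<union> B)" by (simp_all add: vec.span_mono)
  then show "vec.span (vec.span A \<union> vec.span B) \<subseteq> vec.span (A \<union> B)"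
    by (intro vec.span_minimal) simp_all
  have "A \<union> B \<subseteq> vec.span A \<union> vec.span B" using vec.span_superset by blast
  then show "vec.span (A \<union> B) \<subseteq> vec.span (vec.span A \<union> vec.span B)" by (rule vec.span_mono)
qed

lemma proj_from_span: "proj_from (vec.span {u}) (vec.span {x}) = vec.span {u, x}"
  unfolding proj_from_def span_Un_span by (simp add: insert_commute)

lemma span_pair_iff: "v \<in> vec.span {u, x} \<longleftrightarrow> (\<exists>a b. v = a *s u + b *s x)"
  for u x v :: "complex^'n"
proof
  assume "v \<in> vec.span {u, x}"
  then obtain a where "v - a *s u \<in> vec.span {x}" by (auto simp: vec.span_breakdown_eq)
  then obtain b where "v - a *s u = b *s x" by (auto simp: vec.span_singleton)
  then have "v = a *s u + b *s x" by (simp add: algebra_simps)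
  then show "\<exists>a b. v = a *s u + b *s x" by blast
next
  assume "\<exists>a b. v = a *s u + b *s x"
  then obtain a b where "v = a *s u + b *s x" by blast
  then show "v \<in> vec.span {u, x}" by (simp add: vec.span_add vec.span_scale vec.span_base)
qed

lemma span_pair_eq:
  fixes u x v :: "complex^'n"
  assumes "v = a *s u + b *s x" "b \<noteq> 0"
  shows "vec.span {u, v} = vec.span {u, x}"
proof (rule subset_antisym)
  have "v \<in> vec.span {u, x}" unfolding span_pair_iff using assms(1) by blast
  then show "vec.span {u, v} \<subseteq> vec.span {u, x}"
    by (intro vec.span_minimal) (simp_all add: vec.span_base)
  have "x = (- a / b) *s u + inverse b *s v"
    using assms by (simp add: vec.scale_right_distrib field_simps)
  then have "x \<in> vec.span {u, v}" unfolding span_pair_iff by blast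
  then show "vec.span {u, x} \<subseteq> vec.span {u, v}"
    by (intro vec.span_minimal) (simp_all add: vec.span_base)
qed

lemma continuous_on_scale_vec:
  fixes h :: "'a::topological_space \<Rightarrow> complex" and g :: "'a \<Rightarrow> complex^'n"
  assumes "continuous_on S h" "continuous_on S g"
  shows "continuous_on S (\<lambda>x. h x *s g x)"
  unfolding vector_scalar_mult_def using assms
  by (intro continuous_on_vec_lambda continuous_intros) auto

lemma span_quotient_map: "quotient_map (top_of_set (- {0})) analytic_topology (\<lambda>v. vec.span {v})"
  unfolding analytic_topology_def by (rule quotient_map_quotient_topology)

section \<open>Polarizations as continuous functions and as forms\<close>

lemma (in cubic_polarization) continuous_on_tau:
  assumes "continuous_on S (h :: 'b::topological_space \<Rightarrow> complex^4)"
  shows "continuous_on S (\<lambda>x. \<tau> a b (h x))"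
  unfolding coordinates_3[of a b "h _"] using assms by (intro continuous_intros)

lemma (in cubic_polarization) continuous_on_tau2:
  assumes "continuous_on S (h :: 'b::topological_space \<Rightarrow> complex^4)"
  shows "continuous_on S (\<lambda>x. \<tau> a (h x) (h x))"
  unfolding coordinates_23[of a "h _" "h _"] using assms by (intro continuous_intros)

lemma (in cubic_polarization) coordinates_1: "\<tau> x y z = (\<Sum>i\<in>UNIV. x $ i * \<tau> (axis i 1) y z)"
  using coordinates_2[of y x z] by (simp only: commute_12[of _ y])

lemma (in cubic_polarization) continuous_on_tau3:
  assumes "continuous_on S (h :: 'b::topological_space \<Rightarrow> complex^4)"
  shows "continuous_on S (\<lambda>x. \<tau> (h x) (h x) (h x))"
  unfolding coordinates_1[of "h _"] by (intro continuous_intros continuous_on_tau2 assms)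

lemma (in cubic_polarization) is_form_tau: "is_form 1 (\<lambda>x. \<tau> a b x)"
proof -
  have "is_form 1 (\<lambda>x. \<Sum>k\<in>UNIV. \<tau> a b (axis k 1) * x $ k)"
    by (intro is_form_sum is_form_scale is_form_coordinate)
  moreover have "(\<lambda>x. \<Sum>k\<in>UNIV. \<tau> a b (axis k 1) * x $ k) = (\<lambda>x. \<tau> a b x)"
  proof
    show "(\<Sum>k\<in>UNIV. \<tau> a b (axis k 1) * x $ k) = \<tau> a b x" for x
      by (subst coordinates_3[of a b x]) (simp only: mult.commute[of "x $ _"])
  qed
  ultimately show ?thesis by (simp only:)
qed

lemma (in cubic_polarization) is_form_tau2: "is_form 2 (\<lambda>x. \<tau> a x x)"
proof -
  have "is_form (1 + 1) (\<lambda>x. \<Sum>k\<in>UNIV. x $ k * \<tau> a (axis k 1) x)"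
    by (intro is_form_sum is_form_mult is_form_coordinate is_form_tau)
  moreover have "(\<lambda>x. \<Sum>k\<in>UNIV. x $ k * \<tau> a (axis k 1) x) = (\<lambda>x. \<tau> a x x)"
    by (rule ext) (rule coordinates_2[symmetric])
  ultimately show ?thesis by (simp only: one_add_one)
qed

lemma (in cubic_polarization) is_form_tau3: "is_form 3 (\<lambda>x. \<tau> x x x)"
proof -
  have "is_form (1 + 2) (\<lambda>x. \<Sum>k\<in>UNIV. x $ k * \<tau> (axis k 1) x x)"
    by (intro is_form_sum is_form_mult is_form_coordinate is_form_tau2)
  moreover have "(\<lambda>x. \<Sum>k\<in>UNIV. x $ k * \<tau> (axis k 1) x x) = (\<lambda>x. \<tau> x x x)"
    by (rule ext) (rule coordinates_1[symmetric])
  ultimately have "is_form (1 + 2) (\<lambda>x. \<tau> x x x)" by (simp only:)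
  then show ?thesis by (rule is_form_cast) simp
qed

context polarized_cubic
begin

definition "plane_part x = x - lam x *s u"
text \<open>Composition with \<open>plane_part\<close> extends the discriminant from the polar plane
  to the whole space, in such a way that its vanishing depends only on the line joining the point to
  \<open>L\<close>.\<close>

definition "D x = discr (p (plane_part x)) (q (plane_part x))"
definition "L = vec.span {u}"
text \<open>Normalized representatives of lines: each line in \<open>U\<close> contains exactly one
  vector with \<open>lam = 0\<close> and \<open>phi = 1\<close>, so loops of lines can be handled as
  loops of vectors.\<close>

definition "base = {v. lam v = 0 \<and> phi v = 1 \<and> D v \<noteq> 0}"
definition "U = (\<lambda>v. vec.span {u, v}) ` base"
definition "X = {x \<in> proj_space. \<forall>v\<in>x. f v = 0}"

lemma plane_part_simps: "lam (plane_part x) = 0" "phi (plane_part x) = phi x" "lam v = 0 \<Longrightarrow> plane_part v = v" "x = plane_part x + lam x *s u"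
  by (simp_all add: plane_part_def lam_simps phi_simps)

lemma p_scale: "p (k *s v) = k ^ 2 * p v" and q_scale: "q (k *s v) = k ^ 3 * q v"
  by (simp_all add: p_def q_def expand power2_eq_square power3_eq_cube)

lemma plane_part_line: "plane_part (a *s u + b *s x) = b *s plane_part x"
  by (simp add: plane_part_def lam_simps vec.scale_left_distrib vec.scale_right_diff_distrib)

lemma D_line: "D (a *s u + b *s x) = b ^ 6 * D x"
  unfolding D_def plane_part_line p_scale q_scale discr_def
  by (simp add: power_mult_distrib algebra_simps flip: power_mult)

lemma D_scale: "D (b *s x) = b ^ 6 * D x"
  using D_line[of 0 b x] by simp

text \<open>Expresses the discriminant through \<open>lam\<close>, \<open>\<tau> u x x\<close> and
  \<open>f\<close>, forms of degrees \<open>1\<close>, \<open>2\<close> and \<open>3\<close>, so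
  that the closure rules recognize \<open>D\<close> as a form of degree \<open>6\<close>.\<close>

lemma D_eq: "D x = discr (3 * (\<tau> u x x - lam x ^ 2)) (f x - 3 * lam x * \<tau> u x x + 2 * lam x ^ 3)"
proof -
  have "p (plane_part x) = 3 * (\<tau> u x x - lam x ^ 2)"
    by (simp add: p_def plane_part_def expand commute_23[of u x u] unit lam_simps(4) power2_eq_square flip: lam_def)
  moreover have "q (plane_part x) = f x - 3 * lam x * \<tau> u x x + 2 * lam x ^ 3"
  proof -
    have "\<tau> x x u = \<tau> u x x" using commute_12 commute_23 by metis
    moreover have "\<tau> x u u = lam x" using commute_12 commute_23 unfolding lam_def by metis
    moreover have "q (plane_part x) = f (x + (- lam x) *s u)" by (simp add: q_def plane_part_def f_def)
    ultimately show ?thesis unfolding f_add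
      by (simp add: f_def unit power2_eq_square power3_eq_cube)
  qed
  ultimately show ?thesis by (simp add: D_def)
qed

lemma is_form_phi: "is_form 1 phi"
proof -
  have "is_form 1 (\<lambda>x. inverse (\<tau> u e e) * \<tau> u e x)" by (intro is_form_scale is_form_tau)
  then show ?thesis by (simp add: phi_def[abs_def] divide_inverse mult.commute)
qed

lemma is_form_D: "is_form 6 D"
proof -
  have lam: "is_form 1 lam" unfolding lam_def[abs_def] by (rule is_form_tau)
  have f: "is_form 3 f" unfolding f_def[abs_def] by (rule is_form_tau3)
  have P: "is_form 2 (\<lambda>x. \<tau> u x x + (-1) * lam x ^ 2)"
    by (intro is_form_add is_form_tau2 is_form_scale is_form_cast[OF is_form_power[OF lam]]) simp
  have Q: "is_form 3 (\<lambda>x. f x + ((-3) * (lam x * \<tau> u x x) + 2 * lam x ^ 3))"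
    by (intro is_form_add f is_form_scale is_form_cast[OF is_form_mult[OF lam is_form_tau2]]
        is_form_cast[OF is_form_power[OF lam]]) simp_all
  have "is_form 6 (\<lambda>x. (-4) * (3 * (\<tau> u x x + (-1) * lam x ^ 2)) ^ 3 +
     (-27) * (f x + ((-3) * (lam x * \<tau> u x x) + 2 * lam x ^ 3)) ^ 2)"
    by (intro is_form_add is_form_scale is_form_cast[OF is_form_power[OF is_form_scale[OF P]]]
        is_form_cast[OF is_form_power[OF Q]]) simp_all
  moreover have "(\<lambda>x. (-4) * (3 * (\<tau> u x x + (-1) * lam x ^ 2)) ^ 3 +
     (-27) * (f x + ((-3) * (lam x * \<tau> u x x) + 2 * lam x ^ 3)) ^ 2) = D"
    by (rule ext) (simp add: D_eq discr_def algebra_simps)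
  ultimately show ?thesis by simp
qed

lemma continuous_on_lam: "continuous_on S h \<Longrightarrow> continuous_on S (\<lambda>x. lam (h x))"
  for h :: "'b::topological_space \<Rightarrow> complex^4"
  unfolding lam_def by (rule continuous_on_tau)

lemma continuous_on_phi: "continuous_on S h \<Longrightarrow> continuous_on S (\<lambda>x. phi (h x))"
  for h :: "'b::topological_space \<Rightarrow> complex^4"
  unfolding phi_def divide_inverse by (intro continuous_on_mult continuous_on_tau continuous_on_const)

lemma continuous_on_plane_part: "continuous_on S h \<Longrightarrow> continuous_on S (\<lambda>x. plane_part (h x))"
  for h :: "'b::topological_space \<Rightarrow> complex^4"
  unfolding plane_part_def
  by (intro continuous_on_diff continuous_on_scale_vec continuous_on_lam continuous_on_const)

lemma continuous_on_p: "continuous_on S h \<Longrightarrow> continuous_on S (\<lambda>x. p (h x))"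
  for h :: "'b::topological_space \<Rightarrow> complex^4"
  unfolding p_def by (intro continuous_on_mult continuous_on_tau2 continuous_on_const)

lemma continuous_on_q: "continuous_on S h \<Longrightarrow> continuous_on S (\<lambda>x. q (h x))"
  for h :: "'b::topological_space \<Rightarrow> complex^4"
  unfolding q_def by (rule continuous_on_tau3)

lemma continuous_on_D: "continuous_on S D"
  unfolding D_def[abs_def] discr_def
  by (intro continuous_on_diff continuous_on_mult continuous_on_power continuous_on_const
      continuous_on_p continuous_on_q continuous_on_plane_part continuous_on_id)

lemma in_U_iff: "vec.span {u, x} \<in> U \<longleftrightarrow> phi x \<noteq> 0 \<and> D x \<noteq> 0"
proof
  assume "vec.span {u, x} \<in> U"
  then obtain v where v: "v \<in> base" "vec.span {u, x} = vec.span {u, v}" by (auto simp: U_def)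
  have "v \<in> vec.span {u, x}" unfolding v(2) by (simp add: vec.span_base)
  then obtain a b where ab: "v = a *s u + b *s x" unfolding span_pair_iff by blast
  have "phi v = b * phi x" by (simp add: ab phi_simps)
  moreover have "D v = b ^ 6 * D x" unfolding ab by (rule D_line)
  ultimately show "phi x \<noteq> 0 \<and> D x \<noteq> 0" using v(1) by (auto simp: base_def)
next
  assume x: "phi x \<noteq> 0 \<and> D x \<noteq> 0"
  define v where "v = inverse (phi x) *s plane_part x"
  have v: "v = (- lam x / phi x) *s u + inverse (phi x) *s x"
    by (simp add: v_def plane_part_def vec.scale_right_diff_distrib divide_inverse mult.commute)
  have "D v = inverse (phi x) ^ 6 * D x" unfolding v by (rule D_line)
  then have "v \<in> base" using x by (simp add: base_def v_def lam_simps phi_simps plane_part_simps)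
  moreover have "vec.span {u, v} = vec.span {u, x}" using span_pair_eq[OF v] x by simp
  ultimately show "vec.span {u, x} \<in> U" unfolding U_def by (metis imageI)
qed

lemma u_nonzero: "u \<noteq> 0"
  using unit zero_1 by force

lemma L_proj: "L \<in> proj_space"
  unfolding L_def using u_nonzero by (rule span_singleton_in_proj_space)

lemma span_neq_L: "phi x \<noteq> 0 \<Longrightarrow> vec.span {x} \<noteq> L"
proof
  assume "phi x \<noteq> 0" "vec.span {x} = L"
  then have "x \<in> vec.span {u}" unfolding L_def by (metis insertI1 vec.span_base)
  then show False using \<open>phi x \<noteq> 0\<close> by (auto simp: vec.span_singleton phi_simps)
qed

lemma proj_from_in_U_iff:
  assumes "pt \<in> proj_space"
  shows "proj_from L pt \<in> U \<longleftrightarrow> (\<exists>x\<in>pt. phi x \<noteq> 0) \<and> (\<exists>x\<in>pt. D x \<noteq> 0)"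
proof -
  obtain x where x: "x \<noteq> 0" "pt = vec.span {x}" using assms by (rule proj_spaceE)
  have "(\<exists>y\<in>pt. phi y \<noteq> 0) \<longleftrightarrow> phi x \<noteq> 0" "(\<exists>y\<in>pt. D y \<noteq> 0) \<longleftrightarrow> D x \<noteq> 0"
    unfolding x(2) by (auto simp: vec.span_singleton phi_simps D_scale intro: exI[of _ "1 :: complex"])
  then show ?thesis unfolding x(2) L_def proj_from_span in_U_iff by simp
qed

text \<open>The set of points over \<open>U\<close> is the intersection \<open>Z\<close> of two
  basic open sets. For density, a neighbourhood of a line pulls back to a nonempty Zariski-open set
  of points, which meets \<open>Z\<close> by irreducibility; the point of \<open>e\<close> shows
  that \<open>Z\<close> is not empty.\<close>

lemma zariski_open_U: "openin (lines_zariski L) U"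
  and zariski_dense_U: "D e \<noteq> 0 \<Longrightarrow> (lines_zariski L) closure_of U = lines_through L"
proof -
  define Z where "Z = {pt \<in> proj_space. \<exists>v\<in>pt. phi v \<noteq> 0} \<inter> {pt \<in> proj_space. \<exists>v\<in>pt. D v \<noteq> 0}"
  have Z_open: "openin zariski_topology Z"
    unfolding Z_def by (intro openin_Int openin_zariski_nonzero_form[OF is_form_phi] openin_zariski_nonzero_form[OF is_form_D])
  have Z: "pt \<in> Z \<longleftrightarrow> pt \<in> proj_space \<and> pt \<noteq> L \<and> proj_from L pt \<in> U" for pt
  proof -
    have "pt \<noteq> L" if "v \<in> pt" "phi v \<noteq> 0" for v
      using that by (auto simp: L_def vec.span_singleton phi_simps)
    then show ?thesis using proj_from_in_U_iff[of pt] by (auto simp: Z_def)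
  qed
  have top: "topspace (subtopology zariski_topology (- {L})) = proj_space - {L}"
    by (auto simp: topspace_zariski_topology)
  show "openin (lines_zariski L) U"
    unfolding lines_zariski_def openin_quotient_topology top
  proof
    show "U \<subseteq> proj_from L ` (proj_space - {L})"
    proof
      fix l assume "l \<in> U"
      then obtain v where v: "v \<in> base" "l = vec.span {u, v}" by (auto simp: U_def)
      then have "phi v \<noteq> 0" by (simp add: base_def)
      then have "v \<noteq> 0" by (auto simp: phi_simps)
      with \<open>phi v \<noteq> 0\<close> have "vec.span {v} \<in> proj_space - {L}"
        using span_neq_L span_singleton_in_proj_space by auto
      moreover have "l = proj_from L (vec.span {v})" unfolding v(2) L_def proj_from_span ..
      ultimately show "l \<in> proj_from L ` (proj_space - {L})" by blast
    qed
    have "{x \<in> proj_space - {L}. proj_from L x \<in> U} = Z \<inter> - {L}" using Z by auto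
    then show "openin (subtopology zariski_topology (- {L})) {x \<in> proj_space - {L}. proj_from L x \<in> U}"
      using Z_open by (auto simp: openin_subtopology)
  qed
  show "(lines_zariski L) closure_of U = lines_through L" if De: "D e \<noteq> 0"
  proof (rule subset_antisym)
    show "lines_zariski L closure_of U \<subseteq> lines_through L"
      using closure_of_subset_topspace topspace_lines(2)[OF L_proj] by metis
    show "lines_through L \<subseteq> lines_zariski L closure_of U"
    proof
      fix l assume l: "l \<in> lines_through L"
      have "\<exists>y\<in>U. y \<in> T" if T: "l \<in> T" "openin (lines_zariski L) T" for T
      proof -
        define T' where "T' = {x \<in> proj_space - {L}. proj_from L x \<in> T}"
        have sub: "T \<subseteq> proj_from L ` (proj_space - {L})"
          and T'_open: "openin (subtopology zariski_topology (- {L})) T'"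
          using T(2) unfolding lines_zariski_def openin_quotient_topology top T'_def by auto
        have "T' \<noteq> {}" using T(1) sub unfolding T'_def by blast
        moreover obtain Y where Y: "openin zariski_topology Y" "T' = Y \<inter> - {L}"
          using T'_open unfolding openin_subtopology by blast
        ultimately have "Y \<noteq> {}" by auto
        moreover have "vec.span {e} \<in> Z"
        proof -
          have "e \<noteq> 0" using phi_simps(5,6) by force
          then have "vec.span {e} \<in> proj_space" by (rule span_singleton_in_proj_space)
          moreover have "proj_from L (vec.span {e}) \<in> U"
            unfolding L_def proj_from_span in_U_iff using De by (simp add: phi_simps)
          ultimately show ?thesis using Z span_neq_L[of e] by (simp add: phi_simps)
        qed
        ultimately have "Y \<inter> Z \<noteq> {}" using zariski_open_Int_nonempty[OF Y(1) Z_open] by blast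
        then obtain pt where pt: "pt \<in> Y" "pt \<in> Z" by blast
        then have "pt \<in> T'" using Y(2) Z by auto
        then show ?thesis using pt Z by (auto simp: T'_def)
      qed
      then show "l \<in> lines_zariski L closure_of U"
        using l unfolding closure_of_def topspace_lines(2)[OF L_proj] by blast
    qed
  qed
qed

section \<open>Affine coordinates on points and on lines\<close>

definition chart :: "(complex^4) set set" where
  "chart = {pt \<in> proj_space. pt \<noteq> L \<and> proj_from L pt \<in> U}"

text \<open>The representative of a point with \<open>phi = 1\<close>, which exists and is unique on
  the chart. It replaces classes of vectors by actual vectors, as \<open>kap_line\<close> does for
  lines.\<close>

definition kap :: "(complex^4) set \<Rightarrow> complex^4" where
  "kap pt = (THE x. x \<in> pt \<and> phi x = 1)"

definition kap_line :: "(complex^4) set \<Rightarrow> complex^4" where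
  "kap_line l = (THE v. v \<in> l \<and> lam v = 0 \<and> phi v = 1)"

lemma kap_span: "phi x \<noteq> 0 \<Longrightarrow> kap (vec.span {x}) = inverse (phi x) *s x"
  unfolding kap_def by (rule the_equality) (auto simp: vec.span_singleton phi_simps field_simps)

lemma kap_line_span: "phi x \<noteq> 0 \<Longrightarrow> kap_line (vec.span {u, x}) = inverse (phi x) *s plane_part x"
proof -
  assume x: "phi x \<noteq> 0"
  have eq: "inverse (phi x) *s plane_part x = (- lam x / phi x) *s u + inverse (phi x) *s x"
    by (simp add: plane_part_def vec.scale_right_diff_distrib divide_inverse mult.commute)
  show ?thesis
    unfolding kap_line_def
  proof (rule the_equality)
    show "inverse (phi x) *s plane_part x \<in> vec.span {u, x} \<and> lam (inverse (phi x) *s plane_part x) = 0 \<and>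
        phi (inverse (phi x) *s plane_part x) = 1"
    proof (intro conjI)
      show "inverse (phi x) *s plane_part x \<in> vec.span {u, x}" unfolding span_pair_iff using eq by blast
    qed (use x in \<open>simp_all add: lam_simps(3) phi_simps(3) plane_part_simps(1,2)\<close>)
    fix v assume v: "v \<in> vec.span {u, x} \<and> lam v = 0 \<and> phi v = 1"
    then obtain a b where ab: "v = a *s u + b *s x" unfolding span_pair_iff by blast
    have "v = plane_part v" using v plane_part_simps(3) by simp
    also have "\<dots> = b *s plane_part x" unfolding ab by (rule plane_part_line)
    finally have vb: "v = b *s plane_part x" .
    have "b * phi x = 1" using v unfolding ab by (simp add: phi_simps)
    then have "b = inverse (phi x)" using x by (simp add: field_simps)
    with vb show "v = inverse (phi x) *s plane_part x" by simp
  qed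
qed

lemma kap_line_base: "v \<in> base \<Longrightarrow> kap_line (vec.span {u, v}) = v"
  by (simp add: kap_line_span base_def plane_part_simps)

lemma chartE:
  assumes "pt \<in> chart"
  obtains x where "pt = vec.span {x}" "phi x = 1" "D x \<noteq> 0" "kap pt = x" "kap_line (proj_from L pt) = plane_part x"
proof -
  from assms obtain y where y: "pt = vec.span {y}" by (auto simp: chart_def elim: proj_spaceE)
  then have yU: "phi y \<noteq> 0" "D y \<noteq> 0" using assms in_U_iff[of y] by (auto simp: chart_def L_def proj_from_span)
  define x where "x = inverse (phi y) *s y"
  have phix: "phi x = 1" using yU by (simp add: x_def phi_simps)
  have pt: "pt = vec.span {x}"
    using yU vec.span_image_scale[of "{y}" "\<lambda>_. inverse (phi y)"] by (simp add: y x_def)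
  show thesis
  proof (rule that[OF pt phix])
    show "D x \<noteq> 0" using yU by (simp add: x_def D_scale)
    show "kap pt = x" unfolding pt using kap_span[of x] phix by simp
    show "kap_line (proj_from L pt) = plane_part x" unfolding pt L_def proj_from_span using kap_line_span[of x] phix by simp
  qed
qed

lemma chart_preimage: "{x \<in> - {0}. vec.span {x} \<in> chart} = {x. phi x \<noteq> 0 \<and> D x \<noteq> 0}"
  using in_U_iff span_neq_L phi_simps(6)
  by (auto simp: chart_def L_def proj_from_span intro!: span_singleton_in_proj_space)

lemma open_chart: "openin analytic_topology chart"
proof -
  have "chart \<subseteq> (\<lambda>v. vec.span {v}) ` (- {0})" by (auto simp: chart_def proj_space_eq)
  moreover have "open {x. phi x \<noteq> 0 \<and> D x \<noteq> 0}"
  proof -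
    have "{x. phi x \<noteq> 0 \<and> D x \<noteq> 0} = {x. phi x \<noteq> 0} \<inter> {x. D x \<noteq> 0}" by auto
    then show ?thesis
      using continuous_on_phi[OF continuous_on_id, of UNIV] continuous_on_D[of UNIV]
      by (auto intro!: open_Int open_Collect_neq continuous_intros)
  qed
  then have "openin (top_of_set (- {0})) {x. phi x \<noteq> 0 \<and> D x \<noteq> 0}"
    by (intro open_subset) (auto simp: phi_simps(6))
  ultimately show ?thesis
    unfolding analytic_topology_def openin_quotient_topology topspace_euclidean_subtopology chart_preimage by simp
qed

text \<open>The chart is open, so its topology is again a quotient of a set of vectors, and
  continuity can be checked for the formula \<open>inverse (phi x) *s x\<close>.\<close>

lemma continuous_kap: "continuous_map (subtopology analytic_topology chart) euclidean kap"
proof -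
  have q: "quotient_map (subtopology (top_of_set (- {0})) {x \<in> topspace (top_of_set (- {0})). vec.span {x} \<in> chart})
     (subtopology analytic_topology chart) (\<lambda>v. vec.span {v})"
    using span_quotient_map open_chart by (intro quotient_map_restriction) auto
  have eq: "subtopology (top_of_set (- {0})) {x \<in> topspace (top_of_set (- {0})). vec.span {x} \<in> chart} =
     top_of_set {x. phi x \<noteq> 0 \<and> D x \<noteq> 0}"
  proof -
    have "- {0} \<inter> {x. phi x \<noteq> 0 \<and> D x \<noteq> 0} = {x. phi x \<noteq> 0 \<and> D x \<noteq> 0}" by (auto simp: phi_simps(6))
    then show ?thesis
      by (simp only: topspace_euclidean_subtopology chart_preimage subtopology_subtopology)
  qed
  have "continuous_on {x. phi x \<noteq> 0 \<and> D x \<noteq> 0} (\<lambda>x. inverse (phi x) *s x)"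
    by (intro continuous_on_scale_vec continuous_intros continuous_on_phi) auto
  then have "continuous_on {x. phi x \<noteq> 0 \<and> D x \<noteq> 0} (kap \<circ> (\<lambda>v. vec.span {v}))"
    by (rule continuous_on_eq) (simp add: kap_span)
  then show ?thesis
    using continuous_compose_quotient_map_eq[OF q, of euclidean kap] unfolding eq by simp
qed

lemma lines_quotient_map:
  "quotient_map (subtopology analytic_topology (- {L})) (lines_analytic L) (proj_from L)"
  unfolding lines_analytic_def by (rule quotient_map_quotient_topology)

lemma analytic_open_U: "openin (lines_analytic L) U"
proof -
  have top: "topspace (subtopology analytic_topology (- {L})) = proj_space - {L}"
    by (auto simp: topspace_analytic_topology)
  have "U \<subseteq> proj_from L ` (proj_space - {L})"
    using openin_subset[OF zariski_open_U] topspace_lines(2)[OF L_proj] proj_from_image[OF L_proj] by simp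
  moreover have "{x \<in> proj_space - {L}. proj_from L x \<in> U} = chart \<inter> - {L}" by (auto simp: chart_def)
  then have "openin (subtopology analytic_topology (- {L})) {x \<in> proj_space - {L}. proj_from L x \<in> U}"
    using open_chart by (auto simp: openin_subtopology)
  ultimately show ?thesis unfolding lines_analytic_def openin_quotient_topology top by blast
qed

lemma continuous_kap_line: "continuous_map (base_over L U) euclidean kap_line"
proof -
  have top: "{x \<in> topspace (subtopology analytic_topology (- {L})). proj_from L x \<in> U} = chart"
    by (auto simp: topspace_analytic_topology chart_def)
  have q: "quotient_map (subtopology (subtopology analytic_topology (- {L})) chart)
     (subtopology (lines_analytic L) U) (proj_from L)"
    using quotient_map_restriction[OF lines_quotient_map top] analytic_open_U by blast
  have "- {L} \<inter> chart = chart" by (auto simp: chart_def)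
  then have eq: "subtopology (subtopology analytic_topology (- {L})) chart = subtopology analytic_topology chart"
    by (simp add: subtopology_subtopology)
  have "continuous_map euclidean euclidean plane_part" using continuous_on_plane_part[OF continuous_on_id, of UNIV] by simp
  with continuous_kap have "continuous_map (subtopology analytic_topology chart) euclidean (plane_part \<circ> kap)"
    by (rule continuous_map_compose)
  then have "continuous_map (subtopology analytic_topology chart) euclidean (kap_line \<circ> proj_from L)"
  proof (rule continuous_map_eq)
    fix pt assume "pt \<in> topspace (subtopology analytic_topology chart)"
    then have "pt \<in> chart" by simp
    then show "(plane_part \<circ> kap) pt = (kap_line \<circ> proj_from L) pt" by (rule chartE) simp
  qed
  then show ?thesis
    using continuous_compose_quotient_map_eq[OF q, of euclidean kap_line] unfolding eq base_over_def by simp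
qed

end

section \<open>The covering and its monodromy\<close>

context polarized_cubic
begin

lemma L_notin_X: "L \<notin> X"
proof
  assume "L \<in> X"
  then have "f u = 0" by (simp add: X_def L_def vec.span_base)
  then show False by (simp add: f_def unit)
qed

lemma chart_if_part: "pt \<in> X \<Longrightarrow> proj_from L pt \<in> U \<Longrightarrow> pt \<in> chart"
  using L_notin_X by (auto simp: chart_def X_def)

lemma topspace_part: "topspace (part_over X L U) = {pt \<in> X. proj_from L pt \<in> U}"
  by (auto simp: part_over_def topspace_analytic_topology X_def)

lemma topspace_base: "topspace (base_over L U) = U"
  using openin_subset[OF analytic_open_U] by (auto simp: base_over_def)

lemma span_in_X: "x \<noteq> 0 \<Longrightarrow> f x = 0 \<Longrightarrow> vec.span {x} \<in> X"
  using span_singleton_in_proj_space[of x] by (auto simp: X_def vec.span_singleton f_scale)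

lemma span_point:
  assumes v: "v \<in> base" and t: "dcubic (p v) (q v) t = 0"
  shows "vec.span {v + t *s u} \<in> topspace (part_over X L U)"
    and "proj_from L (vec.span {v + t *s u}) = vec.span {u, v}"
    and "kap (vec.span {v + t *s u}) = v + t *s u" "lam (v + t *s u) = t"
proof -
  have lv: "lam v = 0" "phi v = 1" using v by (simp_all add: base_def)
  show pr: "proj_from L (vec.span {v + t *s u}) = vec.span {u, v}"
    unfolding L_def proj_from_span by (rule span_pair_eq[of _ t _ 1]) simp_all
  have ph: "phi (v + t *s u) = 1" by (simp add: phi_simps lv)
  then have "v + t *s u \<noteq> 0" by (auto simp: phi_simps(6))
  moreover have "f (v + t *s u) = 0" using f_dcubic[OF lv(1)] t by simp
  ultimately have "vec.span {v + t *s u} \<in> X" by (rule span_in_X)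
  moreover have "vec.span {u, v} \<in> U" using v by (simp add: U_def)
  ultimately show "vec.span {v + t *s u} \<in> topspace (part_over X L U)"
    unfolding topspace_part pr by (simp add: pr)
  show "kap (vec.span {v + t *s u}) = v + t *s u" using kap_span[of "v + t *s u"] ph by simp
  show "lam (v + t *s u) = t" by (simp add: lam_simps lv)
qed

lemma part_point:
  assumes "pt \<in> topspace (part_over X L U)"
  obtains v t where "v \<in> base" "pt = vec.span {v + t *s u}" "dcubic (p v) (q v) t = 0"
    "kap pt = v + t *s u" "kap_line (proj_from L pt) = v" "lam (kap pt) = t"
proof -
  have pt: "pt \<in> X" "pt \<in> chart" using assms chart_if_part by (auto simp: topspace_part)
  obtain x where x: "pt = vec.span {x}" "phi x = 1" "D x \<noteq> 0" "kap pt = x" "kap_line (proj_from L pt) = plane_part x"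
    using pt(2) by (rule chartE)
  have xe: "x = plane_part x + lam x *s u" by (rule plane_part_simps(4))
  have "D (plane_part x) = D x" using D_line[of "- lam x" 1 x] by (simp add: plane_part_def)
  then have b: "plane_part x \<in> base" using x by (simp add: base_def plane_part_simps)
  have "f x = 0" using pt(1) x(1) by (simp add: X_def vec.span_base)
  then have "dcubic (p (plane_part x)) (q (plane_part x)) (lam x) = 0"
    using f_dcubic[OF plane_part_simps(1), of x "lam x"] xe by simp
  from that[OF b _ this] show thesis using x xe by simp
qed

lemma continuous_map_span:
  assumes "continuous_map A (top_of_set S) h" "\<And>v. v \<in> S \<Longrightarrow> phi v \<noteq> 0"
  shows "continuous_map A analytic_topology (\<lambda>a. vec.span {h a})"
proof -
  have "0 \<notin> S" using assms(2)[of 0] phi_simps(6) by auto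
  then have "continuous_map A (top_of_set (- {0})) h"
    using assms(1) by (fastforce simp: continuous_map_in_subtopology Pi_iff)
  from continuous_map_compose[OF this quotient_imp_continuous_map[OF span_quotient_map]]
  show ?thesis by (simp add: o_def)
qed

lemma base_discr: "v \<in> base \<Longrightarrow> discr (p v) (q v) \<noteq> 0"
  by (auto simp: base_def D_def plane_part_simps(3))

lemma base_over_point:
  assumes "l \<in> U"
  obtains v where "v \<in> base" "l = vec.span {u, v}" "kap_line l = v"
  using assms kap_line_base by (auto simp: U_def)

text \<open>A point of the surface over the line of \<open>v\<close> in \<open>base\<close> has the
  normalized representative \<open>v + t *s u\<close> with \<open>t\<close> a root of the cubic at
  \<open>v\<close>. So \<open>lam (kap pt)\<close> is the root coordinate, and the projection is a
  pullback of the covering by roots.\<close>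

lemma covering: "covering_map (part_over X L U) (base_over L U) (proj_from L)"
proof (rule covering_map_dcubic[where t = "\<lambda>pt. lam (kap pt)" and P = "\<lambda>l. p (kap_line l)" and Q = "\<lambda>l. q (kap_line l)"
      and j = "\<lambda>l t. vec.span {kap_line l + t *s u}"])
  have part_sub: "part_over X L U = subtopology (subtopology analytic_topology (- {L})) {pt \<in> X. proj_from L pt \<in> U}"
  proof -
    have "- {L} \<inter> {pt \<in> X. proj_from L pt \<in> U} = {pt \<in> X. proj_from L pt \<in> U}" using L_notin_X by auto
    then show ?thesis by (simp add: part_over_def subtopology_subtopology)
  qed
  show "continuous_map (part_over X L U) (base_over L U) (proj_from L)"
    unfolding part_sub base_over_def continuous_map_in_subtopology
    using quotient_imp_continuous_map[OF lines_quotient_map]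
    by (auto intro: continuous_map_from_subtopology)
  have "continuous_map (part_over X L U) euclidean kap"
  proof -
    have "{pt \<in> X. proj_from L pt \<in> U} \<subseteq> chart" using chart_if_part by auto
    then show ?thesis unfolding part_over_def
      by (rule continuous_map_from_subtopology_mono[OF continuous_kap])
  qed
  moreover have "continuous_map euclidean euclidean lam" using continuous_on_lam[OF continuous_on_id, of UNIV] by simp
  ultimately have "continuous_map (part_over X L U) euclidean (lam \<circ> kap)" by (rule continuous_map_compose)
  then show "continuous_map (part_over X L U) euclidean (\<lambda>pt. lam (kap pt))" by (simp add: o_def)
  have "continuous_map euclidean euclidean p" "continuous_map euclidean euclidean q"
    using continuous_on_p[OF continuous_on_id, of UNIV] continuous_on_q[OF continuous_on_id, of UNIV] by simp_all
  then have "continuous_map (base_over L U) euclidean (p \<circ> kap_line)" "continuous_map (base_over L U) euclidean (q \<circ> kap_line)"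
    using continuous_kap_line by (auto intro: continuous_map_compose)
  then show "continuous_map (base_over L U) euclidean (\<lambda>l. p (kap_line l))"
    "continuous_map (base_over L U) euclidean (\<lambda>l. q (kap_line l))" by (simp_all add: o_def)
  show "discr (p (kap_line l)) (q (kap_line l)) \<noteq> 0" if "l \<in> topspace (base_over L U)" for l
    using that base_discr unfolding topspace_base by (elim base_over_point) simp
  show "dcubic (p (kap_line (proj_from L pt))) (q (kap_line (proj_from L pt))) (lam (kap pt)) = 0"
    "vec.span {kap_line (proj_from L pt) + lam (kap pt) *s u} = pt" if "pt \<in> topspace (part_over X L U)" for pt
    using that by (elim part_point; simp)+
  show "vec.span {kap_line l + t *s u} \<in> topspace (part_over X L U) \<and> proj_from L (vec.span {kap_line l + t *s u}) = l \<and>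
      lam (kap (vec.span {kap_line l + t *s u})) = t"
    if l: "l \<in> topspace (base_over L U)" and t: "dcubic (p (kap_line l)) (q (kap_line l)) t = 0" for l t
  proof -
    obtain v where v: "v \<in> base" "l = vec.span {u, v}" "kap_line l = v"
      using l unfolding topspace_base by (rule base_over_point)
    show ?thesis using span_point[OF v(1) t[unfolded v(3)]] by (simp only: v(3) v(2)[symmetric] simp_thms)
  qed
  fix T r
  assume T: "openin (base_over L U) T" "continuous_map (subtopology (base_over L U) T) euclidean r"
    "\<And>l. l \<in> T \<Longrightarrow> dcubic (p (kap_line l)) (q (kap_line l)) (r l) = 0"
  have TU: "T \<subseteq> U" using openin_subset[OF T(1)] by (simp add: topspace_base)
  have top: "topspace (subtopology (base_over L U) T) = T" using TU by (auto simp: topspace_base)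
  have kl: "continuous_map (subtopology (base_over L U) T) euclidean kap_line"
    using continuous_kap_line by (rule continuous_map_from_subtopology)
  have pairs: "continuous_map (subtopology (base_over L U) T) euclidean (\<lambda>l. (kap_line l, r l))"
    using continuous_map_pairedI[OF kl T(2)] by simp
  have "continuous_on UNIV (\<lambda>a :: (complex^4) \<times> complex. fst a + snd a *s u)"
    by (intro continuous_intros continuous_on_scale_vec)
  then have "continuous_map euclidean euclidean (\<lambda>a :: (complex^4) \<times> complex. fst a + snd a *s u)" by simp
  from continuous_map_compose[OF pairs this]
  have c: "continuous_map (subtopology (base_over L U) T) euclidean (\<lambda>l. kap_line l + r l *s u)" by (simp add: o_def)
  have ph: "phi (kap_line l + r l *s u) = 1" if "l \<in> T" for l
  proof -
    have "l \<in> U" using that TU by auto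
    then obtain v where "v \<in> base" "kap_line l = v" by (rule base_over_point)
    then show ?thesis by (simp add: phi_simps base_def)
  qed
  have "continuous_map (subtopology (base_over L U) T) (top_of_set {x. phi x = 1}) (\<lambda>l. kap_line l + r l *s u)"
    unfolding continuous_map_in_subtopology top using c ph by auto
  then have "continuous_map (subtopology (base_over L U) T) analytic_topology (\<lambda>l. vec.span {kap_line l + r l *s u})"
    by (rule continuous_map_span) simp
  moreover have "vec.span {kap_line l + r l *s u} \<in> {pt \<in> X. proj_from L pt \<in> U}" if "l \<in> T" for l
  proof -
    have "l \<in> U" using that TU by auto
    then obtain v where v: "v \<in> base" "l = vec.span {u, v}" "kap_line l = v" by (rule base_over_point)
    show ?thesis using span_point(1)[OF v(1) T(3)[OF that, unfolded v(3)]] unfolding topspace_part v(3) .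
  qed
  ultimately show "continuous_map (subtopology (base_over L U) T) (part_over X L U) (\<lambda>l. vec.span {kap_line l + r l *s u})"
    unfolding part_over_def continuous_map_in_subtopology top by auto
qed

definition "sheet v t = vec.span {v + t *s u}"

lemma fibre_eq:
  assumes v: "v \<in> base"
  shows "{pt \<in> topspace (part_over X L U). proj_from L pt = vec.span {u, v}} = sheet v ` root_set (p v, q v)"
    and "inj_on (sheet v) (root_set (p v, q v))"
proof -
  show "{pt \<in> topspace (part_over X L U). proj_from L pt = vec.span {u, v}} = sheet v ` root_set (p v, q v)"
  proof (rule subset_antisym)
    show "{pt \<in> topspace (part_over X L U). proj_from L pt = vec.span {u, v}} \<subseteq> sheet v ` root_set (p v, q v)"
    proof
      fix pt assume pt: "pt \<in> {pt \<in> topspace (part_over X L U). proj_from L pt = vec.span {u, v}}"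
      then have "pt \<in> topspace (part_over X L U)" by simp
      then obtain v' t where *: "v' \<in> base" "pt = vec.span {v' + t *s u}" "dcubic (p v') (q v') t = 0"
          "kap_line (proj_from L pt) = v'" by (rule part_point)
      have "v' = v" using pt *(4) kap_line_base[OF v] by simp
      then show "pt \<in> sheet v ` root_set (p v, q v)" using * by (auto simp: sheet_def root_set_def)
    qed
    show "sheet v ` root_set (p v, q v) \<subseteq> {pt \<in> topspace (part_over X L U). proj_from L pt = vec.span {u, v}}"
      using span_point(1,2)[OF v] by (auto simp: sheet_def root_set_def)
  qed
  show "inj_on (sheet v) (root_set (p v, q v))"
  proof (rule inj_onI)
    fix s t assume st: "s \<in> root_set (p v, q v)" "t \<in> root_set (p v, q v)" "sheet v s = sheet v t"
    then have "dcubic (p v) (q v) s = 0" "dcubic (p v) (q v) t = 0" by (simp_all add: root_set_def)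
    note a = span_point(3,4)[OF v this(1)] and b = span_point(3,4)[OF v this(2)]
    have "v + s *s u = v + t *s u" using a(1) b(1) st(3) unfolding sheet_def by metis
    then show "s = t" using a(2) b(2) by metis
  qed
qed

lemma fibre_eq':
  assumes "v \<in> base"
  shows "{pt \<in> X. proj_from L pt = vec.span {u, v}} = sheet v ` root_set (p v, q v)"
proof -
  have "vec.span {u, v} \<in> U" using assms by (simp add: U_def)
  then have "{pt \<in> X. proj_from L pt = vec.span {u, v}} = {pt \<in> topspace (part_over X L U). proj_from L pt = vec.span {u, v}}"
    by (auto simp: topspace_part)
  with fibre_eq(1)[OF assms] show ?thesis by simp
qed

lemma etale_covering:
  assumes "D e \<noteq> 0"
  shows "etale_covering_over 3 X L U"
  unfolding etale_covering_over_def
proof (intro conjI ballI zariski_open_U zariski_dense_U[OF assms] covering)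
  fix y assume "y \<in> U"
  then obtain v where v: "v \<in> base" "y = vec.span {u, v}" by (rule base_over_point)
  have "(p v, q v) \<in> root_base" using base_discr[OF v(1)] by (simp add: root_base_def)
  then obtain a b c where "root_set (p v, q v) = {a, b, c}" "a \<noteq> b" "a \<noteq> c" "b \<noteq> c" by (rule root_set_eq)
  then have "card (root_set (p v, q v)) = 3" by simp
  then show "card {x \<in> X. proj_from L x = y} = 3"
    unfolding v(2) fibre_eq'[OF v(1)] by (simp add: card_image[OF fibre_eq(2)[OF v(1)]])
qed

section \<open>Monodromy on roots and loops along lines through the base point\<close>

definition "pq_at v = (p v, q v)"

text \<open>Monodromy expressed on roots, for loops of vectors in \<open>base\<close>. It contains
  the monodromy over every line through \<open>e\<close> with direction in \<open>V\<close>, and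
  these lines are what the conditions on a small group are tested on.\<close>

definition "M = {\<sigma>. \<sigma> permutes root_set (pq_at e) \<and>
   (\<exists>\<gamma>. path \<gamma> \<and> path_image \<gamma> \<subseteq> base \<and> \<gamma> 0 = e \<and> \<gamma> 1 = e \<and> induces (pq_at \<circ> \<gamma>) \<sigma>)}"

lemma M_comp:
  assumes "\<sigma> \<in> M" "\<sigma>' \<in> M"
  shows "\<sigma>' \<circ> \<sigma> \<in> M"
proof -
  from assms(1) obtain \<gamma> where s: "\<sigma> permutes root_set (pq_at e)" and g: "path \<gamma>" "path_image \<gamma> \<subseteq> base" "\<gamma> 0 = e" "\<gamma> 1 = e"
    "induces (pq_at \<circ> \<gamma>) \<sigma>" unfolding M_def by blast
  from assms(2) obtain \<gamma>' where s': "\<sigma>' permutes root_set (pq_at e)" and g': "path \<gamma>'" "path_image \<gamma>' \<subseteq> base" "\<gamma>' 0 = e" "\<gamma>' 1 = e"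
    "induces (pq_at \<circ> \<gamma>') \<sigma>'" unfolding M_def by blast
  have "induces ((pq_at \<circ> \<gamma>) +++ (pq_at \<circ> \<gamma>')) (\<sigma>' \<circ> \<sigma>)"
    by (rule induces_join[OF g(5) g'(5)]) (simp_all add: g g' s)
  then have "induces (pq_at \<circ> (\<gamma> +++ \<gamma>')) (\<sigma>' \<circ> \<sigma>)" by (simp only: path_compose_join)
  moreover have "path (\<gamma> +++ \<gamma>')" using g g' by (intro path_join_imp) (simp_all add: pathstart_def pathfinish_def)
  moreover have "path_image (\<gamma> +++ \<gamma>') \<subseteq> base" using g(2) g'(2) by (rule subset_path_image_join)
  moreover have "(\<gamma> +++ \<gamma>') 0 = e" "(\<gamma> +++ \<gamma>') 1 = e" using g g' by (simp_all add: joinpaths_def)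
  moreover have "\<sigma>' \<circ> \<sigma> permutes root_set (pq_at e)" using s s' by (rule permutes_compose)
  ultimately show ?thesis unfolding M_def by blast
qed

lemma line_in_base:
  assumes "w \<in> V" "discr (p (e + z *s w)) (q (e + z *s w)) \<noteq> 0"
  shows "e + z *s w \<in> base"
  using assms by (simp add: base_def V_def lam_simps phi_simps D_def plane_part_simps(3))

lemma line_pencil:
  assumes "w \<in> V"
  shows "cubic_pencil.P (p e) (p w) z = p (e + z *s w)"
    and "cubic_pencil.Q (q e) (3 * \<tau> e e w) (3 * \<tau> e w w) (q w) z = q (e + z *s w)"
  using p_line[OF assms, of z] q_line[of z w] by (simp_all add: cubic_pencil.P_def cubic_pencil.Q_def)

lemma line_loop:
  assumes w: "w \<in> V" and r: "path r" "path_image r \<subseteq> {z. discr (p (e + z *s w)) (q (e + z *s w)) \<noteq> 0}" "r 0 = 0" "r 1 = 0"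
    and s: "\<sigma> permutes root_set (pq_at e)" "induces ((\<lambda>z. pq_at (e + z *s w)) \<circ> r) \<sigma>"
  shows "\<sigma> \<in> M"
proof -
  define \<gamma> where "\<gamma> t = e + r t *s w" for t
  have "path \<gamma>" using r(1) unfolding path_def \<gamma>_def by (intro continuous_intros continuous_on_scale_vec)
  moreover have "path_image \<gamma> \<subseteq> base" using r(2) line_in_base[OF w] by (auto simp: path_image_def \<gamma>_def)
  moreover have "\<gamma> 0 = e" "\<gamma> 1 = e" using r by (simp_all add: \<gamma>_def)
  moreover have "pq_at \<circ> \<gamma> = (\<lambda>z. pq_at (e + z *s w)) \<circ> r" by (simp add: fun_eq_iff \<gamma>_def)
  ultimately show ?thesis using s unfolding M_def by (metis (mono_tags, lifting) mem_Collect_eq)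
qed

lemma line_setup:
  assumes w: "w \<in> V" and De: "D e \<noteq> 0"
  defines "K \<equiv> {z. discr (p (e + z *s w)) (q (e + z *s w)) = 0}"
  shows "finite K" "0 \<notin> K" "continuous_on (- K) (\<lambda>z. pq_at (e + z *s w))"
    "(\<lambda>z. pq_at (e + z *s w)) ` (- K) \<subseteq> root_base"
    "K = cubic_pencil.K (p e) (p w) (q e) (3 * \<tau> e e w) (3 * \<tau> e w w) (q w)"
proof -
  show Keq: "K = cubic_pencil.K (p e) (p w) (q e) (3 * \<tau> e e w) (3 * \<tau> e w w) (q w)"
    unfolding K_def cubic_pencil.K_def line_pencil[OF w] ..
  show K0: "0 \<notin> K" using De by (simp add: K_def D_def plane_part_simps(3) lam_simps)
  then show "finite K" unfolding Keq by (rule cubic_pencil.finite_K)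
  show "continuous_on (- K) (\<lambda>z. pq_at (e + z *s w))"
    unfolding pq_at_def line_pencil[OF w, symmetric] by (rule cubic_pencil.continuous_PQ)
  show "(\<lambda>z. pq_at (e + z *s w)) ` (- K) \<subseteq> root_base"
    by (auto simp: K_def root_base_def pq_at_def)
qed

lemma pq_at_e: "D e \<noteq> 0 \<Longrightarrow> pq_at e \<in> root_base"
  by (simp add: pq_at_def root_base_def D_def plane_part_simps(3) lam_simps)

text \<open>A root fixed by \<open>M\<close> returns to itself along every loop in the punctured
  line, hence continues to a global root there, which is linear with the slope required for
  gluing.\<close>

lemma reducible_if_M_fixes_root:
  assumes De: "D e \<noteq> 0" and t: "t \<in> root_set (pq_at e)" and fixed: "\<And>\<sigma>. \<sigma> \<in> M \<Longrightarrow> \<sigma> t = t"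
  shows "reducible_cubic f"
proof (rule reducible_if_fixed_root)
  fix w z assume w: "w \<in> V"
  define K where "K = {z. discr (p (e + z *s w)) (q (e + z *s w)) = 0}"
  note line_facts = line_setup[OF w De, folded K_def]
  let ?f = "\<lambda>z. pq_at (e + z *s w)"
  have t0: "t \<in> root_set (?f 0)" using t by simp
  obtain g where g: "continuous_on (- K) g" "\<And>z. z \<notin> K \<Longrightarrow> g z \<in> root_set (?f z)" "g 0 = t"
  proof (rule global_root[OF line_facts(1-4) t0])
    fix r h assume r: "path r" "path_image r \<subseteq> - K" "r 0 = 0" "r 1 = 0" and h: "root_path (?f \<circ> r) h" "h 0 = t"
    have fr: "path (?f \<circ> r)" "path_image (?f \<circ> r) \<subseteq> root_base"
      using r line_facts(3,4) by (auto simp: path_image_compose intro!: path_continuous_image continuous_on_subset[OF line_facts(3)])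
    have cl: "(?f \<circ> r) 1 = (?f \<circ> r) 0" and r0: "(?f \<circ> r) 0 = pq_at e" using r by simp_all
    obtain \<sigma> where s: "\<sigma> permutes root_set (pq_at e)" "induces (?f \<circ> r) \<sigma>"
      using induces_exists[OF fr cl] unfolding r0 by blast
    have "path_image r \<subseteq> {z. discr (p (e + z *s w)) (q (e + z *s w)) \<noteq> 0}" using r(2) by (auto simp: K_def)
    then have "\<sigma> \<in> M" by (rule line_loop[OF w r(1) _ r(3,4) s])
    then have st: "\<sigma> t = t" by (rule fixed)
    obtain h' where h': "root_path (?f \<circ> r) h'" "h' 0 = t" "h' 1 = \<sigma> t"
      using s(2) t unfolding induces_def r0 by blast
    have "h 1 = h' 1" by (rule root_path_unique[OF fr h(1) h'(1), of 0]) (simp_all add: h h')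
    then show "h 1 = t" using h'(3) st by simp
  qed (rule that)
  have K0: "0 \<notin> cubic_pencil.K (p e) (p w) (q e) (3 * \<tau> e e w) (3 * \<tau> e w w) (q w)"
    using line_facts(2) unfolding line_facts(5) .
  have "dcubic (p (e + z *s w)) (q (e + z *s w)) (g 0 - 3 * \<tau> e e w / (3 * g 0 ^ 2 + p e) * z) = 0"
    using cubic_pencil.linear_root[OF K0, of g z] g(1,2)
    unfolding line_facts(5)[symmetric] line_pencil[OF w] pq_at_def by blast
  then show "dcubic (p (e + z *s w)) (q (e + z *s w)) (t - 3 * \<tau> e e w / (3 * t ^ 2 + p e) * z) = 0"
    unfolding g(3) .
qed

text \<open>Preservation of the Vandermonde product makes the square root of the discriminant
  single-valued on each line. All these square roots start at the same value at \<open>e\<close>, so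
  their linear coefficients are one constant times \<open>\<tau> e e w\<close>.\<close>

lemma cyclic_if_M_even:
  assumes De: "D e \<noteq> 0" and abc: "root_set (pq_at e) = {a, b, c}" "a \<noteq> b" "a \<noteq> c" "b \<noteq> c"
    and even: "\<And>\<sigma>. \<sigma> \<in> M \<Longrightarrow> vandermonde (\<sigma> a) (\<sigma> b) (\<sigma> c) = vandermonde a b c"
  shows "cyclic_cubic f"
proof (rule cyclic_if_square_discriminant)
  fix w assume w: "w \<in> V"
  define K where "K = {z. discr (p (e + z *s w)) (q (e + z *s w)) = 0}"
  note line_facts = line_setup[OF w De, folded K_def]
  let ?f = "\<lambda>z. pq_at (e + z *s w)"
  have abc0: "root_set (?f 0) = {a, b, c}" using abc(1) by simp
  obtain s where s: "continuous_on (- K) s" "\<And>z. z \<notin> K \<Longrightarrow> s z ^ 2 = discr (fst (?f z)) (snd (?f z))"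
    "s 0 = vandermonde a b c"
  proof (rule global_sqrt_discr[OF line_facts(1-4) abc0 abc(2-4)])
    fix r \<sigma> assume r: "path r" "path_image r \<subseteq> - K" "r 0 = 0" "r 1 = 0" and
      s: "induces (?f \<circ> r) \<sigma>" "\<sigma> permutes {a, b, c}"
    have "path_image r \<subseteq> {z. discr (p (e + z *s w)) (q (e + z *s w)) \<noteq> 0}" using r(2) by (auto simp: K_def)
    then have "\<sigma> \<in> M" by (rule line_loop[OF w r(1) _ r(3,4) s(2)[folded abc(1)] s(1)])
    then show "vandermonde (\<sigma> a) (\<sigma> b) (\<sigma> c) = vandermonde a b c" by (rule even)
  qed (rule that)
  have K0: "0 \<notin> cubic_pencil.K (p e) (p w) (q e) (3 * \<tau> e e w) (3 * \<tau> e w w) (q w)"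
    using line_facts(2) unfolding line_facts(5) .
  have sq: "s z ^ 2 = discr (p (e + z *s w)) (q (e + z *s w))" if "z \<notin> K" for z
    using s(2)[OF that] by (simp add: pq_at_def)
  obtain s\<^sub>2 s\<^sub>3 where "\<And>z. (s 0 - 27 * q e * (3 * \<tau> e e w) / s 0 * z + s\<^sub>2 * z ^ 2 + s\<^sub>3 * z ^ 3) ^ 2 =
      discr (p (e + z *s w)) (q (e + z *s w))"
    using cubic_pencil.cubic_sqrt[OF K0, of s] s(1) sq
    unfolding line_facts(5)[symmetric] line_pencil[OF w] by blast
  \<comment> \<open>The factor \<open>81\<close> is \<open>27 * 3\<close>, the \<open>3\<close>
    coming from the linear coefficient \<open>3 * \<tau> e e w\<close> of \<open>q\<close>. Constant
    term and factor are the same for every \<open>w\<close>.\<close>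
  then have "\<forall>z. (vandermonde a b c + (- 81 * q e / vandermonde a b c) * \<tau> e e w * z + s\<^sub>2 * z ^ 2 + s\<^sub>3 * z ^ 3) ^ 2 =
      discr (p (e + z *s w)) (q (e + z *s w))"
    unfolding s(3) by (simp add: mult_ac)
  then show "\<exists>s\<^sub>2 s\<^sub>3. \<forall>z. (vandermonde a b c + (- 81 * q e / vandermonde a b c) * \<tau> e e w * z + s\<^sub>2 * z ^ 2 + s\<^sub>3 * z ^ 3) ^ 2 =
      discr (p (e + z *s w)) (q (e + z *s w))" by blast
qed

lemma M_eq:
  assumes De: "D e \<noteq> 0" and "\<not> reducible_cubic f" "\<not> cyclic_cubic f"
  shows "M = {\<sigma>. \<sigma> permutes root_set (pq_at e)}"
proof -
  obtain a b c where abc: "root_set (pq_at e) = {a, b, c}" "a \<noteq> b" "a \<noteq> c" "b \<noteq> c"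
    by (rule root_set_eq[OF pq_at_e[OF De]])
  have "M = {\<sigma>. \<sigma> permutes {a, b, c}}"
  proof (rule symmetric_group_three[OF abc(2-4)])
    show "\<sigma> permutes {a, b, c}" if "\<sigma> \<in> M" for \<sigma> using that unfolding M_def abc(1) by blast
    show "\<tau> \<circ> \<sigma> \<in> M" if "\<sigma> \<in> M" "\<tau> \<in> M" for \<sigma> \<tau> using that by (rule M_comp)
    show "\<exists>\<sigma>\<in>M. \<sigma> x \<noteq> x" if "x \<in> {a, b, c}" for x
      using reducible_if_M_fixes_root[OF De, of x] that assms(2) abc(1) by blast
    show "\<exists>\<sigma>\<in>M. vandermonde (\<sigma> a) (\<sigma> b) (\<sigma> c) \<noteq> vandermonde a b c"
      using cyclic_if_M_even[OF De abc] assms(3) by blast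
  qed
  then show ?thesis unfolding abc(1) .
qed

section \<open>From root paths back to paths on the surface\<close>

lemma path_sheet:
  assumes g: "path \<gamma>" "path_image \<gamma> \<subseteq> base" and h: "root_path (pq_at \<circ> \<gamma>) h"
  shows "pathin (part_over X L U) (\<lambda>s. sheet (\<gamma> s) (h s))"
proof -
  have "continuous_on {0..1} (\<lambda>s. \<gamma> s + h s *s u)"
    using g(1) h unfolding path_def root_path_def by (intro continuous_intros continuous_on_scale_vec) auto
  moreover have gb: "\<gamma> s \<in> base" if "s \<in> {0..1}" for s using g(2) that by (auto simp: path_image_def)
  then have "phi (\<gamma> s + h s *s u) = 1" if "s \<in> {0..1}" for s
    using gb[OF that] by (simp add: phi_simps base_def)
  ultimately have "continuous_map (top_of_set {0..1}) (top_of_set {x. phi x = 1}) (\<lambda>s. \<gamma> s + h s *s u)"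
    by (auto simp: continuous_map_subtopology_eu)
  then have "continuous_map (top_of_set {0..1}) analytic_topology (\<lambda>s. vec.span {\<gamma> s + h s *s u})"
    by (rule continuous_map_span) simp
  moreover have "vec.span {\<gamma> s + h s *s u} \<in> {pt \<in> X. proj_from L pt \<in> U}" if "s \<in> {0..1}" for s
    using span_point(1)[OF gb[OF that], of "h s"] h that
    unfolding topspace_part by (simp add: root_path_def pq_at_def)
  ultimately show ?thesis
    unfolding pathin_def sheet_def part_over_def continuous_map_in_subtopology by auto
qed

lemma path_line:
  assumes g: "path \<gamma>" "path_image \<gamma> \<subseteq> base"
  shows "pathin (base_over L U) (\<lambda>s. vec.span {u, \<gamma> s})"
proof -
  have gb: "\<gamma> s \<in> base" if "s \<in> {0..1}" for s using g(2) that by (auto simp: path_image_def)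
  then have "continuous_map (top_of_set {0..1}) (top_of_set {x. phi x = 1}) \<gamma>"
    using g(1) by (auto simp: continuous_map_subtopology_eu path_def base_def)
  then have "continuous_map (top_of_set {0..1}) analytic_topology (\<lambda>s. vec.span {\<gamma> s})"
    by (rule continuous_map_span) simp
  moreover have "vec.span {\<gamma> s} \<in> - {L}" if "s \<in> {0..1}" for s
    using span_neq_L[of "\<gamma> s"] gb[OF that] by (simp add: base_def)
  ultimately have "continuous_map (top_of_set {0..1}) (subtopology analytic_topology (- {L})) (\<lambda>s. vec.span {\<gamma> s})"
    unfolding continuous_map_in_subtopology by auto
  from continuous_map_compose[OF this quotient_imp_continuous_map[OF lines_quotient_map]]
  have "continuous_map (top_of_set {0..1}) (lines_analytic L) (\<lambda>s. vec.span {u, \<gamma> s})"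
    by (simp add: o_def L_def proj_from_span)
  moreover have "vec.span {u, \<gamma> s} \<in> U" if "s \<in> {0..1}" for s using gb[OF that] by (simp add: U_def)
  ultimately show ?thesis unfolding pathin_def base_over_def continuous_map_in_subtopology by auto
qed

text \<open>A permutation of the fibre is carried by \<open>sheet\<close> to a permutation of the
  roots, which belongs to \<open>M\<close>. The loop realizing it spans a loop of lines, and its
  root paths span the lifts on the surface.\<close>

lemma uniform:
  assumes De: "D e \<noteq> 0" and nr: "\<not> reducible_cubic f" and nc: "\<not> cyclic_cubic f"
  shows "uniform_point 3 X L"
  unfolding uniform_point_def
proof (intro exI conjI)
  let ?y = "vec.span {u, e}" and ?R = "root_set (pq_at e)"
  show "etale_covering_over 3 X L U" by (rule etale_covering[OF De])
  have e: "e \<in> base" using De by (simp add: base_def lam_simps phi_simps)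
  then show yU: "?y \<in> U" by (simp add: U_def)
  let ?F = "{x \<in> X. proj_from L x = ?y}" and ?F' = "{x \<in> topspace (part_over X L U). proj_from L x = ?y}"
  have F: "?F = sheet e ` ?R" "?F' = sheet e ` ?R" and inj: "inj_on (sheet e) ?R"
    using fibre_eq[OF e] fibre_eq'[OF e] by (simp_all add: pq_at_def)
  have "\<sigma> \<in> monodromy_group (part_over X L U) (base_over L U) (proj_from L) ?y" if \<sigma>: "\<sigma> permutes ?F" for \<sigma>
  proof -
    define J where "J = inv_into ?R (sheet e)"
    define \<sigma>' where "\<sigma>' t = (if t \<in> ?R then J (\<sigma> (sheet e t)) else t)" for t
    have \<sigma>F: "\<sigma> (sheet e t) \<in> sheet e ` ?R" if "t \<in> ?R" for t
      using permutes_in_image[OF \<sigma>, of "sheet e t"] that unfolding F by simp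
    have sJ: "sheet e (\<sigma>' t) = \<sigma> (sheet e t)" if "t \<in> ?R" for t
      using that \<sigma>F[OF that] by (simp add: \<sigma>'_def J_def f_inv_into_f)
    have maps: "\<sigma>' ` ?R \<subseteq> ?R" using \<sigma>F by (auto simp: \<sigma>'_def J_def inv_into_into)
    have "inj_on \<sigma>' ?R"
    proof (rule inj_onI)
      fix s t assume st: "s \<in> ?R" "t \<in> ?R" "\<sigma>' s = \<sigma>' t"
      then have "\<sigma> (sheet e s) = \<sigma> (sheet e t)" using sJ by metis
      then have "sheet e s = sheet e t" using permutes_inj[OF \<sigma>] by (simp add: inj_eq)
      then show "s = t" using inj st by (simp add: inj_on_eq_iff)
    qed
    then have "bij_betw \<sigma>' ?R ?R"
      using endo_inj_surj[OF finite_root_set[OF pq_at_e[OF De]] maps] by (simp add: bij_betw_def)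
    then have "\<sigma>' permutes ?R" by (rule bij_imp_permutes) (simp add: \<sigma>'_def)
    then have "\<sigma>' \<in> M" using M_eq[OF De nr nc] by blast
    then obtain \<gamma> where g: "path \<gamma>" "path_image \<gamma> \<subseteq> base" "\<gamma> 0 = e" "\<gamma> 1 = e" "induces (pq_at \<circ> \<gamma>) \<sigma>'"
      unfolding M_def by blast
    have "\<exists>\<delta>. pathin (part_over X L U) \<delta> \<and> (\<forall>s\<in>{0..1}. proj_from L (\<delta> s) = vec.span {u, \<gamma> s}) \<and> \<delta> 0 = x \<and> \<delta> 1 = \<sigma> x"
      if "x \<in> topspace (part_over X L U)" "proj_from L x = ?y" for x
    proof -
      have "x \<in> sheet e ` ?R" using that F(2) by blast
      then obtain t where t: "t \<in> ?R" "x = sheet e t" by blast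
      then obtain h where h: "root_path (pq_at \<circ> \<gamma>) h" "h 0 = t" "h 1 = \<sigma>' t"
        using g(5) unfolding induces_def by (auto simp: g(3))
      have "proj_from L (sheet (\<gamma> s) (h s)) = vec.span {u, \<gamma> s}" if s: "s \<in> {0..1}" for s
      proof -
        have "\<gamma> s \<in> base" using g(2) s by (auto simp: path_image_def)
        moreover have "dcubic (p (\<gamma> s)) (q (\<gamma> s)) (h s) = 0" using h(1) s by (simp add: root_path_def pq_at_def)
        ultimately show ?thesis unfolding sheet_def by (rule span_point(2))
      qed
      then show ?thesis
        using path_sheet[OF g(1,2) h(1)] h g t sJ[OF t(1)]
        by (intro exI[of _ "\<lambda>s. sheet (\<gamma> s) (h s)"]) simp
    qed
    then show ?thesis
      unfolding monodromy_group_def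
      using \<sigma> F path_line[OF g(1,2)] g(3,4) by (intro CollectI conjI exI[of _ "\<lambda>s. vec.span {u, \<gamma> s}"]) auto
  qed
  moreover have "monodromy_group (part_over X L U) (base_over L U) (proj_from L) ?y \<subseteq> {\<sigma>. \<sigma> permutes ?F}"
    unfolding monodromy_group_def F by blast
  ultimately show "monodromy_group (part_over X L U) (base_over L U) (proj_from L) ?y = {\<sigma>. \<sigma> permutes ?F}"
    by blast
qed

text \<open>The present \<open>e\<close> may have a vanishing discriminant. If every point of the
  polar plane with \<open>p\<close> nonzero had one, the discriminant would vanish on all lines
  through \<open>e\<close> with direction in \<open>V\<close>, since \<open>p\<close> has only
  finitely many zeros on each; zero would then be a polynomial square root, and the cubic would be
  cyclic.\<close>

lemma unramified_point_exists:
  assumes nc: "\<not> cyclic_cubic f"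
  obtains v where "lam v = 0" "p v \<noteq> 0" "discr (p v) (q v) \<noteq> 0"
proof -
  have "\<exists>v. lam v = 0 \<and> p v \<noteq> 0 \<and> discr (p v) (q v) \<noteq> 0"
  proof (rule ccontr)
    assume *: "\<not> ?thesis"
    have pe: "p e \<noteq> 0" using e_nonzero by (simp add: p_def)
    have zero: "discr (p (e + z *s w)) (q (e + z *s w)) = 0" if w: "w \<in> V" for w z
    proof (rule ccontr)
      assume nz: "discr (p (e + z *s w)) (q (e + z *s w)) \<noteq> 0"
      define K where "K = cubic_pencil.K (p e) (p w) (q e) (3 * \<tau> e e w) (3 * \<tau> e w w) (q w)"
      have "z \<notin> K" using nz unfolding K_def cubic_pencil.K_def line_pencil[OF w] by simp
      then have "finite K" unfolding K_def by (rule cubic_pencil.finite_K)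
      moreover have "finite {z. poly [:p e, 0, p w:] z = 0}" using pe by (intro poly_roots_finite) simp
      ultimately have "finite (K \<union> {z. poly [:p e, 0, p w:] z = 0})" by simp
      from ex_new_if_finite[OF infinite_UNIV_char_0 this]
      obtain z' where z': "z' \<notin> K" "poly [:p e, 0, p w:] z' \<noteq> 0" by auto
      have "p (e + z' *s w) \<noteq> 0" using z'(2) unfolding p_line[OF w] by (simp add: power2_eq_square mult_ac)
      moreover have "discr (p (e + z' *s w)) (q (e + z' *s w)) \<noteq> 0"
        using z'(1) unfolding K_def cubic_pencil.K_def line_pencil[OF w] by simp
      moreover have "lam (e + z' *s w) = 0" using w by (simp add: lam_simps V_def)
      ultimately show False using * by blast
    qed
    have "cyclic_cubic f"
    proof (rule cyclic_if_square_discriminant[of 0 0])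
      fix w assume "w \<in> V"
      then show "\<exists>s\<^sub>2 s\<^sub>3. \<forall>z. (0 + 0 * \<tau> e e w * z + s\<^sub>2 * z ^ 2 + s\<^sub>3 * z ^ 3) ^ 2 = discr (p (e + z *s w)) (q (e + z *s w))"
        using zero by (intro exI[of _ 0]) simp
    qed
    with nc show False by blast
  qed
  then show thesis using that by blast
qed

end

lemma uniform_point_if_not_special:
  fixes c :: "complex^cubic_exponent" and u\<^sub>0 :: "complex^4"
  assumes nr: "\<not> reducible_cubic (cubic_form c)" and nc: "\<not> cyclic_cubic (cubic_form c)"
    and u\<^sub>0: "cubic_form c u\<^sub>0 \<noteq> 0"
  shows "uniform_point 3 {x \<in> proj_space. \<forall>v\<in>x. cubic_form c v = 0} (vec.span {u\<^sub>0})"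
proof -
  obtain \<tau> where \<tau>: "cubic_polarization \<tau>" "\<And>x. cubic_form c x = \<tau> x x x" using cubic_form_polarization by blast
  interpret cubic_polarization \<tau> by fact
  have cf: "cubic_form c = (\<lambda>x. \<tau> x x x)" using \<tau>(2) by blast
  \<comment> \<open>Splitting this pure cubic provides a cube root \<open>x\<close> of the inverse
    of the value at \<open>u\<^sub>0\<close>, by which \<open>u\<^sub>0\<close> is scaled to value
    \<open>1\<close>.\<close>
  obtain x y z where *: "\<And>t. t ^ 3 + 0 * t ^ 2 + 0 * t + (- inverse (\<tau> u\<^sub>0 u\<^sub>0 u\<^sub>0)) = (t - x) * (t - y) * (t - z)"
    using monic_cubic_splits[of 0 0 "- inverse (\<tau> u\<^sub>0 u\<^sub>0 u\<^sub>0)"] by metis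
  have x3: "x ^ 3 = inverse (\<tau> u\<^sub>0 u\<^sub>0 u\<^sub>0)" using *[of x] by simp
  define u where "u = x *s u\<^sub>0"
  have unit: "\<tau> u u u = 1" using x3 u\<^sub>0 by (simp add: u_def expand cf power3_eq_cube field_simps)
  have x0: "x \<noteq> 0" using x3 u\<^sub>0 by (auto simp: cf)
  have span: "vec.span {u\<^sub>0} = vec.span {u}"
    using vec.span_image_scale[of "{u\<^sub>0}" "\<lambda>_. x"] x0 by (simp add: u_def)
  obtain e\<^sub>0 where e0: "\<tau> u u e\<^sub>0 = 0" "\<tau> u e\<^sub>0 e\<^sub>0 \<noteq> 0"
    using cyclic_if_polar_vanishes[OF unit] nc unfolding cf by blast
  \<comment> \<open>This interpretation with a provisional base point serves to find a vector
    \<open>e\<close> with nonzero discriminant, with which the locale is then interpreted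
    again.\<close>
  interpret A: polarized_cubic \<tau> u e\<^sub>0 by unfold_locales (use unit e0 in auto)
  have "\<not> cyclic_cubic A.f" using nc by (simp add: cf A.f_def[abs_def])
  then obtain e where e: "A.lam e = 0" "A.p e \<noteq> 0" "discr (A.p e) (A.q e) \<noteq> 0"
    by (rule A.unramified_point_exists)
  interpret B: polarized_cubic \<tau> u e
    by unfold_locales (use unit e in \<open>auto simp: A.lam_def A.p_def\<close>)
  have "B.D e \<noteq> 0" using e(3) unfolding B.D_def B.plane_part_simps(3)[OF B.lam_simps(5)]
    by (simp add: B.p_def B.q_def A.p_def A.q_def)
  moreover have "\<not> reducible_cubic B.f" "\<not> cyclic_cubic B.f"
    using nr nc by (simp_all add: cf B.f_def[abs_def])
  ultimately have "uniform_point 3 B.X B.L" by (rule B.uniform)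
  then show ?thesis unfolding B.X_def B.L_def B.f_def cf span .
qed

lemma cubic_form_scale_parameter: "cubic_form (k *s c) v = k * cubic_form c v"
  by (simp add: cubic_form_def sum_distrib_left mult.assoc)

theorem proposition4p3:
  shows "\<exists>G :: (complex^cubic_exponent) set set.
           openin zariski_topology G \<and>
           zariski_topology closure_of G = proj_space \<and>
           (\<forall>C\<in>G. nonuniform_locus 3 (cubic_surface C) = {})"
proof -
  obtain G :: "(complex^cubic_exponent) set set" where G: "openin zariski_topology G"
    "zariski_topology closure_of G = proj_space"
    "\<And>C c. C \<in> G \<Longrightarrow> c \<in> C \<Longrightarrow> c \<noteq> 0 \<Longrightarrow> \<not> reducible_cubic (cubic_form c) \<and> \<not> cyclic_cubic (cubic_form c)"
    by (rule general_cubic) (rule that)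
  have "uniform_point 3 (cubic_surface C) L" if C: "C \<in> G" and L: "L \<in> proj_space" "L \<notin> cubic_surface C" for C L
  proof -
    obtain c v where cv: "c \<in> C" "v \<in> L" "cubic_form c v \<noteq> 0" using L by (auto simp: cubic_surface_def)
    have c0: "c \<noteq> 0" using cv(3) by (auto simp: cubic_form_def)
    have "cubic_form c 0 = 0"
    proof -
      obtain \<tau> where "cubic_polarization \<tau>" "\<And>x. cubic_form c x = \<tau> x x x" using cubic_form_polarization by blast
      then show ?thesis using cubic_polarization.zero_1 by metis
    qed
    then have v0: "v \<noteq> 0" using cv(3) by auto
    have "C \<in> proj_space" using C openin_subset[OF G(1)] by (auto simp: topspace_zariski_topology)
    then have Cs: "vec.span {c} = C" using cv(1) c0 by (rule span_singleton_eq)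
    have Ls: "vec.span {v} = L" using L(1) cv(2) v0 by (rule span_singleton_eq)
    have "cubic_surface C = {x \<in> proj_space. \<forall>v\<in>x. cubic_form c v = 0}"
      unfolding cubic_surface_def Cs[symmetric]
      by (auto simp: vec.span_singleton cubic_form_scale_parameter intro: exI[of _ "1 :: complex"])
    then show ?thesis
      using uniform_point_if_not_special[of c v] G(3)[OF C cv(1) c0] cv(3) by (simp add: Ls)
  qed
  then have "\<forall>C\<in>G. nonuniform_locus 3 (cubic_surface C) = {}" by (auto simp: nonuniform_locus_def)
  with G show ?thesis by blast
qed

end
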